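(* There exists $\widetilde\sigma_0>0$ such that every zero of $D$ with $\operatorname{Re}(s)\le-\widetilde\sigma_0$ is simple, and these zeros form two complex-conjugate sequences $\{\rho_m,\overline{\rho_m}\}_{m\ge m_0}$ (for some integer $m_0$) satisfying $$\rho_m=1-\frac{i\pi(2m+1)}{\mathcal{L}}+O(e^{-\kappa m})\qquad(m\ge m_0)$$ for some $\kappa>0$. In particular, the zeros recede along the two rays $\arg(1-s)=\pm\Theta$ (that is, $|\rho_m|\to\infty$ and the distance from $\rho_m$, respectively $\overline{\rho_m}$, to the corresponding ray tends to $0$), consecutive zeros on each string have limiting spacing $2\pi/|\mathcal{L}|$ (that is, $|\rho_{m+1}-\rho_m|\to2\pi/|\mathcal{L}|$ as $m\to\infty$), and, as $R\to\infty$, $$\Bigl|\{\rho\in\mathbb{C}:D(\rho)=0,\ \operatorname{Re}(\rho)<0,\ |\rho|\le R\}\Bigr|=\frac{|\mathcal{L}|}{\pi}\,R+O(1).$$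
   Context: Here $\zeta$ is the Riemann zeta function. $D$ is the function given by $D(s)=\sum_{n\ge1}\zeta(2n)\,n^{-s}$ for $\operatorname{Re}(s)>1$, continued meromorphically to $\mathbb{C}$ by $D(s)=\zeta(s)+E(s)$, where $E(s)=\sum_{n\ge1}(\zeta(2n)-1)n^{-s}$ converges absolutely for all $s\in\mathbb{C}$ and is entire; the only singularity of $D$ is a simple pole at $s=1$. The constants are $$\mathcal{L}=\log\frac{2\pi i}{2\log2}=\log\frac{\pi}{\log2}+\frac{i\pi}{2},\qquad \Theta=\frac{\pi}{2}-\arg\mathcal{L},$$ with the principal branch of the logarithm and the principal argument. *)

theory Defs
  imports "HOL-Complex_Analysis.Complex_Analysis" "HOL-Library.Landau_Symbols"
begin

text \<open>
  The analytic continuation of \<open>\<Sum>n\<ge>1. n\<^sup>-\<^sup>s\<close> to the complement of the pole \<open>s = 1\<close>, which is unique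
  by the identity theorem. The value at the pole is a convention and only serves to make the
  total function unique.
\<close>
definition zeta :: "complex \<Rightarrow> complex" where
  "zeta = (THE f. f holomorphic_on (- {1}) \<and> f 1 = 0 \<and>
     (\<forall>s. Re s > 1 \<longrightarrow> (\<lambda>n. of_nat (Suc n) powr (- s)) sums f s))"

text \<open>The summation index is shifted: \<open>Suc n\<close> runs through the positive integers.\<close>
definition E_fun :: "complex \<Rightarrow> complex" where
  "E_fun s = (\<Sum>n. (zeta (2 * of_nat (Suc n)) - 1) * of_nat (Suc n) powr (- s))"

text \<open>
  The meromorphic continuation of \<open>\<Sum>n\<ge>1. \<zeta>(2n) n\<^sup>-\<^sup>s\<close>. The value at the pole
  \<open>s = 1\<close> is meaningless.
\<close>
definition D_fun :: "complex \<Rightarrow> complex" where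
  "D_fun s = zeta s + E_fun s"

definition L_const :: complex where
  "L_const = Ln (2 * of_real pi * \<i> / (2 * of_real (ln 2)))"

definition Theta :: real where
  "Theta = pi / 2 - Arg L_const"

end

theory Submission
  imports Defs
begin

text \<open>
  Expanding \<open>\<zeta>(2n) - 1\<close> into powers \<open>k\<^sup>-\<^sup>2\<^sup>n\<close> writes \<open>D\<close> as the sum over \<open>k \<ge> 1\<close> of the polylogarithms
  \<open>Li\<^sub>s(k\<^sup>-\<^sup>2)\<close>, and the Lipschitz formula turns each of these into \<open>\<Gamma>(1-s)\<close> times the sum of
  \<open>(2 log k + 2\<pi>ij)\<^sup>s\<^sup>-\<^sup>1\<close> over the integers \<open>j\<close>. Far to the left with \<open>Im s \<le> 0\<close>, all other terms are exponentially
  small compared with the larger of \<open>(2 log 2)\<^sup>s\<^sup>-\<^sup>1\<close> and \<open>(2\<pi>i)\<^sup>s\<^sup>-\<^sup>1\<close>, so the zeros of \<open>D\<close>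
  are those of \<open>1 + exp((s-1)L)\<close> up to exponentially small shifts, by Rouche's theorem. The sum over \<open>k\<close>
  has to be cut at some \<open>K\<close> with \<open>log K > \<pi>\<close>; the tail is controlled by
  \<open>|\<Gamma>(x+iy)| \<ge> \<Gamma>(x) exp(-\<pi>y/2)\<close>, uniformly in \<open>y\<close>.

  The count of zeros with \<open>Re s < 0\<close> also needs that only finitely many of them lie in a strip
  \<open>-a \<le> Re s < 0\<close>. There \<open>E\<close> is bounded, whereas the functional equation and a lower bound for
  \<open>\<zeta>\<close> next to the line \<open>Re s = 1\<close>, from Mertens' \<open>3-4-1\<close> inequality, force \<open>|\<zeta>(s)|\<close> to tend to infinity.
\<close>

section \<open>Interchanging limits and infinite sums\<close>

text \<open>The condition on \<open>K\<close> arises because the tail of \<open>E_fun\<close> is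
  estimated by absolute values only: it is at most a multiple of Gamma(1 - Re s) (2 log K)^(Re s -
  1), blind to Im s. Dividing by Gamma(1-s) can cost a factor exp(pi |Im s| / 2), which is precisely
  the growth of |(2 pi i)^(s-1)| in the lower half-plane. That main term absorbs the loss, and the
  ratio (pi / log K)^(1 - Re s) remains. Restricting to Im s \<le> 0 breaks the tie between 2 pi i
  and -2 pi i; reflection recovers the other half. The ratio of the two main terms is exactly
  exp((s-1) L), which is where the constant L comes from. Since \<open>zeta\<close> is a definite
  description, its continuation has to be constructed; the Lipschitz formula serves for this too,
  and for Re s < 0 it yields the functional equation. Gamma enters through explicit inequalities
  instead of Stirling's formula, as the bounds must be uniform in the whole quadrant.\<close>

lemma infsum_holomorphic:
  fixes f :: "'i \<Rightarrow> complex \<Rightarrow> complex"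
  assumes S: "open S" and hol: "\<And>i. i \<in> I \<Longrightarrow> f i holomorphic_on S"
    and bd: "\<And>z. z \<in> S \<Longrightarrow> \<exists>r>0. \<exists>M. M summable_on I \<and> (\<forall>i\<in>I. \<forall>u\<in>S \<inter> cball z r. norm (f i u) \<le> M i)"
  shows "(\<lambda>z. \<Sum>\<^sub>\<infinity>i\<in>I. f i z) holomorphic_on S"
proof -
  have "\<exists>d>0. (\<lambda>z. \<Sum>\<^sub>\<infinity>i\<in>I. f i z) holomorphic_on ball z d" if z: "z \<in> S" for z
  proof -
    obtain r M where r: "r > 0" "M summable_on I" "\<And>i u. i\<in>I \<Longrightarrow> u\<in>S \<inter> cball z r \<Longrightarrow> norm (f i u) \<le> M i"
      using bd[OF z] by blast
    obtain r' where r': "r' > 0" "cball z r' \<subseteq> S" using S z open_contains_cball by blast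
    \<comment> \<open>The majorant is promised only on \<open>S \<inter> cball z r\<close>;
      shrinking to \<open>d\<close> gives a closed disc inside \<open>S\<close> on which it applies
      everywhere.\<close>
    define d where "d = min r r'"
    have d: "d > 0" "cball z d \<subseteq> S" "cball z d \<subseteq> cball z r" using r r' by (auto simp: d_def)
    have "uniform_limit (cball z d) (\<lambda>X y. \<Sum>x\<in>X. f x y) (\<lambda>y. \<Sum>\<^sub>\<infinity>x\<in>I. f x y) (finite_subsets_at_top I)"
      by (rule Weierstrass_m_test_general[of _ _ _ M]) (use r d in blast)+
    moreover have "\<forall>\<^sub>F X in finite_subsets_at_top I. continuous_on (cball z d) (\<lambda>y. \<Sum>x\<in>X. f x y) \<and>
          (\<lambda>y. \<Sum>x\<in>X. f x y) holomorphic_on ball z d"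
    proof (rule eventually_finite_subsets_at_top_weakI)
      fix X assume X: "finite X" "X \<subseteq> I"
      have "(\<lambda>y. \<Sum>x\<in>X. f x y) holomorphic_on S" using X hol by (intro holomorphic_on_sum) auto
      then have "(\<lambda>y. \<Sum>x\<in>X. f x y) holomorphic_on cball z d" using d holomorphic_on_subset by blast
      then show "continuous_on (cball z d) (\<lambda>y. \<Sum>x\<in>X. f x y) \<and> (\<lambda>y. \<Sum>x\<in>X. f x y) holomorphic_on ball z d"
        using holomorphic_on_imp_continuous_on holomorphic_on_subset ball_subset_cball by blast
    qed
    ultimately show ?thesis
      by (intro exI[of _ d] conjI d(1), elim holomorphic_uniform_limit[rotated]) simp_all
  qed
  then have "(\<lambda>z. \<Sum>\<^sub>\<infinity>i\<in>I. f i z) analytic_on S"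
    by (subst analytic_on_def) blast
  then show ?thesis by (rule analytic_imp_holomorphic)
qed

text \<open>Dominated convergence for unordered sums along an arbitrary filter: the majorant makes
  the finite partial sums converge uniformly on the parameters where it holds, so the two limits may
  be swapped. It serves both for x tending to 0 from the right and for growing sets of
  primes.\<close>

lemma infsum_tannery:
  fixes f :: "'i \<Rightarrow> 'k \<Rightarrow> 'b :: banach"
  assumes lim: "\<And>i. i \<in> I \<Longrightarrow> (f i \<longlongrightarrow> g i) F"
    and bd: "eventually (\<lambda>k. \<forall>i\<in>I. norm (f i k) \<le> M i) F"
    and M: "M summable_on I" and F: "F \<noteq> bot"
  shows "((\<lambda>k. \<Sum>\<^sub>\<infinity>i\<in>I. f i k) \<longlongrightarrow> (\<Sum>\<^sub>\<infinity>i\<in>I. g i)) F"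
proof (rule swap_uniform_limit')
  let ?Y = "{k. \<forall>i\<in>I. norm (f i k) \<le> M i}"
  show "uniform_limit ?Y (\<lambda>X y. \<Sum>x\<in>X. f x y) (\<lambda>y. \<Sum>\<^sub>\<infinity>x\<in>I. f x y) (finite_subsets_at_top I)"
    by (rule Weierstrass_m_test_general[of _ _ _ M]) (use M in auto)
  show "\<forall>\<^sub>F X in finite_subsets_at_top I. ((\<lambda>k. \<Sum>i\<in>X. f i k) \<longlongrightarrow> (\<Sum>i\<in>X. g i)) F"
    by (rule eventually_finite_subsets_at_top_weakI) (auto intro!: tendsto_sum lim)
  show "\<forall>\<^sub>F x in F. x \<in> ?Y" using bd by simp
  \<comment> \<open>The bound survives the limit, which makes the family of termwise limits
    summable.\<close>
  have "norm (g i) \<le> M i" if "i \<in> I" for i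
  proof (rule tendsto_upperbound[OF tendsto_norm[OF lim[OF that]] _ F])
    show "\<forall>\<^sub>F k in F. norm (f i k) \<le> M i" using bd by eventually_elim (use that in blast)
  qed
  then have "g summable_on I"
    by (intro abs_summable_summable[OF Infinite_Sum.abs_summable_on_comparison_test'[OF M]])
  then have "(g has_sum (\<Sum>\<^sub>\<infinity>i\<in>I. g i)) I" by simp
  then show "((\<lambda>X. \<Sum>i\<in>X. g i) \<longlongrightarrow> (\<Sum>\<^sub>\<infinity>i\<in>I. g i)) (finite_subsets_at_top I)"
    by (simp add: has_sum_def)
qed auto

lemma infsum_norm_le:
  fixes f :: "'i \<Rightarrow> 'b :: banach"
  assumes "\<And>i. i \<in> I \<Longrightarrow> norm (f i) \<le> M i" "M summable_on I"
  shows "f summable_on I" "norm (\<Sum>\<^sub>\<infinity>i\<in>I. f i) \<le> (\<Sum>\<^sub>\<infinity>i\<in>I. M i)"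
proof -
  have a: "(\<lambda>i. norm (f i)) summable_on I"
    by (rule Infinite_Sum.abs_summable_on_comparison_test'[OF assms(2,1)])
  then show "f summable_on I" by (rule abs_summable_summable)
  have "norm (\<Sum>\<^sub>\<infinity>i\<in>I. f i) \<le> (\<Sum>\<^sub>\<infinity>i\<in>I. norm (f i))" using a by (rule norm_infsum_bound)
  also have "\<dots> \<le> (\<Sum>\<^sub>\<infinity>i\<in>I. M i)" using a assms by (intro infsum_mono) auto
  finally show "norm (\<Sum>\<^sub>\<infinity>i\<in>I. f i) \<le> (\<Sum>\<^sub>\<infinity>i\<in>I. M i)" .
qed

lemma summable_on_nat_iff_nonneg:
  fixes f :: "nat \<Rightarrow> real" assumes "\<And>n. f n \<ge> 0"
  shows "f summable_on UNIV \<longleftrightarrow> summable f"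
  using assms by (simp add: summable_on_UNIV_nonneg_real_iff)

lemma summable_Suc_powr:
  fixes p :: real assumes "p > 1"
  shows "(\<lambda>n. real (Suc n) powr (-p)) summable_on UNIV"
proof -
  have "summable (\<lambda>n. real n powr (-p))" using assms by (simp add: summable_real_powr_iff)
  then have "summable (\<lambda>n. real (Suc n) powr (-p))" by (subst summable_Suc_iff)
  then show ?thesis by (subst summable_on_nat_iff_nonneg) auto
qed

lemma summable_int_powr:
  fixes p :: real assumes p: "p > 1"
  shows "(\<lambda>j::int. (1 + \<bar>of_int j\<bar>) powr (-p)) summable_on UNIV"
proof -
  let ?f = "\<lambda>j::int. (1 + \<bar>real_of_int j\<bar>) powr (-p)"
  have s: "(\<lambda>n::nat. real (Suc n) powr (-p)) summable_on UNIV" by (rule summable_Suc_powr[OF p])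
  have 1: "?f summable_on range int"
    by (subst summable_on_reindex) (use s in \<open>auto simp: o_def add.commute\<close>)
  have 2: "?f summable_on range (\<lambda>n. - int n)"
    by (subst summable_on_reindex) (use s in \<open>auto simp: o_def add.commute inj_def\<close>)
  have "?f summable_on (range int \<union> range (\<lambda>n. - int n))" by (rule summable_on_union[OF 1 2])
  also have "range int \<union> range (\<lambda>n. - int n) = UNIV"
    (is "?A = _") proof -
    have "j \<in> ?A" for j by (cases j rule: int_cases2) auto
    then show ?thesis by blast
  qed
  finally show ?thesis .
qed

section \<open>Vertical lattices of step 2 pi i\<close>

definition two_pi_i :: "int \<Rightarrow> complex" where
  "two_pi_i j = 2 * of_real pi * \<i> * of_int j"

lemma two_pi_i_simps [simp]: "Re (two_pi_i j) = 0" "Im (two_pi_i j) = 2 * pi * of_int j" "two_pi_i 0 = 0"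
  "norm (two_pi_i j) = 2 * pi * \<bar>of_int j\<bar>" "two_pi_i (i + j) = two_pi_i i + two_pi_i j" "two_pi_i (- j) = - two_pi_i j"
  by (auto simp: two_pi_i_def norm_mult ring_distribs)

text \<open>The real part keeps the point at distance \<open>r\<close> from 0, and for large
  \<open>j\<close> the imaginary part keeps it at distance 2 pi |j| - B. A convex combination of the
  two bounds is linear in |j| and uniform on the half-strip.\<close>

lemma lattice_lower_bound:
  fixes r B :: real assumes r: "r > 0" "B \<ge> 0"
  obtains c where "c > 0" "\<And>\<mu> j. Re \<mu> \<ge> r \<Longrightarrow> \<bar>Im \<mu>\<bar> \<le> B \<Longrightarrow> norm (\<mu> + two_pi_i j) \<ge> c * (1 + \<bar>of_int j\<bar>)"
proof -
  \<comment> \<open>The weight solves (1 - l) r - l B = r / 2, so that half of \<open>r\<close>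
    survives as the constant term.\<close>
  define l where "l = r / (2 * (r + B))"
  have l: "0 < l" "l \<le> 1" "(1 - l) * r - l * B = r / 2"
  proof -
    have e: "l * (r + B) = r / 2" using r using r(1,2) by (simp add: l_def del: distrib_left_numeral)
    show "0 < l" "l \<le> 1" using r by (auto simp: l_def field_simps)
    show "(1 - l) * r - l * B = r / 2" using e by (simp add: algebra_simps)
  qed
  define c where "c = min (r / 2) (2 * pi * l)"
  show ?thesis
  proof
    show "c > 0" using r l by (auto simp: c_def)
    fix \<mu> :: complex and j :: int
    assume m: "Re \<mu> \<ge> r" "\<bar>Im \<mu>\<bar> \<le> B"
    let ?n = "norm (\<mu> + two_pi_i j)"
    have 1: "?n \<ge> r" using complex_Re_le_cmod[of "\<mu> + two_pi_i j"] m by simp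
    have "\<bar>Im (\<mu> + two_pi_i j)\<bar> \<le> ?n" by (rule abs_Im_le_cmod)
    moreover have "\<bar>2 * pi * of_int j\<bar> = 2 * pi * \<bar>of_int j\<bar>" by (simp add: abs_mult)
    ultimately have 2: "?n \<ge> 2 * pi * \<bar>of_int j\<bar> - B" using m by simp
    have "(1 - l) * ?n + l * ?n \<ge> (1 - l) * r + l * (2 * pi * \<bar>of_int j\<bar> - B)"
      using 1 2 l by (intro add_mono mult_left_mono) auto
    also have "(1 - l) * r + l * (2 * pi * \<bar>of_int j\<bar> - B) = r / 2 + (2 * pi * l) * \<bar>of_int j\<bar>"
      using l(3) by (simp add: algebra_simps)
    finally have "?n \<ge> r / 2 + (2 * pi * l) * \<bar>of_int j\<bar>" by (simp add: algebra_simps)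
    moreover have "(2 * pi * l) * \<bar>of_int j\<bar> \<ge> c * \<bar>of_int j\<bar>" by (intro mult_right_mono) (auto simp: c_def)
    moreover have "r / 2 \<ge> c" by (simp add: c_def)
    ultimately show "?n \<ge> c * (1 + \<bar>of_int j\<bar>)" by (simp add: algebra_simps)
  qed
qed

lemma norm_powr_le:
  fixes z w :: complex
  shows "norm (z powr w) \<le> exp (pi * \<bar>Im w\<bar>) * norm z powr Re w"
proof -
  have "- Im w * Arg z \<le> \<bar>Im w\<bar> * \<bar>Arg z\<bar>" by (metis abs_ge_self abs_minus_cancel abs_mult)
  also have "\<dots> \<le> \<bar>Im w\<bar> * pi"
    using mpi_less_Arg[of z] Arg_le_pi[of z] by (intro mult_left_mono) auto
  finally have "exp (- Im w * Arg z) \<le> exp (pi * \<bar>Im w\<bar>)" by (simp add: mult.commute)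
  then show ?thesis
    using mult_left_mono[of "exp (- Im w * Arg z)" "exp (pi * \<bar>Im w\<bar>)" "norm z powr Re w"]
    by (simp add: norm_powr_complex mult.commute)
qed

section \<open>Periodised powers\<close>

definition lattice_sum :: "complex \<Rightarrow> complex \<Rightarrow> complex" where
  "lattice_sum w \<mu> = (\<Sum>\<^sub>\<infinity>j. (\<mu> + two_pi_i j) powr (-w))"

lemma lattice_sum_bound:
  fixes r B :: real
  assumes r: "r > 0" "B \<ge> 0" and w: "Re w > 1"
  obtains M where "M summable_on UNIV"
    "\<And>\<mu> j. Re \<mu> \<ge> r \<Longrightarrow> \<bar>Im \<mu>\<bar> \<le> B \<Longrightarrow> norm ((\<mu> + two_pi_i j) powr (-w)) \<le> M j"
proof -
  obtain c where c: "c > 0" "\<And>\<mu> j. Re \<mu> \<ge> r \<Longrightarrow> \<bar>Im \<mu>\<bar> \<le> B \<Longrightarrow> norm (\<mu> + two_pi_i j) \<ge> c * (1 + \<bar>of_int j\<bar>)"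
    using lattice_lower_bound[OF r] by metis
  define M where "M = (\<lambda>j::int. exp (pi * \<bar>Im w\<bar>) * c powr (- Re w) * (1 + \<bar>of_int j\<bar>) powr (- Re w))"
  show ?thesis
  proof
    show "M summable_on UNIV" unfolding M_def
      by (intro summable_on_cmult_right summable_int_powr w)
    fix \<mu> j assume m: "Re \<mu> \<ge> r" "\<bar>Im \<mu>\<bar> \<le> B"
    have "norm ((\<mu> + two_pi_i j) powr (-w)) \<le> exp (pi * \<bar>Im w\<bar>) * norm (\<mu> + two_pi_i j) powr (- Re w)"
      using norm_powr_le[of "\<mu> + two_pi_i j" "-w"] by simp
    also have "norm (\<mu> + two_pi_i j) powr (- Re w) \<le> (c * (1 + \<bar>of_int j\<bar>)) powr (- Re w)"
      using c(2)[OF m, of j] c(1) w by (intro powr_mono2') auto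
    also have "\<dots> = c powr (- Re w) * (1 + \<bar>of_int j\<bar>) powr (- Re w)"
      using c(1) by (simp add: powr_mult)
    finally show "norm ((\<mu> + two_pi_i j) powr (-w)) \<le> M j" by (simp add: M_def mult_ac)
  qed
qed

lemma lattice_sum_summable:
  assumes "Re \<mu> > 0" "Re w > 1"
  shows "(\<lambda>j. (\<mu> + two_pi_i j) powr (-w)) summable_on UNIV"
proof -
  obtain M where "M summable_on UNIV" 
    "\<And>\<nu> j. Re \<nu> \<ge> Re \<mu> \<Longrightarrow> \<bar>Im \<nu>\<bar> \<le> \<bar>Im \<mu>\<bar> \<Longrightarrow> norm ((\<nu> + two_pi_i j) powr (-w)) \<le> M j"
    by (rule lattice_sum_bound[of "Re \<mu>" "\<bar>Im \<mu>\<bar>" w]) (use assms in auto)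
  then show ?thesis using infsum_norm_le(1)[of UNIV "\<lambda>j. (\<mu> + two_pi_i j) powr (-w)" M] by simp
qed

lemma notin_nonpos_Reals: "Re z > 0 \<Longrightarrow> z \<notin> \<real>\<^sub>\<le>\<^sub>0" "Im z \<noteq> 0 \<Longrightarrow> z \<notin> \<real>\<^sub>\<le>\<^sub>0"
  by (auto simp: complex_nonpos_Reals_iff)

lemma lattice_sum_holomorphic:
  assumes w: "Re w > 1"
  shows "lattice_sum w holomorphic_on {\<mu>. Re \<mu> > 0}"
  unfolding lattice_sum_def
proof (rule infsum_holomorphic)
  show "open {\<mu>. Re \<mu> > 0}" by (rule open_halfspace_Re_gt)
  show "(\<lambda>\<mu>. (\<mu> + two_pi_i j) powr (-w)) holomorphic_on {\<mu>. Re \<mu> > 0}" for j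
    by (intro holomorphic_intros) (auto simp: complex_nonpos_Reals_iff)
  fix z :: complex assume "z \<in> {\<mu>. Re \<mu> > 0}"
  then have z: "Re z > 0" by simp
  obtain M where M: "M summable_on UNIV" 
    "\<And>\<nu> j. Re \<nu> \<ge> Re z / 2 \<Longrightarrow> \<bar>Im \<nu>\<bar> \<le> \<bar>Im z\<bar> + Re z / 2 \<Longrightarrow> norm ((\<nu> + two_pi_i j) powr (-w)) \<le> M j"
    by (rule lattice_sum_bound[of "Re z / 2" "\<bar>Im z\<bar> + Re z / 2" w]) (use z w in auto)
  have "norm ((u + two_pi_i j) powr (-w)) \<le> M j" if "u \<in> cball z (Re z / 2)" for u j
  proof (rule M(2))
    have *: "norm (z - u) \<le> Re z / 2" using that by (simp add: dist_norm)
    show "Re u \<ge> Re z / 2" using complex_Re_le_cmod[of "z - u"] * by simp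
    show "\<bar>Im u\<bar> \<le> \<bar>Im z\<bar> + Re z / 2" using abs_Im_le_cmod[of "z - u"] * by simp
  qed
  then show "\<exists>r>0. \<exists>M. M summable_on UNIV \<and>
      (\<forall>i\<in>UNIV. \<forall>u\<in>{\<mu>. Re \<mu> > 0} \<inter> cball z r. norm ((u + two_pi_i i) powr - w) \<le> M i)"
    using z M(1) by (intro exI[of _ "Re z / 2"] conjI exI[of _ M]) auto
qed

lemma lattice_sum_periodic: "lattice_sum w (\<mu> + two_pi_i k) = lattice_sum w \<mu>"
proof -
  have "bij_betw (\<lambda>j. k + j) UNIV (UNIV :: int set)"
    by (rule bij_betw_byWitness[of _ "\<lambda>j. j - k"]) auto
  from infsum_reindex_bij_betw[OF this, of "\<lambda>j. (\<mu> + two_pi_i j) powr (-w)"]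
  show ?thesis by (simp add: lattice_sum_def add.assoc)
qed

lemma lattice_sum_exp:
  assumes "exp x = exp y" shows "lattice_sum w (-x) = lattice_sum w (-y)"
proof -
  obtain n :: int where "x = y + of_int (2 * n) * pi * \<i>" using assms exp_eq by metis
  then have "-y = -x + two_pi_i n" by (simp add: two_pi_i_def algebra_simps)
  then show ?thesis using lattice_sum_periodic[of w "-x" n] by simp
qed

lemma powr_of_real_mult:
  fixes z w :: complex
  assumes "r > 0" "z \<noteq> 0"
  shows "(of_real r * z) powr w = of_real r powr w * z powr w"
  using assms by (simp add: powr_def Ln_times_of_real Ln_of_real exp_add[symmetric] ring_distribs)

text \<open>Sort the integers by their residue modulo \<open>N\<close> and pull the factor
  \<open>N\<close> out of each power; the principal branch permits this because \<open>N\<close> is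
  a positive real.\<close>

lemma lattice_sum_distribution:
  assumes N: "N > 0" and w: "Re w > 1" and m: "Re \<mu> > 0"
  shows "(\<Sum>r<N. lattice_sum w (\<mu> + two_pi_i (int r) / of_nat N)) = of_nat N powr w * lattice_sum w (of_nat N * \<mu>)"
proof -
  let ?f = "\<lambda>m. (of_nat N * \<mu> + two_pi_i m) powr (-w)"
  let ?B = "\<lambda>r::nat. range (\<lambda>j. int r + int N * j)"
  have sum: "?f summable_on UNIV" by (rule lattice_sum_summable) (use m w N in auto)
  have scale: "of_nat N powr w * ?f m = (\<mu> + two_pi_i m / of_nat N) powr (-w)" for m
  proof -
    have "of_nat N * \<mu> + two_pi_i m = of_real (real N) * (\<mu> + two_pi_i m / of_nat N)" using N by (simp add: field_simps)
    moreover have "\<mu> + two_pi_i m / of_nat N \<noteq> 0"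
    proof -
      have "Re (two_pi_i m / of_nat N) = 0" by (simp add: two_pi_i_def Re_divide_of_nat)
      then have "Re (\<mu> + two_pi_i m / of_nat N) > 0" using m by (simp only: plus_complex.sel)
      then show ?thesis by force
    qed
    ultimately have "?f m = of_real (real N) powr (-w) * (\<mu> + two_pi_i m / of_nat N) powr (-w)"
      using N powr_of_real_mult[of "real N"] by simp
    then show ?thesis using N by (simp add: powr_minus)
  qed
  have "infsum ?f UNIV = infsum ?f (\<Union>r\<in>{..<N}. ?B r)"
  proof -
    have "m \<in> (\<Union>r\<in>{..<N}. ?B r)" for m
    proof -
      have "m = int (nat (m mod int N)) + int N * (m div int N)" using N by simp
      moreover have "nat (m mod int N) < N" using N by (simp add: nat_less_iff)
      ultimately show ?thesis by blast
    qed
    then have "(\<Union>r\<in>{..<N}. ?B r) = UNIV" by blast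
    then show ?thesis by simp
  qed
  also have "\<dots> = (\<Sum>r<N. infsum ?f (?B r))"
  proof (rule sum_infsum[symmetric])
    show "?f summable_on ?B r" for r using sum by (rule summable_on_subset) auto
    show "?B r \<inter> ?B r' = {}" if "r \<in> {..<N}" "r' \<in> {..<N}" "r \<noteq> r'" for r r'
    proof -
      have "int r + int N * j \<noteq> int r' + int N * j'" for j j'
      proof
        assume "int r + int N * j = int r' + int N * j'"
        then have "(int r + int N * j) mod int N = (int r' + int N * j') mod int N" by simp
        then show False using that by simp
      qed
      then show ?thesis by blast
    qed
  qed auto
  also have "\<dots> = (\<Sum>r<N. of_nat N powr (-w) * lattice_sum w (\<mu> + two_pi_i (int r) / of_nat N))"
  proof (rule sum.cong)
    fix r
    have "infsum ?f (?B r) = infsum (\<lambda>j. ?f (int r + int N * j)) UNIV"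
      by (subst infsum_reindex) (use N in \<open>auto simp: inj_def o_def\<close>)
    also have "(\<lambda>j. ?f (int r + int N * j)) = (\<lambda>j. of_nat N powr (-w) * (\<mu> + two_pi_i (int r) / of_nat N + two_pi_i j) powr (-w))"
    proof
      fix j
      have "\<mu> + two_pi_i (int r + int N * j) / of_nat N = \<mu> + two_pi_i (int r) / of_nat N + two_pi_i j"
        using N by (simp add: two_pi_i_def field_simps)
      then have "of_nat N powr w * ?f (int r + int N * j) = (\<mu> + two_pi_i (int r) / of_nat N + two_pi_i j) powr (-w)"
        using scale by metis
      moreover have "of_nat N powr (-w) * of_nat N powr w = 1" using N by (simp add: powr_minus)
      ultimately show "?f (int r + int N * j) = of_nat N powr (-w) * (\<mu> + two_pi_i (int r) / of_nat N + two_pi_i j) powr (-w)"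
        by (metis mult.assoc mult_1)
    qed
    finally show "infsum ?f (?B r) = of_nat N powr (-w) * lattice_sum w (\<mu> + two_pi_i (int r) / of_nat N)"
      by (simp add: lattice_sum_def infsum_cmult_right')
  qed auto
  also have "\<dots> = of_nat N powr (-w) * (\<Sum>r<N. lattice_sum w (\<mu> + two_pi_i (int r) / of_nat N))"
    by (simp add: sum_distrib_left)
  finally have "lattice_sum w (of_nat N * \<mu>) = \<dots>" by (simp add: lattice_sum_def)
  then show ?thesis using N by (simp add: powr_minus)
qed

text \<open>Periodicity makes the lattice sum a function of q = exp(-\<mu>) on the punctured unit
  disc. It is bounded near q = 0, so the singularity is removable and the Taylor series of the
  extension provides the coefficients.\<close>

lemma lattice_sum_power_series:
  assumes w: "Re w > 1"
  shows "\<exists>c. \<forall>\<mu>. Re \<mu> > 0 \<longrightarrow> (\<lambda>n. c n * exp (-\<mu>) ^ n) sums lattice_sum w \<mu>"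
proof -
  define f where "f = (\<lambda>q. lattice_sum w (- Ln q))"
  have f: "f (exp (-\<mu>)) = lattice_sum w \<mu>" for \<mu>
    unfolding f_def using lattice_sum_exp[of "Ln (exp (-\<mu>))" "-\<mu>" w] by simp
  have Re_Ln': "Re (- Ln q) > 0" if "q \<noteq> 0" "norm q < 1" for q
    using that by (simp add: ln_less_zero)
  have "f holomorphic_on (ball 0 1 - {0})"
  proof -
    have "\<exists>d>0. f holomorphic_on ball q0 d" if q0: "q0 \<in> ball 0 1 - {0}" for q0
    proof -
      have q: "q0 \<noteq> 0" "norm q0 < 1" using q0 by auto
      define d where "d = min (norm q0) (1 - norm q0)"
      have d: "d > 0" using q by (auto simp: d_def)
      \<comment> \<open>A branch of the logarithm holomorphic around \<open>q0\<close>, even when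
        \<open>q0\<close> lies on the cut of \<open>Ln\<close>. Periodicity makes the lattice sum
        indifferent to the choice of branch.\<close>
      define h where "h = (\<lambda>q. Ln (q / q0) + Ln q0)"
      have in1: "q / q0 \<notin> \<real>\<^sub>\<le>\<^sub>0" "q \<noteq> 0" "norm q < 1" if "q \<in> ball q0 d" for q
      proof -
        have n: "norm (q - q0) < norm q0" "norm (q - q0) < 1 - norm q0"
          using that by (auto simp: d_def dist_norm norm_minus_commute)
        have "norm (1 - q / q0) < 1"
        proof -
          have "1 - q / q0 = (q0 - q) / q0" using q by (simp add: field_simps)
          then show ?thesis using n q by (simp add: norm_divide norm_minus_commute)
        qed
        then have "Re (q / q0) > 0" using complex_Re_le_cmod[of "1 - q / q0"] by simp
        then show "q / q0 \<notin> \<real>\<^sub>\<le>\<^sub>0" by (rule notin_nonpos_Reals)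
        show "q \<noteq> 0" using n by auto
        show "norm q < 1" using norm_triangle_sub[of q q0] n by simp
      qed
      have eh: "exp (h q) = q" if "q \<in> ball q0 d" for q
        using in1[OF that] q by (simp add: h_def exp_add)
      have "(\<lambda>q. lattice_sum w (- h q)) holomorphic_on ball q0 d"
      proof (rule holomorphic_on_compose_gen[of _ _ "lattice_sum w" "{\<mu>. Re \<mu> > 0}", unfolded o_def])
        show "(\<lambda>q. - h q) holomorphic_on ball q0 d" unfolding h_def
          using in1 q by (intro holomorphic_intros) auto
        show "(\<lambda>q. - h q) ` ball q0 d \<subseteq> {\<mu>. Re \<mu> > 0}"
        proof clarsimp
          fix q assume "dist q0 q < d"
          then have q': "q \<in> ball q0 d" by simp
          have "exp (Re (h q)) < 1" using eh[OF q'] in1[OF q'] by (metis norm_exp_eq_Re)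
          then show "Re (h q) < 0" by simp
        qed
      qed (rule lattice_sum_holomorphic[OF w])
      moreover have "lattice_sum w (- h q) = f q" if "q \<in> ball q0 d" for q
        unfolding f_def by (rule lattice_sum_exp) (use eh[OF that] in1[OF that] in simp)
      ultimately have "f holomorphic_on ball q0 d" by (rule holomorphic_transform)
      then show ?thesis using d by blast
    qed
    then have "f analytic_on (ball 0 1 - {0})" by (subst analytic_on_def) blast
    then show ?thesis by (rule analytic_imp_holomorphic)
  qed
  moreover have "\<exists>B. eventually (\<lambda>q. norm (f q) \<le> B) (at 0)"
  proof -
    \<comment> \<open>The half-strip is the one reached by the principal logarithm: its imaginary
      part is at most pi in modulus, and |q| < exp(-1) gives real part at least 1.\<close>
    obtain M where M: "M summable_on UNIV"
      "\<And>\<mu> j. Re \<mu> \<ge> 1 \<Longrightarrow> \<bar>Im \<mu>\<bar> \<le> pi \<Longrightarrow> norm ((\<mu> + two_pi_i j) powr (-w)) \<le> M j"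
      by (rule lattice_sum_bound[of 1 pi w]) (use w in auto)
    have b: "norm (f q) \<le> infsum M UNIV" if q: "q \<noteq> 0" "norm q < exp (-1)" for q
      unfolding f_def lattice_sum_def
    proof (rule infsum_norm_le(2)[OF M(2) M(1)])
      have "ln (norm q) < -1" using q by (metis ln_exp ln_less_cancel_iff exp_gt_zero zero_less_norm_iff)
      then show "1 \<le> Re (- Ln q)" using q by simp
      show "\<bar>Im (- Ln q)\<bar> \<le> pi" using mpi_less_Im_Ln[of q] Im_Ln_le_pi[of q] q by auto
    qed
    have "eventually (\<lambda>q::complex. q \<in> ball 0 (exp (-1)) - {0}) (at 0)"
      by (intro eventually_at_in_open) auto
    then have "eventually (\<lambda>q. norm (f q) \<le> infsum M UNIV) (at 0)"
      by eventually_elim (use b in auto)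
    then show ?thesis by blast
  qed
  ultimately obtain g where g: "g holomorphic_on ball 0 1" "\<And>z. z \<in> ball 0 1 - {0} \<Longrightarrow> g z = f z"
    using holomorphic_on_extend_bounded[of f "ball 0 1" 0] by auto
  define c where "c = (\<lambda>n. (deriv ^^ n) g 0 / fact n)"
  have "(\<lambda>n. c n * exp (-\<mu>) ^ n) sums lattice_sum w \<mu>" if "Re \<mu> > 0" for \<mu>
  proof -
    have "exp (-\<mu>) \<in> ball 0 1 - {0}" using that by simp
    then show ?thesis using holomorphic_power_series[OF g(1), of "exp (-\<mu>)"] g(2) f
      by (simp add: c_def)
  qed
  then show ?thesis by blast
qed

section \<open>The Lipschitz summation formula\<close>

lemma powser_zero_imp_coeff_zero:
  fixes a :: "nat \<Rightarrow> complex"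
  assumes "\<And>q. q \<noteq> 0 \<Longrightarrow> norm q < 1 \<Longrightarrow> (\<lambda>n. a n * q ^ n) sums 0"
  shows "a n = 0"
proof (rule ccontr)
  assume n: "a n \<noteq> 0"
  \<comment> \<open>Multiplying the series by q extends the identity to q = 0, where nothing is
    assumed about \<open>a\<close>, and moves the nonzero coefficient to a positive index, as
    \<open>powser_0_nonzero\<close> requires.\<close>
  define b where "b = (\<lambda>n. case n of 0 \<Rightarrow> 0 | Suc m \<Rightarrow> a m)"
  have s: "(\<lambda>n. b n * (q - 0) ^ n) sums 0" if "norm (q - 0) < 1" for q
  proof (cases "q = 0")
    case True
    then show ?thesis by (simp add: b_def)
  next
    case False
    then have "(\<lambda>n. q * (a n * q ^ n)) sums (q * 0)" using that by (intro sums_mult assms) auto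
    then have "(\<lambda>n. b (Suc n) * q ^ Suc n) sums 0" by (simp add: b_def mult_ac)
    then have "(\<lambda>n. b n * q ^ n) sums (0 + b 0 * q ^ 0)" by (subst (asm) sums_Suc_iff) (simp add: b_def)
    then show ?thesis by (simp add: b_def)
  qed
  obtain s where "s > 0" "\<And>z::complex. z \<in> cball 0 s - {0} \<Longrightarrow> (0::complex) \<noteq> 0"
  proof (rule powser_0_nonzero[of 1 0 b "\<lambda>_. 0" "Suc n"])
    show "b (Suc n) \<noteq> 0" using n by (simp add: b_def)
  qed (use s in auto)
  from this(2)[of "of_real s"] \<open>s > 0\<close> show False by simp
qed

text \<open>
  The coefficients are determined by the distribution relation alone: comparing those of \<open>q\<^sup>0\<close> and \<open>q\<^sup>N\<close>
  gives \<open>c 0 = 0\<close> and \<open>c N = N\<^sup>w\<^sup>-\<^sup>1 c 1\<close>.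
\<close>

lemma lattice_sum_coefficients:
  assumes w: "Re w > 1"
  shows "\<exists>c. \<forall>\<mu>. Re \<mu> > 0 \<longrightarrow> (\<lambda>n. c * (of_nat n powr (w - 1) * exp (-\<mu>) ^ n)) sums lattice_sum w \<mu>"
proof -
  obtain c where c: "\<And>\<mu>. Re \<mu> > 0 \<Longrightarrow> (\<lambda>n. c n * exp (-\<mu>) ^ n) sums lattice_sum w \<mu>"
    using lattice_sum_power_series[OF w] by blast
  \<comment> \<open>The coefficient of q^n in the difference of the two sides of the distribution
    relation, once both are expanded in powers of q.\<close>
  define d where "d = (\<lambda>N n. c n * (\<Sum>r<N. exp (- two_pi_i (int r) / of_nat N) ^ n)
     - (if N dvd n then of_nat N powr w * c (n div N) else 0))"
  have d0: "d N n = 0" if N: "N > 0" for N n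
  proof (rule powser_zero_imp_coeff_zero)
    fix q :: complex assume q: "q \<noteq> 0" "norm q < 1"
    define \<mu> where "\<mu> = - Ln q"
    have m: "Re \<mu> > 0" using q by (simp add: \<mu>_def ln_less_zero)
    have e: "exp (-\<mu>) = q" using q by (simp add: \<mu>_def)
    have "(\<lambda>n. c n * exp (- (\<mu> + two_pi_i (int r) / of_nat N)) ^ n) sums lattice_sum w (\<mu> + two_pi_i (int r) / of_nat N)" for r
    proof (rule c)
      have "Re (two_pi_i (int r) / of_nat N) = 0" by (simp add: two_pi_i_def Re_divide_of_nat)
      then show "Re (\<mu> + two_pi_i (int r) / of_nat N) > 0" using m by (simp only: plus_complex.sel)
    qed
    then have "(\<lambda>n. \<Sum>r<N. c n * exp (- (\<mu> + two_pi_i (int r) / of_nat N)) ^ n) sums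
        (\<Sum>r<N. lattice_sum w (\<mu> + two_pi_i (int r) / of_nat N))" by (rule sums_sum)
    moreover have "exp (- (\<mu> + two_pi_i (int r) / of_nat N)) = q * exp (- two_pi_i (int r) / of_nat N)" for r
      by (simp add: e[symmetric] exp_add[symmetric])
    ultimately have 1: "(\<lambda>n. c n * (\<Sum>r<N. exp (- two_pi_i (int r) / of_nat N) ^ n) * q ^ n) sums
        (of_nat N powr w * lattice_sum w (of_nat N * \<mu>))"
      by (simp add: lattice_sum_distribution[OF N w m] power_mult_distrib sum_distrib_left sum_distrib_right mult_ac)
    have "exp (- (of_nat N * \<mu>)) = q ^ N" by (simp add: e[symmetric] exp_of_nat_mult[symmetric])
    then have "(\<lambda>n. of_nat N powr w * (c n * (q ^ N) ^ n)) sums (of_nat N powr w * lattice_sum w (of_nat N * \<mu>))"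
      using c[of "of_nat N * \<mu>"] m N by (intro sums_mult) simp
    then have "(\<lambda>n. (\<lambda>n. (if N dvd n then of_nat N powr w * c (n div N) else 0) * q ^ n) (N * n)) sums (of_nat N powr w * lattice_sum w (of_nat N * \<mu>))"
      using N by (simp add: power_mult mult.left_commute mult.assoc)
    then have 2: "(\<lambda>n. (if N dvd n then of_nat N powr w * c (n div N) else 0) * q ^ n) sums (of_nat N powr w * lattice_sum w (of_nat N * \<mu>))"
      by (subst (asm) sums_mono_reindex) (use N in \<open>auto simp: strict_mono_def image_iff dvd_def\<close>)
    show "(\<lambda>n. d N n * q ^ n) sums 0"
      using sums_diff[OF 1 2] by (simp add: d_def left_diff_distrib)
  qed
  have cN: "c N = of_nat N powr (w - 1) * c 1" if N: "N > 0" for N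
  proof -
    have "exp (- two_pi_i (int r) / of_nat N) ^ N = 1" for r
    proof -
      have "exp (- two_pi_i (int r) / of_nat N) ^ N = exp (- two_pi_i (int r))"
        using N by (simp flip: exp_of_nat_mult)
      also have "\<dots> = exp (2 * of_int (- int r) * of_real pi * \<i>)" by (simp add: two_pi_i_def mult_ac)
      also have "\<dots> = 1" using exp_integer_2pi[of "- of_int (int r)"] by (simp add: mult_ac)
      finally show ?thesis .
    qed
    then have "of_nat N * c N = of_nat N powr w * c 1"
      using d0[OF N, of N] N by (simp add: d_def mult.commute)
    then show ?thesis using N by (simp add: powr_diff field_simps)
  qed
  have c0: "c 0 = 0"
  proof -
    \<comment> \<open>The relation for N = 2 at n = 0; the moduli of the two factors differ since Re
      w > 1.\<close>
    have "2 * c 0 = 2 powr w * c 0" using d0[of 2 0] by (simp add: d_def)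
    moreover have "norm (2 powr w :: complex) > 2"
      using w powr_less_mono[of 1 "Re w" "2::real"] by (simp add: norm_powr_real_powr)
    ultimately show ?thesis by auto
  qed
  have "c n = c 1 * of_nat n powr (w - 1)" for n
    using cN[of n] c0 by (cases "n = 0") auto
  then have "\<forall>\<mu>. Re \<mu> > 0 \<longrightarrow> (\<lambda>n. c 1 * (of_nat n powr (w - 1) * exp (-\<mu>) ^ n)) sums lattice_sum w \<mu>"
    using c by (metis (no_types, lifting) mult.assoc sums_cong)
  then show ?thesis by blast
qed

lemma one_minus_exp_over_tendsto: "((\<lambda>x::real. (1 - exp (-x)) / x) \<longlongrightarrow> 1) (at_right 0)"
  by real_asymp

text \<open>Only j = 0 contributes in the limit: every other term stays bounded while the prefactor
  tends to 0. The prefactor uses 1 - exp(-x) instead of x because the binomial series, with which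
  the Dirichlet side is compared, is a power of exactly this quantity.\<close>

lemma lattice_sum_asymp:
  assumes w: "Re w > 1"
  shows "((\<lambda>x::real. of_real (1 - exp (-x)) powr w * lattice_sum w (of_real x)) \<longlongrightarrow> 1) (at_right 0)"
proof -
  \<comment> \<open>For j = 0 the bound is 1 - exp(-x) \<le> x. For the other \<open>j\<close> the
    prefactor is at most 1 in modulus and the lattice point has modulus at least (1 + |j|) /
    2.\<close>
  define M where "M = (\<lambda>j::int. if j = 0 then 1 else exp (pi * \<bar>Im w\<bar>) * 2 powr Re w * (1 + \<bar>of_int j\<bar>) powr (- Re w))"
  have Ms: "M summable_on UNIV"
  proof -
    have "(\<lambda>j. exp (pi * \<bar>Im w\<bar>) * 2 powr Re w * (1 + \<bar>of_int j\<bar>) powr (- Re w)) summable_on (UNIV::int set)"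
      by (intro summable_on_cmult_right summable_int_powr w)
    then have "(\<lambda>j. exp (pi * \<bar>Im w\<bar>) * 2 powr Re w * (1 + \<bar>of_int j\<bar>) powr (- Re w)) summable_on (UNIV - {0::int})"
      by (rule summable_on_subset) auto
    then have "M summable_on (UNIV - {0})"
      by (subst summable_on_cong[where g="\<lambda>j. exp (pi * \<bar>Im w\<bar>) * 2 powr Re w * (1 + \<bar>of_int j\<bar>) powr (- Re w)"]) (auto simp: M_def)
    then have "M summable_on insert 0 (UNIV - {0})" by (subst summable_on_insert_iff)
    then show ?thesis by simp
  qed
  have y: "0 < 1 - exp (-x)" "1 - exp (-x) \<le> x" "1 - exp (-x) \<le> 1" if "x > 0" for x :: real
    using that exp_ge_add_one_self[of "-x"] by auto
  have ev: "eventually (\<lambda>x::real. x > 0) (at_right 0)" by (simp add: eventually_at_right_less)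
  have "((\<lambda>x::real. \<Sum>\<^sub>\<infinity>j. of_real (1 - exp (-x)) powr w * (of_real x + two_pi_i j) powr (-w)) \<longlongrightarrow> (\<Sum>\<^sub>\<infinity>j::int. if j = 0 then 1 else 0)) (at_right 0)"
  proof (rule infsum_tannery[where f="\<lambda>j x. of_real (1 - exp (-x)) powr w * (of_real x + two_pi_i j) powr (-w)" and M=M])
    show "M summable_on UNIV" by (rule Ms)
    show "eventually (\<lambda>x::real. \<forall>j\<in>UNIV. norm (of_real (1 - exp (-x)) powr w * (of_real x + two_pi_i j) powr (-w)) \<le> M j) (at_right 0)"
      using ev
    proof eventually_elim
      case (elim x)
      have "norm (of_real (1 - exp (-x)) powr w * (of_real x + two_pi_i j) powr (-w)) \<le> M j" for j
      proof (cases "j = 0")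
        case True
        have "norm (of_real (1 - exp (-x)) powr w * of_real x powr (-w)) = (1 - exp (-x)) powr Re w * x powr (- Re w)"
          unfolding norm_mult using y[OF elim] elim by (subst (1 2) norm_powr_real_powr) auto
        also have "\<dots> \<le> x powr Re w * x powr (- Re w)"
          using y[OF elim] w by (intro mult_right_mono powr_mono2) auto
        also have "\<dots> = 1" using elim by (simp add: powr_minus)
        finally show ?thesis using True by (simp add: M_def)
      next
        case False
        have n: "1 + \<bar>of_int j\<bar> \<le> 2 * norm (of_real x + two_pi_i j)"
        proof -
          have j: "1 \<le> \<bar>real_of_int j\<bar>" using False by linarith
          have "\<bar>real_of_int j\<bar> \<le> pi * \<bar>real_of_int j\<bar>" using pi_gt3 mult_right_mono[of 1 pi "\<bar>real_of_int j\<bar>"] by simp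
          moreover have "\<bar>2 * pi * of_int j\<bar> \<le> norm (of_real x + two_pi_i j)"
            using abs_Im_le_cmod[of "of_real x + two_pi_i j"] by simp
          then have "2 * (pi * \<bar>of_int j\<bar>) \<le> norm (of_real x + two_pi_i j)" by (simp add: abs_mult)
          ultimately show ?thesis using j by linarith
        qed
        have "norm (of_real (1 - exp (-x)) powr w * (of_real x + two_pi_i j) powr (-w))
            = (1 - exp (-x)) powr Re w * norm ((of_real x + two_pi_i j) powr (-w))"
          unfolding norm_mult using y[OF elim] by (subst norm_powr_real_powr) auto
        also have "\<dots> \<le> 1 * (exp (pi * \<bar>Im w\<bar>) * norm (of_real x + two_pi_i j) powr (- Re w))"
          using norm_powr_le[of "of_real x + two_pi_i j" "-w"] y[OF elim] w by (intro mult_mono powr_le1) auto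
        also have "norm (of_real x + two_pi_i j) powr (- Re w) \<le> ((1 + \<bar>of_int j\<bar>) / 2) powr (- Re w)"
          using n w by (intro powr_mono2') auto
        also have "((1 + \<bar>of_int j\<bar>) / 2) powr (- Re w) = 2 powr Re w * (1 + \<bar>of_int j\<bar>) powr (- Re w)"
          by (simp add: powr_divide powr_minus field_simps)
        finally show ?thesis using False by (simp add: M_def mult_ac)
      qed
      then show ?case by blast
    qed
    fix j :: int
    show "((\<lambda>x::real. of_real (1 - exp (-x)) powr w * (of_real x + two_pi_i j) powr (-w)) \<longlongrightarrow> (if j = 0 then 1 else 0)) (at_right 0)"
    proof (cases "j = 0")
      case True
      have "((\<lambda>x::real. complex_of_real ((1 - exp (-x)) / x) powr w) \<longlongrightarrow> of_real 1 powr w) (at_right 0)"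
        by (intro tendsto_powr_complex tendsto_of_real one_minus_exp_over_tendsto) (auto simp: complex_nonpos_Reals_iff)
      moreover have "eventually (\<lambda>x::real. of_real ((1 - exp (-x)) / x) powr w = of_real (1 - exp (-x)) powr w * of_real x powr (-w)) (at_right 0)"
        using ev
      proof eventually_elim
        case (elim x)
        have "Ln (of_real ((1 - exp (-x)) / x)) = of_real (ln (1 - exp (-x))) - of_real (ln x)"
          using elim y[OF elim] by (subst Ln_of_real) (auto simp: ln_div)
        moreover have "Ln (of_real (1 - exp (-x))) = of_real (ln (1 - exp (-x)))" "Ln (of_real x) = of_real (ln x)"
          using elim y[OF elim] by (auto simp: Ln_of_real simp del: of_real_diff)
        moreover have "complex_of_real ((1 - exp (-x)) / x) \<noteq> 0" "complex_of_real (1 - exp (-x)) \<noteq> 0" "complex_of_real x \<noteq> 0"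
          using elim y[OF elim] by (auto simp del: of_real_divide of_real_diff)
        ultimately show ?case
          by (simp only: powr_def if_False exp_add[symmetric]) (simp add: right_diff_distrib)
      qed
      ultimately show ?thesis using True by (auto intro: Lim_transform_eventually)
    next
      case False
      have "((\<lambda>x::real. norm (complex_of_real (1 - exp (-x)) powr w)) \<longlongrightarrow> 0) (at_right 0)"
      proof (rule Lim_transform_eventually)
        show "((\<lambda>x::real. (1 - exp (-x)) powr Re w) \<longlongrightarrow> 0) (at_right 0)"
          using w by real_asymp
        show "eventually (\<lambda>x::real. (1 - exp (-x)) powr Re w = norm (complex_of_real (1 - exp (-x)) powr w)) (at_right 0)"
          using ev by eventually_elim (use y in \<open>simp add: norm_powr_real_powr\<close>)
      qed
      then have a: "((\<lambda>x::real. complex_of_real (1 - exp (-x)) powr w) \<longlongrightarrow> 0) (at_right 0)"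
        by (rule tendsto_norm_zero_cancel)
      have "((\<lambda>x::real. (of_real x + two_pi_i j) powr (-w)) \<longlongrightarrow> (of_real 0 + two_pi_i j) powr (-w)) (at_right 0)"
        using False by (intro tendsto_powr_complex tendsto_intros) (auto simp: complex_nonpos_Reals_iff)
      from tendsto_mult[OF a this] show ?thesis using False by simp
    qed
  qed simp
  also have "(\<lambda>x::real. \<Sum>\<^sub>\<infinity>j. of_real (1 - exp (-x)) powr w * (of_real x + two_pi_i j) powr (-w)) =
      (\<lambda>x::real. of_real (1 - exp (-x)) powr w * lattice_sum w (of_real x))"
    by (simp add: lattice_sum_def infsum_cmult_right')
  also have "(\<Sum>\<^sub>\<infinity>j::int. if j = 0 then 1 else 0 :: complex) = 1"
    by (subst infsum_cong_neutral[where T="{0}" and g="\<lambda>_. 1"]) auto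
  finally show ?thesis .
qed


lemma gbinomial_minus_power:
  fixes a x :: "'a :: field_char_0"
  shows "((- a) gchoose n) * (- x) ^ n = ((a - 1 + of_nat n) gchoose n) * x ^ n"
proof -
  have 1: "(- x) ^ n = (- 1) ^ n * x ^ n" by (rule power_minus)
  have 2: "(- 1) ^ n * (- 1) ^ n = (1::'a)" by (simp flip: power_mult_distrib)
  have "((- a) gchoose n) * (- x) ^ n = ((- 1) ^ n * (- 1) ^ n) * (((a + of_nat n - 1) gchoose n) * x ^ n)"
    unfolding gbinomial_minus 1 by (simp only: mult_ac)
  also have "a + of_nat n - 1 = a - 1 + of_nat n" by simp
  finally show ?thesis using 2 by simp
qed

text \<open>
  Abelian comparison with the binomial series of \<open>(1 - q)\<^sup>-\<^sup>w\<close>, whose coefficients are asymptotic to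
  \<open>n\<^sup>w\<^sup>-\<^sup>1 / \<Gamma>(w)\<close>.
\<close>

lemma dirichlet_asymp:
  assumes w: "Re w > 1"
    and S: "\<And>x::real. x > 0 \<Longrightarrow> (\<lambda>n. of_nat n powr (w - 1) * of_real (exp (-x)) ^ n) sums S x"
  shows "((\<lambda>x::real. of_real (1 - exp (-x)) powr w * S x) \<longlongrightarrow> Gamma w) (at_right 0)"
proof -
  define p where "p = Re w"
  define b where "b = (\<lambda>n. (w - 1 + of_nat n) gchoose n)"
  define \<beta> where "\<beta> = (\<lambda>n. (p - 1 + real n) gchoose n)"
  \<comment> \<open>The error per coefficient. It is o(\<open>\<beta> n\<close>), where the positive
    numbers \<open>\<beta> n\<close> are the coefficients of (1 - q)^(-Re w) and so sum up in closed
    form.\<close>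
  define e where "e = (\<lambda>n. norm (of_nat n powr (w - 1) - Gamma w * b n))"
  have p: "p > 1" using w by (simp add: p_def)
  have \<beta>pos: "\<beta> n > 0" for n
    using p by (simp add: \<beta>_def gbinomial_pochhammer' pochhammer_pos)
  have bs: "(\<lambda>n. b n * of_real q ^ n) sums (of_real (1 - q) powr (- w))" if "0 < q" "q < 1" for q :: real
    using gen_binomial_complex[of "- of_real q" "-w"] that
    by (simp add: b_def gbinomial_minus_power)
  have \<beta>s: "(\<lambda>n. \<beta> n * q ^ n) sums ((1 - q) powr (- p))" if "0 < q" "q < 1" for q :: real
    using gen_binomial_real[of "- q" "-p"] that
    by (simp add: \<beta>_def gbinomial_minus_power)
  have "w \<notin> \<int>\<^sub>\<le>\<^sub>0" using w by (auto elim!: nonpos_Ints_cases)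
  then have G: "Gamma w * rGamma w = 1" by (simp add: Gamma_def rGamma_eq_zero_iff)
  have "(\<lambda>n. norm (1 - Gamma w * (b n * exp (- (w - 1) * of_real (ln (of_nat n)))))) \<longlonglongrightarrow> norm (1 - Gamma w * rGamma (w - 1 + 1))"
    unfolding b_def by (intro tendsto_intros Gamma_gbinomial)
  then have "(\<lambda>n. norm (1 - Gamma w * (b n * exp (- (w - 1) * of_real (ln (of_nat n)))))) \<longlonglongrightarrow> 0"
    using G by simp
  moreover have "(\<lambda>n. \<beta> n * exp (- (p - 1) * ln (of_nat n))) \<longlonglongrightarrow> rGamma (p - 1 + 1)"
    unfolding \<beta>_def using Gamma_gbinomial[of "p - 1"] by simp
  ultimately have "(\<lambda>n. norm (1 - Gamma w * (b n * exp (- (w - 1) * of_real (ln (of_nat n))))) / 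
      (\<beta> n * exp (- (p - 1) * ln (of_nat n)))) \<longlonglongrightarrow> 0 / rGamma (p - 1 + 1)"
    using p by (intro tendsto_divide) (auto simp: rGamma_eq_zero_iff elim!: nonpos_Ints_cases)
  moreover have "eventually (\<lambda>n. norm (1 - Gamma w * (b n * exp (- (w - 1) * of_real (ln (of_nat n))))) / 
      (\<beta> n * exp (- (p - 1) * ln (of_nat n))) = e n / \<beta> n) sequentially"
    using eventually_gt_at_top[of 0]
  proof eventually_elim
    case (elim n)
    define E where "E = exp ((w - 1) * of_real (ln (real n)))"
    have E: "of_nat n powr (w - 1) = E" "norm E = exp ((p - 1) * ln (real n))" "E \<noteq> 0"
      using elim by (auto simp: E_def powr_def p_def Ln_of_nat)
    have "exp (- (w - 1) * of_real (ln (of_nat n))) = inverse E"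
      unfolding E_def exp_minus[symmetric] by (simp add: algebra_simps)
    moreover have "E - Gamma w * b n = E * (1 - Gamma w * (b n * inverse E))"
      using E(3) by (simp add: right_diff_distrib)
    ultimately have "e n = norm E * norm (1 - Gamma w * (b n * exp (- (w - 1) * of_real (ln (of_nat n)))))"
      unfolding e_def E(1) norm_mult[symmetric] by (simp only:)
    moreover have "exp (- (p - 1) * ln (of_nat n)) = inverse (norm E)"
      unfolding E(2) exp_minus[symmetric] by (simp add: algebra_simps)
    ultimately show ?case by (simp only: divide_inverse inverse_mult_distrib inverse_inverse_eq mult_ac)
  qed
  ultimately have lim: "(\<lambda>n. e n / \<beta> n) \<longlonglongrightarrow> 0"
    by (auto intro: Lim_transform_eventually)
  show ?thesis
  proof (rule tendstoI)
    fix \<epsilon> :: real assume "\<epsilon> > 0"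
    define \<delta> where "\<delta> = \<epsilon> / 2"
    have \<delta>: "\<delta> > 0" using \<open>\<epsilon> > 0\<close> by (simp add: \<delta>_def)
    have "eventually (\<lambda>n. e n / \<beta> n < \<delta>) sequentially"
      using lim \<delta> by (rule order_tendstoD)
    then obtain N where N: "\<And>n. n \<ge> N \<Longrightarrow> e n / \<beta> n < \<delta>" by (auto simp: eventually_sequentially)
    \<comment> \<open>The finitely many early terms cost at most \<open>C\<close>, which the factor
      (1 - q)^p sends to 0. All later ones together cost at most \<open>\<delta>\<close> times the
      real binomial series, which that factor normalises to \<open>\<delta>\<close>.\<close>
    define C where "C = (\<Sum>n<N. e n)"
    have main: "dist (of_real (1 - exp (-x)) powr w * S x) (Gamma w) \<le> C * (1 - exp (-x)) powr p + \<delta>" if x: "x > 0" for x :: real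
    proof -
      define q where "q = exp (-x)"
      have q: "0 < q" "q < 1" using x by (auto simp: q_def)
      define B where "B = complex_of_real (1 - q) powr (- w)"
      have 1: "(\<lambda>n. of_nat n powr (w - 1) * of_real q ^ n - Gamma w * (b n * of_real q ^ n)) sums (S x - Gamma w * B)"
        unfolding q_def B_def using S[OF x] bs[of "exp (-x)"] x by (intro sums_diff sums_mult) auto
      have 2: "(\<lambda>n. (if n \<in> {..<N} then e n else 0) + \<delta> * (\<beta> n * q ^ n)) sums (C + \<delta> * (1 - q) powr (-p))"
        unfolding C_def by (intro sums_add sums_If_finite_set sums_mult \<beta>s q) auto
      have 3: "norm (of_nat n powr (w - 1) * of_real q ^ n - Gamma w * (b n * of_real q ^ n)) \<le> 
          (if n \<in> {..<N} then e n else 0) + \<delta> * (\<beta> n * q ^ n)" for n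
      proof -
        have "norm (of_nat n powr (w - 1) * of_real q ^ n - Gamma w * (b n * of_real q ^ n)) = 
           norm ((of_nat n powr (w - 1) - Gamma w * b n) * of_real (q ^ n))" by (simp add: algebra_simps)
        also have "\<dots> = e n * q ^ n" unfolding norm_mult e_def using q by (simp add: norm_power)
        also have "\<dots> \<le> (if n \<in> {..<N} then e n else 0) + \<delta> * (\<beta> n * q ^ n)"
        proof (cases "n < N")
          case True
          have "e n * q ^ n \<le> e n * 1" using q by (intro mult_left_mono power_le_one) (auto simp: e_def)
          moreover have "0 \<le> \<delta> * (\<beta> n * q ^ n)" using \<delta> \<beta>pos[of n] q by simp
          ultimately show ?thesis using True by simp
        next
          case False
          then have "e n \<le> \<delta> * \<beta> n" using N[of n] \<beta>pos[of n] by (simp add: field_simps)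
          then have "e n * q ^ n \<le> \<delta> * \<beta> n * q ^ n" using q by (intro mult_right_mono) auto
          then show ?thesis using False by (simp add: mult_ac)
        qed
        finally show ?thesis .
      qed
      have "norm (S x - Gamma w * B) \<le> C + \<delta> * (1 - q) powr (-p)"
        using norm_suminf_le[OF 3 sums_summable[OF 2]] sums_unique[OF 1] sums_unique[OF 2] by simp
      then have "norm (of_real (1 - q) powr w) * norm (S x - Gamma w * B) \<le> (1 - q) powr p * (C + \<delta> * (1 - q) powr (-p))"
        using q by (subst norm_powr_real_powr) (auto simp: p_def intro!: mult_left_mono)
      also have "\<dots> = C * (1 - q) powr p + \<delta>" using q by (simp add: powr_minus field_simps)
      also have "norm (of_real (1 - q) powr w) * norm (S x - Gamma w * B) = norm (of_real (1 - q) powr w * S x - Gamma w)"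
      proof -
        have "complex_of_real (1 - q) powr w * B = 1"
          unfolding B_def using q by (simp add: powr_minus del: of_real_diff)
        then have "of_real (1 - q) powr w * (S x - Gamma w * B) = of_real (1 - q) powr w * S x - Gamma w"
          by (metis (no_types, opaque_lifting) mult.left_commute mult.right_neutral right_diff_distrib)
        then show ?thesis by (simp only: norm_mult[symmetric])
      qed
      finally show ?thesis by (simp add: dist_norm q_def)
    qed
    have "((\<lambda>x::real. C * (1 - exp (-x)) powr p + \<delta>) \<longlongrightarrow> C * 0 + \<delta>) (at_right 0)"
    proof (intro tendsto_intros)
      show "((\<lambda>x::real. (1 - exp (-x)) powr p) \<longlongrightarrow> 0) (at_right 0)" using p by real_asymp
    qed
    then have "eventually (\<lambda>x::real. C * (1 - exp (-x)) powr p + \<delta> < \<epsilon>) (at_right 0)"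
      by (rule order_tendstoD) (use \<open>\<epsilon> > 0\<close> in \<open>simp add: \<delta>_def\<close>)
    moreover have "eventually (\<lambda>x::real. x > 0) (at_right 0)" by (simp add: eventually_at_right_less)
    ultimately show "eventually (\<lambda>x::real. dist (of_real (1 - exp (-x)) powr w * S x) (Gamma w) < \<epsilon>) (at_right 0)"
    proof eventually_elim
      case (elim x)
      then show ?case using main[of x] by linarith
    qed
  qed
qed

text \<open>The coefficients are known up to the single constant \<open>c\<close>. Letting x tend to
  0 along the positive reals fixes it: the Dirichlet side tends to Gamma(w), the lattice side to 1 /
  c.\<close>

theorem lipschitz_formula:
  assumes w: "Re w > 1" and m: "Re \<mu> > 0"
  shows "(\<lambda>n. of_nat n powr (w - 1) * exp (-\<mu>) ^ n) sums (Gamma w * lattice_sum w \<mu>)"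
proof -
  obtain c where c: "\<And>\<mu>. Re \<mu> > 0 \<Longrightarrow> (\<lambda>n. c * (of_nat n powr (w - 1) * exp (-\<mu>) ^ n)) sums lattice_sum w \<mu>"
    using lattice_sum_coefficients[OF w] by blast
  have ev: "eventually (\<lambda>x::real. x > 0) (at_right 0)" by (simp add: eventually_at_right_less)
  have c0: "c \<noteq> 0"
  proof
    assume "c = 0"
    then have z: "lattice_sum w (of_real x) = 0" if "x > 0" for x :: real
      using c[of "of_real x"] that sums_unique2[OF _ sums_zero] by simp
    have "((\<lambda>x::real. 0) \<longlongrightarrow> (1::complex)) (at_right (0::real))"
      by (rule Lim_transform_eventually[OF lattice_sum_asymp[OF w]]) (use ev in \<open>eventually_elim, simp add: z\<close>)
    then show False by (simp add: tendsto_const_iff)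
  qed
  have c': "(\<lambda>n. of_nat n powr (w - 1) * exp (-\<mu>) ^ n) sums (lattice_sum w \<mu> / c)" if "Re \<mu> > 0" for \<mu>
    using sums_divide[OF c[OF that], of c] c0 by simp
  have "((\<lambda>x::real. of_real (1 - exp (-x)) powr w * (lattice_sum w (of_real x) / c)) \<longlongrightarrow> Gamma w) (at_right 0)"
    by (rule dirichlet_asymp[OF w]) (use c' in \<open>simp add: exp_of_real[symmetric]\<close>)
  moreover have "((\<lambda>x::real. of_real (1 - exp (-x)) powr w * lattice_sum w (of_real x) / c) \<longlongrightarrow> 1 / c) (at_right 0)"
    by (intro tendsto_divide lattice_sum_asymp w tendsto_const c0)
  ultimately have "Gamma w = 1 / c"
    using tendsto_unique[of "at_right (0::real)"] by simp
  then show ?thesis using c'[OF m] by simp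
qed

section \<open>Analytic continuation of the zeta function\<close>

text \<open>This is Li_s(exp(-x)). The parametrisation suits the Lipschitz formula; the argument
  k^(-2) corresponds to x = 2 log k.\<close>

definition polylog :: "complex \<Rightarrow> real \<Rightarrow> complex" where
  "polylog s x = (\<Sum>\<^sub>\<infinity>n. of_nat (Suc n) powr (-s) * of_real (exp (- x * real (Suc n))))"

lemma norm_Suc_powr: "norm (of_nat (Suc n) powr s :: complex) = real (Suc n) powr Re s"
  by (subst norm_powr_real_powr) auto

text \<open>The convergence asserted by \<open>lipschitz_formula\<close> at the real point w = A' +
  1 already contains this, with \<open>A' = max A 1\<close> ensuring Re w > 1.\<close>

lemma summable_powr_exp:
  assumes x: "x > 0"
  shows "(\<lambda>n. real (Suc n) powr A * exp (- x * real (Suc n))) summable_on UNIV"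
proof -
  define A' where "A' = max A 1"
  have A': "A' \<ge> A" "A' \<ge> 1" by (auto simp: A'_def)
  have "summable (\<lambda>n. of_nat n powr (of_real (A' + 1) - 1) * exp (- of_real x) ^ n :: complex)"
    using lipschitz_formula[of "of_real (A' + 1)" "of_real x"] x A' by (intro sums_summable) auto
  then have "summable (\<lambda>n. Re (of_nat n powr (of_real (A' + 1) - 1) * exp (- of_real x) ^ n :: complex))"
    by (rule summable_Re)
  also have "(\<lambda>n. Re (of_nat n powr (of_real (A' + 1) - 1) * exp (- of_real x) ^ n :: complex)) = (\<lambda>n. real n powr A' * exp (- x * real n))"
  proof
    fix n
    have "of_nat n powr (of_real (A' + 1) - 1) * exp (- of_real x) ^ n = complex_of_real (real n powr A') * of_real (exp (-x) ^ n)"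
      using powr_of_real[of "real n" A'] by (simp flip: exp_of_real)
    then show "Re (of_nat n powr (of_real (A' + 1) - 1) * exp (- of_real x) ^ n :: complex) = real n powr A' * exp (- x * real n)"
      by (simp add: exp_of_nat_mult[symmetric] mult.commute del: of_real_power)
  qed
  finally have "summable (\<lambda>n. real (Suc n) powr A' * exp (- x * real (Suc n)))"
    by (subst summable_Suc_iff)
  then have "(\<lambda>n. real (Suc n) powr A' * exp (- x * real (Suc n))) summable_on UNIV"
    by (subst summable_on_nat_iff_nonneg) auto
  then show ?thesis
    by (rule summable_on_comparison_test) (use A' in \<open>auto intro!: powr_mono\<close>)
qed

lemma polylog_term_bound:
  assumes "- Re s \<le> A"
  shows "norm (of_nat (Suc n) powr (-s) * of_real (exp (- x * real (Suc n)))) \<le> real (Suc n) powr A * exp (- x * real (Suc n))"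
  unfolding norm_mult norm_Suc_powr using assms by (auto intro!: mult_right_mono powr_mono)

lemma polylog_has_sum:
  assumes "x > 0"
  shows "((\<lambda>n. of_nat (Suc n) powr (-s) * of_real (exp (- x * real (Suc n)))) has_sum polylog s x) UNIV"
  unfolding polylog_def
  by (rule has_sum_infsum, rule infsum_norm_le(1)[OF polylog_term_bound[OF order_refl] summable_powr_exp[OF assms]])

lemma polylog_holomorphic:
  assumes "x > 0" shows "(\<lambda>s. polylog s x) holomorphic_on UNIV"
  unfolding polylog_def
proof (rule infsum_holomorphic)
  show "(\<lambda>s. of_nat (Suc n) powr (-s) * of_real (exp (- x * real (Suc n)))) holomorphic_on UNIV" for n
    by (intro holomorphic_intros)
  fix z :: complex
  have "norm (of_nat (Suc n) powr (-u) * of_real (exp (- x * real (Suc n)))) \<le> real (Suc n) powr (\<bar>Re z\<bar> + 1) * exp (- x * real (Suc n))"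
    if "u \<in> cball z 1" for u n
  proof (rule polylog_term_bound)
    have "norm (z - u) \<le> 1" using that by (simp add: dist_norm)
    then show "- Re u \<le> \<bar>Re z\<bar> + 1" using complex_Re_le_cmod[of "z - u"] by simp
  qed
  then show "\<exists>r>0. \<exists>M. M summable_on UNIV \<and> (\<forall>n\<in>UNIV. \<forall>u\<in>UNIV \<inter> cball z r.
      norm (of_nat (Suc n) powr (-u) * of_real (exp (- x * real (Suc n)))) \<le> M n)"
    using summable_powr_exp[OF assms, of "\<bar>Re z\<bar> + 1"] by (intro exI[of _ 1] conjI exI) auto
qed auto

lemma polylog_lat:
  assumes "x > 0" "Re s < 0"
  shows "polylog s x = Gamma (1 - s) * lattice_sum (1 - s) (of_real x)"
proof -
  have "(\<lambda>n. of_nat n powr (1 - s - 1) * exp (- of_real x) ^ n) sums (Gamma (1 - s) * lattice_sum (1 - s) (of_real x))"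
    by (rule lipschitz_formula) (use assms in auto)
  then have "(\<lambda>n. of_nat (Suc n) powr (- s) * exp (- of_real x) ^ Suc n) sums (Gamma (1 - s) * lattice_sum (1 - s) (of_real x))"
    by (subst sums_Suc_iff) simp
  moreover have "exp (- of_real x) ^ Suc n = complex_of_real (exp (- x * real (Suc n)))" for n
  proof -
    have "exp (- x * real (Suc n)) = exp (-x) ^ Suc n"
      by (simp only: exp_of_nat_mult[symmetric] mult.commute)
    then show ?thesis by (simp add: exp_of_real[symmetric])
  qed
  ultimately show ?thesis
    using has_sum_imp_sums[OF polylog_has_sum[OF assms(1), of s]] sums_unique2 by (metis (no_types, lifting) sums_cong)
qed

text \<open>The value at u = 0 of (u + 2 pi i j)^(s-1) minus its first-order Taylor polynomial at u
  = x. Subtracting it improves the decay in \<open>j\<close> from |j|^(Re s - 1) to |j|^(Re s - 3),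
  so the sum converges for Re s < 2 and reaches across the line Re s = 1.\<close>

definition taylor_rem :: "complex \<Rightarrow> real \<Rightarrow> int \<Rightarrow> complex" where
  "taylor_rem s x j = two_pi_i j powr (s - 1) - (of_real x + two_pi_i j) powr (s - 1)
      - (1 - s) * of_real x * (of_real x + two_pi_i j) powr (s - 2)"

lemma norm_two_pi_i_shift_ge:
  assumes "j \<noteq> 0"
  shows "1 + \<bar>of_int j\<bar> \<le> norm (of_real x + two_pi_i j)"
proof -
  have j: "1 \<le> \<bar>real_of_int j\<bar>" using assms by linarith
  have "\<bar>real_of_int j\<bar> \<le> pi * \<bar>real_of_int j\<bar>" using pi_gt3 mult_right_mono[of 1 pi "\<bar>real_of_int j\<bar>"] by simp
  moreover have "\<bar>2 * pi * of_int j\<bar> \<le> norm (of_real x + two_pi_i j)"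
    using abs_Im_le_cmod[of "of_real x + two_pi_i j"] by simp
  then have "2 * (pi * \<bar>of_int j\<bar>) \<le> norm (of_real x + two_pi_i j)" by (simp add: abs_mult)
  ultimately show ?thesis using j by linarith
qed

lemma shifted_powr_bound:
  assumes j: "j \<noteq> 0" and s: "Re s \<le> p" "p \<le> 0" "\<bar>Im s\<bar> \<le> V"
  shows "norm ((of_real x + two_pi_i j) powr s) \<le> exp (pi * V) * (1 + \<bar>of_int j\<bar>) powr p"
proof -
  have "norm ((of_real x + two_pi_i j) powr s) \<le> exp (pi * \<bar>Im s\<bar>) * norm (of_real x + two_pi_i j) powr Re s"
    by (rule norm_powr_le)
  also have "\<dots> \<le> exp (pi * V) * (1 + \<bar>of_int j\<bar>) powr Re s"
    using s norm_two_pi_i_shift_ge[OF j, of x] by (intro mult_mono powr_mono2') auto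
  also have "\<dots> \<le> exp (pi * V) * (1 + \<bar>of_int j\<bar>) powr p"
    using s by (intro mult_left_mono powr_mono) auto
  finally show ?thesis .
qed

lemma taylor_rem_bound:
  assumes j: "j \<noteq> 0" and x: "0 \<le> x" "x \<le> 1" and s: "Re s \<le> p" "p \<le> 2" "norm s \<le> V"
  shows "norm (taylor_rem s x j) \<le> (V + 1) * (V + 2) * exp (pi * V) * (1 + \<bar>of_int j\<bar>) powr (p - 3)"
proof -
  define f where "f = (\<lambda>(i::nat) u. if i = 0 then (u + two_pi_i j) powr (s - 1)
     else if i = 1 then (s - 1) * (u + two_pi_i j) powr (s - 2)
     else (s - 1) * (s - 2) * (u + two_pi_i j) powr (s - 3))"
  define B where "B = (V + 1) * (V + 2) * exp (pi * V) * (1 + \<bar>of_int j\<bar>) powr (p - 3)"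
  \<comment> \<open>On the real line the imaginary part of u + 2 pi i j is the constant 2 pi j,
    nonzero, so the branch cut is never met.\<close>
  let ?S = "{u. Im u = 0}"
  have V: "V \<ge> 0" using s norm_ge_zero order_trans by blast
  have nn: "u + two_pi_i j \<notin> \<real>\<^sub>\<le>\<^sub>0" if "Im u = 0" for u
    using that j by (intro notin_nonpos_Reals(2)) simp
  have "norm (f 0 0 - (\<Sum>i\<le>(1::nat). f i (of_real x) * (0 - of_real x) ^ i / fact i)) \<le> B * norm (0 - complex_of_real x) ^ Suc 1 / fact 1"
  proof (rule complex_Taylor[where S="?S"])
    show "convex ?S" using convex_hyperplane[of \<i> 0] by (simp add: inner_complex_def)
    fix i :: nat and u assume u: "u \<in> ?S" "i \<le> 1"
    then consider "i = 0" | "i = 1" by linarith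
    then show "(f i has_field_derivative f (Suc i) u) (at u within ?S)"
    proof cases
      case 1
      have "((\<lambda>u. (u + two_pi_i j) powr (s - 1)) has_field_derivative (s - 1) * (u + two_pi_i j) powr (s - 2)) (at u)"
        using nn[of u] u by (auto intro!: derivative_eq_intros)
      then show ?thesis using 1 by (auto simp: f_def has_field_derivative_at_within)
    next
      case 2
      have "((\<lambda>u. (s - 1) * (u + two_pi_i j) powr (s - 2)) has_field_derivative (s - 1) * (s - 2) * (u + two_pi_i j) powr (s - 3)) (at u)"
        using nn[of u] u by (auto intro!: derivative_eq_intros)
      then show ?thesis using 2 by (auto simp: f_def has_field_derivative_at_within)
    qed
  next
    fix u assume "u \<in> ?S"
    then have "u = of_real (Re u)" by (simp add: complex_eq_iff)
    then have "norm ((u + two_pi_i j) powr (s - 3)) \<le> exp (pi * V) * (1 + \<bar>of_int j\<bar>) powr (p - 3)"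
      using shifted_powr_bound[OF j, of "s - 3" "p - 3" V "Re u"] s abs_Im_le_cmod[of s] by simp
    moreover have "norm (s - 1) \<le> V + 1" "norm (s - 2) \<le> V + 2"
      using norm_triangle_ineq4[of s 1] norm_triangle_ineq4[of s 2] s by auto
    ultimately have "norm (s - 1) * norm (s - 2) * norm ((u + two_pi_i j) powr (s - 3)) \<le> (V + 1) * (V + 2) * (exp (pi * V) * (1 + \<bar>of_int j\<bar>) powr (p - 3))"
      using V by (intro mult_mono) auto
    then show "norm (f (Suc 1) u) \<le> B" by (simp add: f_def B_def norm_mult mult_ac)
  qed auto
  also have "f 0 0 - (\<Sum>i\<le>(1::nat). f i (of_real x) * (0 - of_real x) ^ i / fact i) = taylor_rem s x j"
    by (simp add: f_def taylor_rem_def algebra_simps)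
  also have "B * norm (0 - complex_of_real x) ^ Suc 1 / fact 1 \<le> B * 1"
  proof -
    have "x * x \<le> 1" using x by (simp add: mult_le_one)
    moreover have "B \<ge> 0" using V by (auto simp: B_def intro!: mult_nonneg_nonneg)
    ultimately show ?thesis using x by (simp add: mult_left_le)
  qed
  finally show ?thesis by (simp add: B_def)
qed

lemma summable_on_int_powr:
  assumes "p < -1" shows "(\<lambda>j::int. C * (1 + \<bar>of_int j\<bar>) powr p :: real) summable_on S"
proof -
  have "(\<lambda>j::int. C * (1 + \<bar>of_int j\<bar>) powr (- (- p)) :: real) summable_on UNIV"
    using assms by (intro summable_on_cmult_right summable_int_powr) auto
  then show ?thesis by (intro summable_on_subset[where A = UNIV and B = S]) auto
qed

lemma taylor_rem_sum_holomorphic: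
  assumes "0 \<le> x" "x \<le> 1"
  shows "(\<lambda>s. \<Sum>\<^sub>\<infinity>j\<in>-{0}. taylor_rem s x j) holomorphic_on {s. Re s < 2}"
proof (rule infsum_holomorphic)
  show "open {s. Re s < 2}" by (rule open_halfspace_Re_lt)
  show "(\<lambda>s. taylor_rem s x j) holomorphic_on {s. Re s < 2}" if "j \<in> -{0}" for j
  proof -
    have "of_real x + two_pi_i j \<noteq> 0" "two_pi_i j \<noteq> 0" using that by (auto simp: complex_eq_iff)
    then show ?thesis unfolding taylor_rem_def by (intro holomorphic_intros)
  qed
  fix z assume "z \<in> {s. Re s < 2}"
  then have z: "Re z < 2" by simp
  define r where "r = (2 - Re z) / 2"
  define p where "p = Re z + r"
  define V where "V = norm z + r"
  have r: "r > 0" "p < 2" using z by (auto simp: r_def p_def field_simps)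
  let ?M = "\<lambda>j::int. (V + 1) * (V + 2) * exp (pi * V) * (1 + \<bar>of_int j\<bar>) powr (p - 3)"
  have "norm (taylor_rem u x j) \<le> ?M j" if "u \<in> cball z r" "j \<in> -{0}" for u j
  proof (rule taylor_rem_bound)
    have d: "norm (u - z) \<le> r" using that by (simp add: dist_norm norm_minus_commute)
    show "Re u \<le> p" using complex_Re_le_cmod[of "u - z"] d by (simp add: p_def)
    show "norm u \<le> V" using norm_triangle_sub[of u z] d by (simp add: V_def)
  qed (use that assms r in auto)
  moreover have "?M summable_on -{0}" by (rule summable_on_int_powr) (use r in auto)
  ultimately show "\<exists>r>0. \<exists>M. M summable_on -{0} \<and> (\<forall>j\<in>-{0}. \<forall>u\<in>{s. Re s < 2} \<inter> cball z r. norm (taylor_rem u x j) \<le> M j)"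
    using r by (intro exI[of _ r] conjI exI[of _ ?M]) auto
qed

lemma Re_pos_notin_nonpos_Ints: "Re z > 0 \<Longrightarrow> z \<notin> \<int>\<^sub>\<le>\<^sub>0"
  by (auto elim!: nonpos_Ints_cases)

text \<open>
  With \<open>H s x = polylog s x - \<Gamma>(1-s) x\<^sup>s\<^sup>-\<^sup>1\<close> one has \<open>\<partial>\<^sub>x H s x = - H (s-1) x\<close>. Integrating twice by parts expresses the
  limit \<open>\<zeta>(s)\<close> of \<open>H s x\<close> as \<open>x\<close> tends to \<open>0\<close> through \<open>H s x\<close>, \<open>H (s-1) x\<close> and an integral of
  \<open>H (s-2)\<close>, to which the Lipschitz formula applies as soon as \<open>Re s < 2\<close>. The resulting expression does not depend on \<open>x\<close>.
\<close>

definition zeta_cont :: "complex \<Rightarrow> real \<Rightarrow> complex" where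
  "zeta_cont s x = polylog s x + of_real x * polylog (s - 1) x
     - (Gamma (1 - s) + Gamma (2 - s)) * of_real x powr (s - 1)
     + Gamma (1 - s) * (\<Sum>\<^sub>\<infinity>j\<in>-{0}. taylor_rem s x j)"

lemma zeta_cont_holomorphic:
  assumes x: "0 < x" "x \<le> 1"
  shows "(\<lambda>s. zeta_cont s x) holomorphic_on ({s. Re s < 2} - {1})"
proof -
  have "1 - s \<notin> \<int>\<^sub>\<le>\<^sub>0" "2 - s \<notin> \<int>\<^sub>\<le>\<^sub>0" if "s \<in> {s. Re s < 2} - {1}" for s
  proof -
    have "1 - s \<noteq> - of_nat n" for n
    proof
      assume *: "1 - s = - of_nat n"
      then have "s = 1 + of_nat n" by (simp add: algebra_simps)
      then show False using that by (cases n) auto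
    qed
    then show "1 - s \<notin> \<int>\<^sub>\<le>\<^sub>0" by (auto elim!: nonpos_Ints_cases')
    show "2 - s \<notin> \<int>\<^sub>\<le>\<^sub>0" using that by (intro Re_pos_notin_nonpos_Ints) simp
  qed
  moreover have "(\<lambda>s. \<Sum>\<^sub>\<infinity>j\<in>-{0}. taylor_rem s x j) holomorphic_on ({s. Re s < 2} - {1})"
    by (rule holomorphic_on_subset[OF taylor_rem_sum_holomorphic]) (use x in auto)
  moreover have "(\<lambda>s. polylog s x) holomorphic_on ({s. Re s < 2} - {1})"
    by (rule holomorphic_on_subset[OF polylog_holomorphic]) (use x in auto)
  moreover have "(\<lambda>s. polylog (s - 1) x) holomorphic_on ({s. Re s < 2} - {1})"
    by (rule holomorphic_on_compose_gen[OF _ polylog_holomorphic, of "\<lambda>s. s - 1", unfolded o_def]) (use x in \<open>auto intro: holomorphic_intros\<close>)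
  ultimately show ?thesis unfolding zeta_cont_def using x by (intro holomorphic_intros) auto
qed

lemma shifted_summable:
  assumes "Re s < -1"
  shows "(\<lambda>j. (of_real x + two_pi_i j) powr s) summable_on -{0}"
  by (rule infsum_norm_le(1)[where M="\<lambda>j. exp (pi * \<bar>Im s\<bar>) * (1 + \<bar>of_int j\<bar>) powr Re s"])
     (use assms in \<open>auto intro!: shifted_powr_bound summable_on_int_powr\<close>)

lemma lattice_sum_split:
  assumes "Re w > 1" "x > 0"
  shows "lattice_sum w (of_real x) = of_real x powr (-w) + (\<Sum>\<^sub>\<infinity>j\<in>-{0}. (of_real x + two_pi_i j) powr (-w))"
proof -
  have "(\<Sum>\<^sub>\<infinity>j\<in>insert 0 (-{0}). (of_real x + two_pi_i j) powr (-w)) = (of_real x + two_pi_i 0) powr (-w) + (\<Sum>\<^sub>\<infinity>j\<in>-{0}. (of_real x + two_pi_i j) powr (-w))"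
    by (rule infsum_insert) (use shifted_summable[of "-w" x] assms in auto)
  moreover have "insert 0 (-{0}) = (UNIV :: int set)" by auto
  ultimately show ?thesis by (simp add: lattice_sum_def)
qed

text \<open>Here the three sums inside the Taylor remainder converge separately. Inserting the
  Lipschitz formula for both polylogarithms and Gamma(2-s) = (1-s) Gamma(1-s) cancels everything
  that depends on \<open>x\<close>; the rest is the functional equation in Hurwitz's form.\<close>

lemma zeta_cont_neg:
  assumes x: "0 < x" and s: "Re s < 0"
  shows "zeta_cont s x = Gamma (1 - s) * (\<Sum>\<^sub>\<infinity>j\<in>-{0}. two_pi_i j powr (s - 1))"
proof -
  define A where "A = (\<Sum>\<^sub>\<infinity>j\<in>-{0}. two_pi_i j powr (s - 1))"
  define B where "B = (\<Sum>\<^sub>\<infinity>j\<in>-{0}. (of_real x + two_pi_i j) powr (s - 1))"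
  define C where "C = (\<Sum>\<^sub>\<infinity>j\<in>-{0}. (of_real x + two_pi_i j) powr (s - 2))"
  have A: "((\<lambda>j. two_pi_i j powr (s - 1)) has_sum A) (-{0})"
    unfolding A_def using shifted_summable[of "s - 1" 0] s by (intro has_sum_infsum) simp
  have B: "((\<lambda>j. (of_real x + two_pi_i j) powr (s - 1)) has_sum B) (-{0})"
    unfolding B_def using shifted_summable[of "s - 1" x] s by (intro has_sum_infsum) simp
  have C: "((\<lambda>j. (of_real x + two_pi_i j) powr (s - 2)) has_sum C) (-{0})"
    unfolding C_def using shifted_summable[of "s - 2" x] s by (intro has_sum_infsum) simp
  have "((\<lambda>j. two_pi_i j powr (s - 1) + (- ((of_real x + two_pi_i j) powr (s - 1))) + (- ((1 - s) * of_real x)) * (of_real x + two_pi_i j) powr (s - 2))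
    has_sum (A + (- B) + (- ((1 - s) * of_real x)) * C)) (-{0})"
    by (intro has_sum_add has_sum_cmult_right A C) (use B in \<open>simp add: has_sum_uminus\<close>)
  then have br: "(\<Sum>\<^sub>\<infinity>j\<in>-{0}. taylor_rem s x j) = A - B - (1 - s) * of_real x * C"
    by (intro infsumI) (simp add: taylor_rem_def)
  have p1: "polylog s x = Gamma (1 - s) * (of_real x powr (s - 1) + B)"
    using polylog_lat[OF x, of s] lattice_sum_split[of "1 - s" x] s x by (simp add: B_def)
  have p2: "polylog (s - 1) x = Gamma (2 - s) * (of_real x powr (s - 2) + C)"
    using polylog_lat[OF x, of "s - 1"] lattice_sum_split[of "2 - s" x] s x by (simp add: C_def)
  have g: "Gamma (2 - s) = (1 - s) * Gamma (1 - s)"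
  proof -
    have "1 - s \<notin> \<int>\<^sub>\<le>\<^sub>0" using s by (intro Re_pos_notin_nonpos_Ints) simp
    then show ?thesis using Gamma_plus1[of "1 - s"] by simp
  qed
  have xx: "of_real x * of_real x powr (s - 2) = complex_of_real x powr (s - 1)"
    using x powr_add[of "complex_of_real x" 1 "s - 2"] by simp
  have "zeta_cont s x = Gamma (1 - s) * (of_real x powr (s - 1) + B) + Gamma (2 - s) * (of_real x * of_real x powr (s - 2) + of_real x * C)
     - (Gamma (1 - s) + Gamma (2 - s)) * of_real x powr (s - 1) + Gamma (1 - s) * (A - B - (1 - s) * of_real x * C)"
    unfolding zeta_cont_def p1 p2 br by (simp add: ring_distribs mult_ac)
  also have "\<dots> = Gamma (1 - s) * A" unfolding xx g by (simp add: algebra_simps)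
  finally show ?thesis by (simp add: A_def)
qed

text \<open>Independence of \<open>x\<close> is explicit for Re s < 0 by
  \<open>zeta_cont_neg\<close>; the identity theorem carries it across the punctured
  half-plane.\<close>

lemma zeta_cont_const:
  assumes x: "0 < x" "x \<le> 1" and s: "Re s < 2" "s \<noteq> 1"
  shows "zeta_cont s x = zeta_cont s 1"
proof (rule analytic_continuation_open[of "{s. Re s < 0}" "{s. Re s < 2} - {1}" "\<lambda>s. zeta_cont s x" "\<lambda>s. zeta_cont s 1"])
  show "connected ({s. Re s < 2} - {1::complex})"
    by (intro connected_open_delete convex_connected convex_halfspace_Re_lt open_halfspace_Re_lt) auto
  have "Re (-1) < 0" by simp
  then show "{s. Re s < 0} \<noteq> {}" by blast
  show "(\<lambda>s. zeta_cont s x) holomorphic_on ({s. Re s < 2} - {1})" "(\<lambda>s. zeta_cont s 1) holomorphic_on ({s. Re s < 2} - {1})"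
    using zeta_cont_holomorphic x by auto
  show "open ({s. Re s < 2} - {1::complex})" by (intro open_delete open_halfspace_Re_lt)
qed (use s x zeta_cont_neg[of x] zeta_cont_neg[of 1] in \<open>auto intro: open_halfspace_Re_lt\<close>)

section \<open>Gluing the continuation to the Dirichlet series\<close>

definition dseries :: "complex \<Rightarrow> complex" where
  "dseries s = (\<Sum>\<^sub>\<infinity>n. of_nat (Suc n) powr (-s))"

lemma dseries_has_sum:
  assumes "Re s > 1"
  shows "((\<lambda>n. of_nat (Suc n) powr (-s)) has_sum dseries s) UNIV"
  unfolding dseries_def
  by (rule has_sum_infsum, rule infsum_norm_le(1)[where M="\<lambda>n. real (Suc n) powr (- Re s)"])
     (use assms summable_Suc_powr[of "Re s"] norm_Suc_powr in auto)

text \<open>In the overlap strip all terms except the first polylogarithm vanish as x tends to 0.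
  The expression being constant in \<open>x\<close>, the limit identifies it with the Dirichlet
  series.\<close>

lemma zeta_cont_limit:
  assumes s: "1 < Re s" "Re s < 2"
  shows "((\<lambda>x. zeta_cont s x) \<longlongrightarrow> dseries s) (at_right 0)"
proof -
  have ev: "eventually (\<lambda>x::real. 0 < x \<and> x < 1) (at_right 0)"
    using eventually_at_right_less[of 0] eventually_at_right[of 0 1] by (auto simp: eventually_at_right_field intro!: exI[of _ 1])
  have Ms: "(\<lambda>n. real (Suc n) powr (- Re s)) summable_on UNIV" using s by (intro summable_Suc_powr) auto
  have 1: "((\<lambda>x. polylog s x) \<longlongrightarrow> dseries s) (at_right 0)"
    unfolding polylog_def dseries_def
  proof (rule infsum_tannery[OF _ _ Ms])
    fix n
    have "((\<lambda>x. of_nat (Suc n) powr (-s) * complex_of_real (exp (- x * real (Suc n)))) \<longlongrightarrow> of_nat (Suc n) powr (-s) * of_real (exp (- 0 * real (Suc n)))) (at_right 0)"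
      by (intro tendsto_intros)
    then show "((\<lambda>x. of_nat (Suc n) powr (-s) * complex_of_real (exp (- x * real (Suc n)))) \<longlongrightarrow> of_nat (Suc n) powr (-s)) (at_right 0)"
      by simp
  next
    show "\<forall>\<^sub>F x in at_right 0. \<forall>n\<in>UNIV. norm (of_nat (Suc n) powr (-s) * complex_of_real (exp (- x * real (Suc n)))) \<le> real (Suc n) powr (- Re s)"
      using ev
    proof eventually_elim
      case (elim x)
      have "norm (of_nat (Suc n) powr (-s) * complex_of_real (exp (- x * real (Suc n)))) \<le> real (Suc n) powr (- Re s)" for n
      proof (rule order_trans[OF polylog_term_bound[OF order_refl]])
        have "real (Suc n) powr (- Re s) * exp (- x * real (Suc n)) \<le> real (Suc n) powr (- Re s) * 1"
          using elim by (intro mult_left_mono) auto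
        then show "real (Suc n) powr (- Re s) * exp (- x * real (Suc n)) \<le> real (Suc n) powr (- Re s)" by simp
      qed
      then show ?case by blast
    qed
  qed auto
  \<comment> \<open>The factor x cannot be pulled out first, as the series for s - 1 diverges at x =
    0. Kept inside, it is controlled by y exp(-y) \<le> 1 with y = x (n + 1), which leaves the same
    majorant as before.\<close>
  have "((\<lambda>x. \<Sum>\<^sub>\<infinity>n. of_real x * (of_nat (Suc n) powr (-(s - 1)) * of_real (exp (- x * real (Suc n))))) \<longlongrightarrow> (\<Sum>\<^sub>\<infinity>n::nat. 0::complex)) (at_right 0)"
  proof (rule infsum_tannery[OF _ _ Ms])
    fix n
    have "((\<lambda>x. of_real x * (of_nat (Suc n) powr (-(s - 1)) * complex_of_real (exp (- x * real (Suc n))))) \<longlongrightarrow> of_real 0 * (of_nat (Suc n) powr (-(s-1)) * of_real (exp (- 0 * real (Suc n))))) (at_right 0)"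
      by (intro tendsto_intros)
    then show "((\<lambda>x. of_real x * (of_nat (Suc n) powr (-(s - 1)) * complex_of_real (exp (- x * real (Suc n))))) \<longlongrightarrow> 0) (at_right 0)"
      by simp
  next
    show "\<forall>\<^sub>F x in at_right 0. \<forall>n\<in>UNIV. norm (of_real x * (of_nat (Suc n) powr (-(s - 1)) * complex_of_real (exp (- x * real (Suc n))))) \<le> real (Suc n) powr (- Re s)"
      using ev
    proof eventually_elim
      case (elim x)
      have "norm (of_real x * (of_nat (Suc n) powr (-(s - 1)) * complex_of_real (exp (- x * real (Suc n))))) \<le> real (Suc n) powr (- Re s)" for n
      proof -
        have "norm (of_real x * (of_nat (Suc n) powr (-(s - 1)) * complex_of_real (exp (- x * real (Suc n))))) = 
           x * (real (Suc n) powr (1 + - Re s) * exp (- x * real (Suc n)))"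
          unfolding norm_mult norm_Suc_powr using elim by simp
        also have "real (Suc n) powr (1 + - Re s) = real (Suc n) * real (Suc n) powr (- Re s)"
          by (subst powr_add) simp
        also have "x * (real (Suc n) * real (Suc n) powr (- Re s) * exp (- x * real (Suc n))) = 
           real (Suc n) powr (- Re s) * ((x * real (Suc n)) * exp (- (x * real (Suc n))))" by simp
        also have "(x * real (Suc n)) * exp (- (x * real (Suc n))) \<le> exp (x * real (Suc n)) * exp (- (x * real (Suc n)))"
        proof (rule mult_right_mono)
          show "x * real (Suc n) \<le> exp (x * real (Suc n))"
            using exp_ge_add_one_self[of "x * real (Suc n)"] by linarith
        qed simp
        also have "\<dots> = 1" by (simp flip: exp_add)
        finally show ?thesis by (simp add: mult_left_mono)
      qed
      then show ?case by blast
    qed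
  qed auto
  then have 2: "((\<lambda>x. of_real x * polylog (s - 1) x) \<longlongrightarrow> 0) (at_right 0)"
    unfolding polylog_def by (simp add: infsum_cmult_right')
  have "((\<lambda>x::real. norm (complex_of_real x powr (s - 1))) \<longlongrightarrow> 0) (at_right 0)"
  proof (rule Lim_transform_eventually)
    show "((\<lambda>x::real. x powr (Re s - 1)) \<longlongrightarrow> 0) (at_right 0)"
      using s by real_asymp
    show "eventually (\<lambda>x::real. x powr (Re s - 1) = norm (complex_of_real x powr (s - 1))) (at_right 0)"
      using ev by eventually_elim (simp add: norm_powr_real_powr)
  qed
  then have 3: "((\<lambda>x::real. complex_of_real x powr (s - 1)) \<longlongrightarrow> 0) (at_right 0)"
    by (rule tendsto_norm_zero_cancel)
  have "((\<lambda>x. \<Sum>\<^sub>\<infinity>j\<in>-{0}. taylor_rem s x j) \<longlongrightarrow> (\<Sum>\<^sub>\<infinity>j\<in>-{0::int}. 0)) (at_right 0)"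
  proof (rule infsum_tannery[where f="\<lambda>j x. taylor_rem s x j" and M="\<lambda>j. (norm s + 1) * (norm s + 2) * exp (pi * norm s) * (1 + \<bar>of_int j\<bar>) powr (Re s - 3)"])
    fix j :: int assume j: "j \<in> -{0}"
    have "((\<lambda>x. taylor_rem s x j) \<longlongrightarrow> two_pi_i j powr (s - 1) - (of_real 0 + two_pi_i j) powr (s - 1)
      - (1 - s) * of_real 0 * (of_real 0 + two_pi_i j) powr (s - 2)) (at_right 0)"
      unfolding taylor_rem_def using j by (intro tendsto_intros tendsto_powr_complex) (auto simp: complex_nonpos_Reals_iff)
    then show "((\<lambda>x. taylor_rem s x j) \<longlongrightarrow> 0) (at_right 0)" by simp
  next
    show "\<forall>\<^sub>F x in at_right 0. \<forall>j\<in>-{0}. norm (taylor_rem s x j) \<le> (norm s + 1) * (norm s + 2) * exp (pi * norm s) * (1 + \<bar>of_int j\<bar>) powr (Re s - 3)"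
      using ev by eventually_elim (use s in \<open>auto intro!: taylor_rem_bound\<close>)
    show "(\<lambda>j. (norm s + 1) * (norm s + 2) * exp (pi * norm s) * (1 + \<bar>of_int j\<bar>) powr (Re s - 3)) summable_on -{0}"
      by (rule summable_on_int_powr) (use s in auto)
  qed auto
  then have 4: "((\<lambda>x. \<Sum>\<^sub>\<infinity>j\<in>-{0}. taylor_rem s x j) \<longlongrightarrow> 0) (at_right 0)" by simp
  have "((\<lambda>x. zeta_cont s x) \<longlongrightarrow> dseries s + 0 - (Gamma (1 - s) + Gamma (2 - s)) * 0 + Gamma (1 - s) * 0) (at_right 0)"
    unfolding zeta_cont_def by (intro tendsto_intros 1 2 3 4)
  then show ?thesis by simp
qed

lemma zeta_cont_eq_dseries:
  assumes s: "1 < Re s" "Re s < 2"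
  shows "zeta_cont s 1 = dseries s"
proof (rule tendsto_unique)
  show "((\<lambda>x. zeta_cont s x) \<longlongrightarrow> dseries s) (at_right 0)" by (rule zeta_cont_limit[OF s])
  have "eventually (\<lambda>x::real. 0 < x \<and> x < 1) (at_right 0)"
    by (auto simp: eventually_at_right_field intro!: exI[of _ 1])
  then have "eventually (\<lambda>x. zeta_cont s 1 = zeta_cont s x) (at_right 0)"
  proof eventually_elim
    case (elim x)
    then show ?case using zeta_cont_const[of x s] s by force
  qed
  then show "((\<lambda>x. zeta_cont s x) \<longlongrightarrow> zeta_cont s 1) (at_right 0)"
    by (rule Lim_transform_eventually[OF tendsto_const])
qed simp

lemma dseries_holomorphic: "dseries holomorphic_on {s. Re s > 1}"
  unfolding dseries_def
proof (rule infsum_holomorphic)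
  show "open {s. Re s > 1}" by (rule open_halfspace_Re_gt)
  show "(\<lambda>s. of_nat (Suc n) powr (-s)) holomorphic_on {s. Re s > 1}" for n
    by (intro holomorphic_intros)
  fix z assume "z \<in> {s. Re s > 1}"
  then have z: "Re z > 1" by simp
  define r where "r = (Re z - 1) / 2"
  have r: "r > 0" "Re z - r > 1" using z by (auto simp: r_def field_simps)
  have "norm (of_nat (Suc n) powr (-u) :: complex) \<le> real (Suc n) powr (- (Re z - r))" if "u \<in> cball z r" for u n
  proof -
    have "norm (z - u) \<le> r" using that by (simp add: dist_norm)
    then have "- Re u \<le> - (Re z - r)" using complex_Re_le_cmod[of "z - u"] by simp
    then show ?thesis unfolding norm_Suc_powr by (intro powr_mono) auto
  qed
  then show "\<exists>r>0. \<exists>M. M summable_on UNIV \<and> (\<forall>n\<in>UNIV. \<forall>u\<in>{s. Re s > 1} \<inter> cball z r. norm (of_nat (Suc n) powr (-u) :: complex) \<le> M n)"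
    using r summable_Suc_powr[of "Re z - r"] by (intro exI[of _ r] conjI exI[of _ "\<lambda>n. real (Suc n) powr (- (Re z - r))"]) auto
qed

text \<open>\<open>dseries\<close> covers Re s > 1 and \<open>zeta_cont\<close> covers Re s < 2
  without the pole; they agree on the strip in between. The formula for Re s < 0 is recorded here so
  that it can be transferred to \<open>zeta\<close> along with the defining properties.\<close>

lemma zeta_exists:
  "\<exists>f. f holomorphic_on (- {1}) \<and> f 1 = 0 \<and> (\<forall>s. Re s > 1 \<longrightarrow> (\<lambda>n. of_nat (Suc n) powr (- s)) sums f s) \<and>
     (\<forall>s. Re s < 0 \<longrightarrow> f s = Gamma (1 - s) * (\<Sum>\<^sub>\<infinity>j\<in>-{0}. two_pi_i j powr (s - 1)))"
proof -
  define f where "f = (\<lambda>s. if s = 1 then 0 else if Re s > 1 then dseries s else zeta_cont s 1)"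
  have 1: "f holomorphic_on {s. Re s > 1}"
    by (rule holomorphic_transform[OF dseries_holomorphic]) (auto simp: f_def)
  have 2: "f holomorphic_on ({s. Re s < 2} - {1})"
    by (rule holomorphic_transform[OF zeta_cont_holomorphic[of 1]]) (auto simp: f_def zeta_cont_eq_dseries)
  have "f holomorphic_on ({s. Re s > 1} \<union> ({s. Re s < 2} - {1}))"
    by (intro holomorphic_on_Un 1 2 open_delete open_halfspace_Re_lt open_halfspace_Re_gt)
  also have "{s. Re s > 1} \<union> ({s. Re s < 2} - {1}) = -{1}" by auto
  finally have "f holomorphic_on -{1}" .
  moreover have "(\<lambda>n. of_nat (Suc n) powr (- s)) sums f s" if "Re s > 1" for s
    using has_sum_imp_sums[OF dseries_has_sum[OF that]] that by (auto simp: f_def)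
  moreover have "f s = Gamma (1 - s) * (\<Sum>\<^sub>\<infinity>j\<in>-{0}. two_pi_i j powr (s - 1))" if "Re s < 0" for s
    using zeta_cont_neg[of 1 s] that by (auto simp: f_def)
  ultimately show ?thesis by (intro exI[of _ f]) (auto simp: f_def)
qed

text \<open>Resolves the definite description: two candidates agree for Re s > 1, hence on the
  connected punctured plane, and the convention at s = 1 settles the remaining point.\<close>

lemma zeta_properties:
  "zeta holomorphic_on (- {1})"
  "Re s > 1 \<Longrightarrow> (\<lambda>n. of_nat (Suc n) powr (- s)) sums zeta s"
  "Re s < 0 \<Longrightarrow> zeta s = Gamma (1 - s) * (\<Sum>\<^sub>\<infinity>j\<in>-{0}. two_pi_i j powr (s - 1))"
proof -
  let ?P = "\<lambda>f. f holomorphic_on (- {1}) \<and> f 1 = 0 \<and> (\<forall>s. Re s > 1 \<longrightarrow> (\<lambda>n. of_nat (Suc n) powr (- s)) sums f s)"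
  obtain f where f: "?P f" "\<And>s. Re s < 0 \<Longrightarrow> f s = Gamma (1 - s) * (\<Sum>\<^sub>\<infinity>j\<in>-{0}. two_pi_i j powr (s - 1))"
    using zeta_exists by blast
  have "zeta = f" unfolding zeta_def
  proof (rule the_equality)
    show "?P f" by (rule f(1))
    fix g assume g: "?P g"
    show "g = f"
    proof
      fix s show "g s = f s"
      proof (cases "s = 1")
        case True then show ?thesis using f g by simp
      next
        case False
        show ?thesis
        proof (rule analytic_continuation_open[of "{s. Re s > 1}" "-{1}" g f])
          have "Re 2 > 1" by simp
          then show "{s. Re s > 1} \<noteq> {}" by blast
          show "connected (- {1::complex})" by (rule connected_punctured_universe) auto
          show "g z = f z" if "z \<in> {s. Re s > 1}" for z using f g that sums_unique2 by blast
        qed (use f g False in \<open>auto intro: open_halfspace_Re_gt\<close>)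
      qed
    qed
  qed
  then show "zeta holomorphic_on (- {1})"
    "Re s > 1 \<Longrightarrow> (\<lambda>n. of_nat (Suc n) powr (- s)) sums zeta s"
    "Re s < 0 \<Longrightarrow> zeta s = Gamma (1 - s) * (\<Sum>\<^sub>\<infinity>j\<in>-{0}. two_pi_i j powr (s - 1))" using f by auto
qed

section \<open>Lower bounds for the Gamma function and the tail of the series E\<close>

lemma norm_Gamma_series:
  assumes "n > 0"
  shows "norm (Gamma_series z n) = fact n * real n powr Re z / (\<Prod>k=0..n. norm (z + of_nat k))"
  using assms
  by (simp add: Gamma_series_def norm_mult norm_divide pochhammer_prod atLeastLessThanSuc_atLeastAtMost powr_def flip: prod_norm)

text \<open>|Gamma(x+iy)| / Gamma(x) is the product over k of (1 + y^2/(x+k)^2)^(-1/2), and each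
  factor grows with x. The comparison with x = 1 is made factor by factor in the finite products of
  the Gauss limit.\<close>

lemma norm_Gamma_ge:
  assumes x: "x \<ge> 1"
  shows "Gamma x * norm (Gamma (Complex 1 y)) \<le> norm (Gamma (Complex x y))"
proof -
  have "norm (Gamma_series (complex_of_real x) n) * norm (Gamma_series (Complex 1 y) n) \<le> norm (Gamma_series (Complex x y) n) * norm (Gamma_series (1::complex) n)"
    if n: "n > 0" for n
  proof -
    define P where "P = (\<lambda>z. \<Prod>k=0..n. norm (z + complex_of_nat k))"
    have nz: "z + of_nat k \<noteq> 0" if "Re z > 0" for z k
    proof -
      have "Re (z + of_nat k) > 0" using that by simp
      then show ?thesis by (metis zero_complex.sel(1) less_irrefl)
    qed
    have pos: "P z > 0" if "Re z > 0" for z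
      unfolding P_def by (intro prod_pos) (use nz[OF that] in auto)
    have "P (Complex x y) * P 1 \<le> P (of_real x) * P (Complex 1 y)"
      unfolding P_def prod.distrib[symmetric]
    proof (intro prod_mono conjI)
      fix k assume "k \<in> {0..n}"
      have "(1 + real k) * y\<^sup>2 * (1 + real k) \<le> (x + real k) * y\<^sup>2 * (x + real k)"
        using x by (intro mult_mono) auto
      then have "((x + k)\<^sup>2 + y\<^sup>2) * (1 + real k)\<^sup>2 \<le> (x + k)\<^sup>2 * ((1 + real k)\<^sup>2 + y\<^sup>2)"
        by (simp add: power2_eq_square algebra_simps)
      then have "sqrt (((x + k)\<^sup>2 + y\<^sup>2) * (1 + real k)\<^sup>2) \<le> sqrt ((x + k)\<^sup>2 * ((1 + real k)\<^sup>2 + y\<^sup>2))"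
        by (rule real_sqrt_le_mono)
      moreover have "norm (1 + complex_of_nat k) = 1 + real k"
        by (metis norm_of_nat of_nat_Suc)
      moreover have "norm (complex_of_real x + of_nat k) = x + real k"
        using x by (metis abs_of_nonneg add_nonneg_nonneg of_nat_0_le_iff of_real_add of_real_of_nat_eq norm_of_real order_trans zero_le_one)
      ultimately show "norm (Complex x y + of_nat k) * norm (1 + complex_of_nat k) \<le> norm (complex_of_real x + of_nat k) * norm (Complex 1 y + of_nat k)"
        using x by (simp add: cmod_def real_sqrt_mult)
    qed auto
    moreover have "P (Complex x y) > 0" "P 1 > 0" "P (of_real x) > 0" "P (Complex 1 y) > 0"
      using x by (auto intro!: pos)
    ultimately have "1 / (P (of_real x) * P (Complex 1 y)) \<le> 1 / (P (Complex x y) * P 1)"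
      by (intro divide_left_mono mult_pos_pos) auto
    then have "(fact n * real n powr x) * (fact n * real n powr 1) * (1 / (P (of_real x) * P (Complex 1 y))) \<le> (fact n * real n powr x) * (fact n * real n powr 1) * (1 / (P (Complex x y) * P 1))"
      by (rule mult_left_mono) auto
    then show ?thesis
      by (simp add: norm_Gamma_series[OF n] P_def)
  qed
  then have ev: "eventually (\<lambda>n. norm (Gamma_series (complex_of_real x) n) * norm (Gamma_series (Complex 1 y) n) \<le> norm (Gamma_series (Complex x y) n) * norm (Gamma_series (1::complex) n)) sequentially"
    by (intro eventually_mono[OF eventually_gt_at_top[of 0]])
  have "norm (Gamma (complex_of_real x)) * norm (Gamma (Complex 1 y)) \<le> norm (Gamma (Complex x y)) * norm (Gamma (1::complex))"
    by (rule tendsto_le[OF trivial_limit_sequentially _ _ ev]; intro tendsto_intros)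
  moreover have "Gamma x > 0" using x by (intro Gamma_real_pos) auto
  ultimately show ?thesis by (simp add: Gamma_complex_of_real)
qed

text \<open>By the reflection formula the square equals pi y / sinh(pi y). With u = exp(-2 pi y)
  this is 2 pi y exp(-pi y) / (1 - u), and both bounds follow from 1 - u \<le> min(1, 2 pi
  y).\<close>

lemma norm_Gamma_1_ge:
  assumes y: "y \<ge> 0"
  shows "exp (- pi * y) \<le> (norm (Gamma (Complex 1 y)))\<^sup>2" "2 * pi * y * exp (- pi * y) \<le> (norm (Gamma (Complex 1 y)))\<^sup>2"
proof -
  have "exp (- pi * y) \<le> (norm (Gamma (Complex 1 y)))\<^sup>2 \<and> 2 * pi * y * exp (- pi * y) \<le> (norm (Gamma (Complex 1 y)))\<^sup>2"
  proof (cases "y = 0")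
    case True
    moreover have "Complex 1 0 = 1" by (simp add: complex_eq_iff)
    ultimately show ?thesis by simp
  next
    case False
    then have y: "y > 0" using y by simp
    define z where "z = \<i> * of_real y"
    define u where "u = exp (- (2 * pi * y))"
    have u: "0 < u" "u < 1" "1 - u \<le> 2 * pi * y"
      using y exp_ge_add_one_self[of "- (2 * pi * y)"] by (auto simp: u_def)
    have c: "Complex 1 y = 1 + z" "1 - z = cnj (1 + z)" by (auto simp: z_def complex_eq_iff)
    have z: "z \<notin> \<int>\<^sub>\<le>\<^sub>0" using y by (auto simp: z_def complex_eq_iff elim!: nonpos_Ints_cases)
    have "(norm (Gamma (Complex 1 y)))\<^sup>2 = norm (Gamma (1 + z) * Gamma (1 - z))"
    proof -
      have "norm (Gamma (1 - z)) = norm (Gamma (1 + z))" by (simp only: c(2) cnj_Gamma[symmetric] complex_mod_cnj)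
      then show ?thesis by (simp add: c(1) norm_mult power2_eq_square)
    qed
    also have "Gamma (1 + z) = z * Gamma z" using Gamma_plus1[OF z] by (simp add: add.commute)
    also have "z * Gamma z * Gamma (1 - z) = z * (of_real pi / sin (of_real pi * z))"
      by (simp add: mult.assoc Gamma_reflection_complex)
    also have "norm \<dots> = y * pi / norm (sin (of_real pi * z))"
      using y by (simp add: norm_mult norm_divide z_def)
    also have "norm (sin (of_real pi * z)) = exp (pi * y) * (1 - u) / 2"
    proof -
      have "sin (of_real pi * z) = - \<i> / 2 * (of_real (exp (- (pi * y))) - of_real (exp (pi * y)))"
        by (simp add: sin_exp_eq z_def exp_of_real[symmetric] field_simps)
      also have "norm \<dots> = \<bar>exp (- (pi * y)) - exp (pi * y)\<bar> / 2"
        unfolding norm_mult by (simp add: norm_divide flip: of_real_diff)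
      also have "exp (- (pi * y)) = exp (pi * y) * u" by (simp add: u_def exp_add[symmetric])
      also have "\<bar>exp (pi * y) * u - exp (pi * y)\<bar> = exp (pi * y) * (1 - u)"
        using u by (simp add: abs_if algebra_simps)
      finally show ?thesis .
    qed
    also have "y * pi / (exp (pi * y) * (1 - u) / 2) = (2 * pi * y / (1 - u)) * exp (- pi * y)"
      by (simp add: exp_minus field_simps)
    finally have eq: "(norm (Gamma (Complex 1 y)))\<^sup>2 = (2 * pi * y / (1 - u)) * exp (- pi * y)" .
    have "1 \<le> 2 * pi * y / (1 - u)" "2 * pi * y \<le> 2 * pi * y / (1 - u)"
      using u y by (auto simp: field_simps)
    from this[THEN mult_right_mono, of "exp (- pi * y)"] show ?thesis unfolding eq by simp
  qed
  then show "exp (- pi * y) \<le> (norm (Gamma (Complex 1 y)))\<^sup>2" "2 * pi * y * exp (- pi * y) \<le> (norm (Gamma (Complex 1 y)))\<^sup>2"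
    by auto
qed

text \<open>The first bound stays useful down to y = 0 and serves in the quadrant. The second gains
  y^(1/2) for large y, which is what makes zeta grow in vertical strips.\<close>

lemma norm_Gamma_lower:
  assumes x: "x \<ge> 1" and y: "y \<ge> 0"
  shows "Gamma x * exp (- pi * y / 2) \<le> norm (Gamma (Complex x y))"
    "Gamma x * (sqrt (2 * pi * y) * exp (- pi * y / 2)) \<le> norm (Gamma (Complex x y))"
proof -
  have G: "Gamma x > 0" using x by (intro Gamma_real_pos) auto
  have e: "sqrt (exp (- pi * y)) = exp (- pi * y / 2)"
    by (intro real_sqrt_unique) (simp_all add: power2_eq_square flip: exp_add)
  have "sqrt (exp (- pi * y)) \<le> norm (Gamma (Complex 1 y))"
    using norm_Gamma_1_ge(1)[OF y] by (rule real_le_lsqrt[OF norm_ge_zero])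
  then have "Gamma x * exp (- pi * y / 2) \<le> Gamma x * norm (Gamma (Complex 1 y))"
    unfolding e using G by (intro mult_left_mono) auto
  then show "Gamma x * exp (- pi * y / 2) \<le> norm (Gamma (Complex x y))"
    using norm_Gamma_ge[OF x, of y] by linarith
  have "sqrt (2 * pi * y * exp (- pi * y)) \<le> norm (Gamma (Complex 1 y))"
    using norm_Gamma_1_ge(2)[OF y] by (rule real_le_lsqrt[OF norm_ge_zero])
  then have "Gamma x * (sqrt (2 * pi * y) * exp (- pi * y / 2)) \<le> Gamma x * norm (Gamma (Complex 1 y))"
    unfolding real_sqrt_mult e using G by (intro mult_left_mono) auto
  then show "Gamma x * (sqrt (2 * pi * y) * exp (- pi * y / 2)) \<le> norm (Gamma (Complex x y))"
    using norm_Gamma_ge[OF x, of y] by linarith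
qed

section \<open>The tail of E beyond the bases below K\<close>

lemma of_nat_powr_neg_even:
  "(of_nat (Suc k) :: complex) powr (- (2 * of_nat (Suc n))) = of_real (exp (- (2 * ln (real (Suc k))) * real (Suc n)))"
proof -
  have "(of_nat (Suc k) :: complex) powr (- (2 * of_nat (Suc n))) = of_real (real (Suc k)) powr of_real (- (2 * real (Suc n)))"
    by simp
  also have "\<dots> = of_real (real (Suc k) powr (- (2 * real (Suc n))))" by (rule powr_of_real) simp
  also have "real (Suc k) powr (- (2 * real (Suc n))) = exp (- (2 * ln (real (Suc k))) * real (Suc n))"
    by (simp add: powr_def algebra_simps)
  finally show ?thesis .
qed

lemma zeta_even_tail:
  assumes K: "K \<ge> 1"
  shows "\<exists>C\<ge>0. \<forall>n. norm (zeta (2 * of_nat (Suc n)) - (\<Sum>k\<in>{1..<K}. of_real (exp (- (2 * ln (real k)) * real (Suc n)))))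
     \<le> C * exp (- (2 * ln (real K)) * real (Suc n))"
proof -
  \<comment> \<open>One factor (k+K)^(-2) is kept for the summation over k and the other n are
    bounded by K^(-2). Restoring the missing K^(-2) to reach exponent n + 1 explains the
    K^2.\<close>
  define C where "C = (\<Sum>k. real K ^ 2 * real (k + K) powr (-2))"
  have "summable (\<lambda>k. real k powr (-2))" by (simp add: summable_real_powr_iff)
  then have sC: "summable (\<lambda>k. real K ^ 2 * real (k + K) powr (-2))"
    by (intro summable_mult) (subst summable_iff_shift[of "\<lambda>k. real k powr (-2)"])
  have "norm (zeta (2 * of_nat (Suc n)) - (\<Sum>k\<in>{1..<K}. of_real (exp (- (2 * ln (real k)) * real (Suc n)))))
     \<le> C * exp (- (2 * ln (real K)) * real (Suc n))" for n
  proof -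
    let ?f = "\<lambda>k::nat. complex_of_real (exp (- (2 * ln (real (Suc k))) * real (Suc n)))"
    let ?e = "exp (- (2 * ln (real K)) * real (Suc n))"
    have s: "?f sums zeta (2 * of_nat (Suc n))"
      using zeta_properties(2)[of "2 * of_nat (Suc n)"] by (simp only: of_nat_powr_neg_even) simp
    have "(\<lambda>k. ?f (k + (K - 1))) sums (zeta (2 * of_nat (Suc n)) - (\<Sum>k<K-1. ?f k))"
      using s by (subst sums_iff_shift) simp
    moreover have "(\<Sum>k<K-1. ?f k) = (\<Sum>k\<in>{1..<K}. of_real (exp (- (2 * ln (real k)) * real (Suc n))))"
      by (rule sum.reindex_bij_witness[of _ "\<lambda>k. k - 1" Suc]) auto
    ultimately have s2: "(\<lambda>k. ?f (k + (K - 1))) sums (zeta (2 * of_nat (Suc n)) - (\<Sum>k\<in>{1..<K}. of_real (exp (- (2 * ln (real k)) * real (Suc n)))))"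
      by simp
    have b: "norm (?f (k + (K - 1))) \<le> (real K ^ 2 * real (k + K) powr (-2)) * ?e" for k
    proof -
      have "Suc (k + (K - 1)) = k + K" using K by simp
      then have "norm (?f (k + (K - 1))) = exp (- (2 * ln (real (k + K))) * real (Suc n))" by (simp del: of_nat_Suc of_nat_add)
      also have "- (2 * ln (real (k + K))) * real (Suc n) = - 2 * ln (real (k + K)) + - (2 * ln (real (k + K))) * real n"
        by (simp add: algebra_simps)
      also have "exp \<dots> \<le> exp (- 2 * ln (real (k + K)) + - (2 * ln (real K)) * real n)"
        using K by (intro exp_mono add_left_mono mult_right_mono) auto
      also have "- 2 * ln (real (k + K)) + - (2 * ln (real K)) * real n = 2 * ln (real K) + - 2 * ln (real (k + K)) + - (2 * ln (real K)) * real (Suc n)"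
        by (simp add: algebra_simps)
      also have "exp \<dots> = real K powr 2 * real (k + K) powr (-2) * ?e"
        using K by (simp only: exp_add powr_def) simp
      finally show ?thesis using K by simp
    qed
    have "norm (\<Sum>k. ?f (k + (K - 1))) \<le> (\<Sum>k. (real K ^ 2 * real (k + K) powr (-2)) * ?e)"
      by (rule norm_suminf_le[OF b summable_mult2[OF sC]])
    also have "\<dots> = C * ?e" unfolding C_def by (rule suminf_mult2[OF sC, symmetric])
    finally show ?thesis using sums_unique[OF s2] by simp
  qed
  moreover have "C \<ge> 0" unfolding C_def by (intro suminf_nonneg sC) auto
  ultimately show ?thesis by blast
qed

lemma has_sum_finite_sum:
  fixes f :: "'i \<Rightarrow> 'a \<Rightarrow> 'b :: topological_comm_monoid_add"
  assumes "finite A" "\<And>i. i \<in> A \<Longrightarrow> (f i has_sum S i) B"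
  shows "((\<lambda>x. \<Sum>i\<in>A. f i x) has_sum (\<Sum>i\<in>A. S i)) B"
  using assms by (induction A rule: finite_induct) (auto intro!: has_sum_add)

text \<open>The finite sum over k < K is exchanged with the series in n. The terms with k = 1 are
  all 1 and cancel the subtracted 1, hence the polylogarithms start at k = 2.\<close>

lemma E_fun_tail:
  assumes K: "K \<ge> 2"
  shows "\<exists>C\<ge>0. \<forall>s. norm (E_fun s - (\<Sum>k\<in>{2..<K}. polylog s (2 * ln (real k)))) \<le> 
     C * (\<Sum>\<^sub>\<infinity>n. real (Suc n) powr (- Re s) * exp (- (2 * ln (real K)) * real (Suc n)))"
proof -
  obtain C where C: "C \<ge> 0" "\<And>n. norm (zeta (2 * of_nat (Suc n)) - (\<Sum>k\<in>{1..<K}. of_real (exp (- (2 * ln (real k)) * real (Suc n)))))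
     \<le> C * exp (- (2 * ln (real K)) * real (Suc n))"
    using zeta_even_tail[of K] K by auto
  have "norm (E_fun s - (\<Sum>k\<in>{2..<K}. polylog s (2 * ln (real k)))) \<le> 
     C * (\<Sum>\<^sub>\<infinity>n. real (Suc n) powr (- Re s) * exp (- (2 * ln (real K)) * real (Suc n)))" for s
  proof -
    define t where "t = (\<lambda>n. (zeta (2 * of_nat (Suc n)) - (\<Sum>k\<in>{1..<K}. of_real (exp (- (2 * ln (real k)) * real (Suc n))))) * of_nat (Suc n) powr (-s))"
    let ?M = "\<lambda>n. C * (real (Suc n) powr (- Re s) * exp (- (2 * ln (real K)) * real (Suc n)))"
    have M: "?M summable_on UNIV" using K by (intro summable_on_cmult_right summable_powr_exp) simp
    have tM: "norm (t n) \<le> ?M n" for n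
    proof -
      have "norm (t n) \<le> C * exp (- (2 * ln (real K)) * real (Suc n)) * real (Suc n) powr (- Re s)"
        unfolding t_def norm_mult norm_Suc_powr using C(2)[of n] by (simp add: mult_right_mono)
      then show ?thesis by (simp add: mult_ac)
    qed
    have t: "(t has_sum infsum t UNIV) UNIV" using infsum_norm_le(1)[OF tM M] by (rule has_sum_infsum)
    have "((\<lambda>n. (\<Sum>k\<in>{2..<K}. of_nat (Suc n) powr (-s) * of_real (exp (- (2 * ln (real k)) * real (Suc n)))) + t n) has_sum
      ((\<Sum>k\<in>{2..<K}. polylog s (2 * ln (real k))) + infsum t UNIV)) UNIV"
      by (intro has_sum_add t has_sum_finite_sum polylog_has_sum) auto
    moreover have "(\<Sum>k\<in>{2..<K}. of_nat (Suc n) powr (-s) * complex_of_real (exp (- (2 * ln (real k)) * real (Suc n)))) + t n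
      = (zeta (2 * of_nat (Suc n)) - 1) * of_nat (Suc n) powr (-s)" for n
    proof -
      have "(\<Sum>k\<in>{1..<K}. complex_of_real (exp (- (2 * ln (real k)) * real (Suc n)))) = 1 + (\<Sum>k\<in>{2..<K}. of_real (exp (- (2 * ln (real k)) * real (Suc n))))"
        using K by (subst sum.atLeast_Suc_lessThan) (auto simp: numeral_2_eq_2)
      then show ?thesis unfolding t_def by (simp add: sum_distrib_left[symmetric] algebra_simps)
    qed
    ultimately have "((\<lambda>n. (zeta (2 * of_nat (Suc n)) - 1) * of_nat (Suc n) powr (-s)) has_sum
      ((\<Sum>k\<in>{2..<K}. polylog s (2 * ln (real k))) + infsum t UNIV)) UNIV" by simp
    then have "E_fun s = (\<Sum>k\<in>{2..<K}. polylog s (2 * ln (real k))) + infsum t UNIV"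
      unfolding E_fun_def by (intro sums_unique[symmetric] has_sum_imp_sums)
    then have "norm (E_fun s - (\<Sum>k\<in>{2..<K}. polylog s (2 * ln (real k)))) = norm (infsum t UNIV)" by simp
    also have "\<dots> \<le> infsum ?M UNIV" by (rule infsum_norm_le(2)[OF tM M])
    also have "\<dots> = C * (\<Sum>\<^sub>\<infinity>n. real (Suc n) powr (- Re s) * exp (- (2 * ln (real K)) * real (Suc n)))"
      by (rule infsum_cmult_right')
    finally show ?thesis .
  qed
  then show ?thesis using C(1) by blast
qed

text \<open>At a real argument the Lipschitz formula evaluates the sum as Gamma(1-\<sigma>) times a
  lattice sum whose points all have modulus at least \<open>x\<close>. Holding back two powers of
  the modulus leaves a convergent sum independent of \<sigma>.\<close>

lemma powr_sum_bound:
  assumes x: "x > 0"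
  shows "\<exists>C\<ge>0. \<forall>\<sigma>\<le>-1. (\<Sum>\<^sub>\<infinity>n. real (Suc n) powr (- \<sigma>) * exp (- x * real (Suc n))) \<le> C * Gamma (1 - \<sigma>) * x powr (\<sigma> - 1)"
proof -
  define C where "C = (\<Sum>\<^sub>\<infinity>j. x ^ 2 * norm (of_real x + two_pi_i j) powr (-2))"
  obtain c where c: "c > 0" "\<And>\<mu> j. Re \<mu> \<ge> x \<Longrightarrow> \<bar>Im \<mu>\<bar> \<le> 0 \<Longrightarrow> norm (\<mu> + two_pi_i j) \<ge> c * (1 + \<bar>of_int j\<bar>)"
    by (rule lattice_lower_bound[of x 0]) (use x in auto)
  have sC: "(\<lambda>j. x ^ 2 * norm (of_real x + two_pi_i j) powr (-2)) summable_on UNIV"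
  proof (intro summable_on_cmult_right)
    have "(\<lambda>j. c powr (-2) * (1 + \<bar>of_int j\<bar>) powr (-2) :: real) summable_on UNIV"
      by (rule summable_on_int_powr) simp
    then show "(\<lambda>j. norm (of_real x + two_pi_i j) powr (-2)) summable_on UNIV"
    proof (rule summable_on_comparison_test)
      fix j :: int
      have "norm (of_real x + two_pi_i j) powr (-2) \<le> (c * (1 + \<bar>of_int j\<bar>)) powr (-2)"
        using c(2)[of "of_real x" j] c(1) by (intro powr_mono2') auto
      also have "\<dots> = c powr (-2) * (1 + \<bar>of_int j\<bar>) powr (-2)"
        using c(1) by (simp add: powr_mult)
      finally show "norm (of_real x + two_pi_i j) powr (-2) \<le> c powr (-2) * (1 + \<bar>of_int j\<bar>) powr (-2)" .
    qed simp
  qed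
  have "(\<Sum>\<^sub>\<infinity>n. real (Suc n) powr (- \<sigma>) * exp (- x * real (Suc n))) \<le> C * Gamma (1 - \<sigma>) * x powr (\<sigma> - 1)" if s: "\<sigma> \<le> -1" for \<sigma>
  proof -
    have "polylog (of_real \<sigma>) x = of_real (\<Sum>\<^sub>\<infinity>n. real (Suc n) powr (- \<sigma>) * exp (- x * real (Suc n)))"
    proof -
      have "of_nat (Suc n) powr (- of_real \<sigma>) * complex_of_real (exp (- x * real (Suc n))) = of_real (real (Suc n) powr (- \<sigma>) * exp (- x * real (Suc n)))" for n
        using powr_of_real[of "real (Suc n)" "-\<sigma>"] by simp
      moreover have "((\<lambda>n. real (Suc n) powr (- \<sigma>) * exp (- x * real (Suc n))) has_sum (\<Sum>\<^sub>\<infinity>n. real (Suc n) powr (- \<sigma>) * exp (- x * real (Suc n)))) UNIV"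
        by (intro has_sum_infsum summable_powr_exp x)
      ultimately show ?thesis unfolding polylog_def by (intro infsumI) (simp only: has_sum_of_real)
    qed
    moreover have "(\<Sum>\<^sub>\<infinity>n. real (Suc n) powr (- \<sigma>) * exp (- x * real (Suc n))) \<ge> 0"
      by (intro infsum_nonneg) auto
    ultimately have "(\<Sum>\<^sub>\<infinity>n. real (Suc n) powr (- \<sigma>) * exp (- x * real (Suc n))) = norm (polylog (of_real \<sigma>) x)"
      by simp
    also have "\<dots> = Gamma (1 - \<sigma>) * norm (lattice_sum (1 - of_real \<sigma>) (of_real x))"
    proof -
      have "Gamma (1 - \<sigma>) > 0" using s by (intro Gamma_real_pos) auto
      then show ?thesis using polylog_lat[OF x, of "of_real \<sigma>"] s Gamma_complex_of_real[of "1 - \<sigma>"] by (simp add: norm_mult)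
    qed
    also have "norm (lattice_sum (1 - of_real \<sigma>) (of_real x)) \<le> (\<Sum>\<^sub>\<infinity>j. x powr (\<sigma> - 1) * (x ^ 2 * norm (of_real x + two_pi_i j) powr (-2)))"
      unfolding lattice_sum_def
    proof (rule infsum_norm_le(2))
      show "(\<lambda>j. x powr (\<sigma> - 1) * (x ^ 2 * norm (of_real x + two_pi_i j) powr (-2))) summable_on UNIV"
        by (intro summable_on_cmult_right sC)
      fix j
      have xn: "x \<le> norm (of_real x + two_pi_i j)" using complex_Re_le_cmod[of "of_real x + two_pi_i j"] by simp
      have "norm ((of_real x + two_pi_i j) powr (- (1 - of_real \<sigma>))) = norm (of_real x + two_pi_i j) powr (\<sigma> - 1)"
        using norm_powr_real_powr'[of "of_real (\<sigma> - 1)" "of_real x + two_pi_i j"] by simp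
      also have "\<dots> = norm (of_real x + two_pi_i j) powr (-2) * norm (of_real x + two_pi_i j) powr (\<sigma> + 1)"
        by (simp flip: powr_add)
      also have "\<dots> \<le> norm (of_real x + two_pi_i j) powr (-2) * x powr (\<sigma> + 1)"
        using xn x s by (intro mult_left_mono powr_mono2') auto
      also have "x powr (\<sigma> + 1) = x powr (\<sigma> - 1) * x powr 2" by (simp add: add.commute flip: powr_add)
      finally show "norm ((of_real x + two_pi_i j) powr (- (1 - of_real \<sigma>))) \<le> x powr (\<sigma> - 1) * (x ^ 2 * norm (of_real x + two_pi_i j) powr (-2))"
        using x by (simp add: mult_ac)
    qed
    also have "\<dots> = x powr (\<sigma> - 1) * C" unfolding C_def by (rule infsum_cmult_right')
    finally show ?thesis
      using s Gamma_real_pos[of "1 - \<sigma>"] by (simp add: mult_ac mult_left_mono)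
  qed
  moreover have "C \<ge> 0" unfolding C_def by (intro infsum_nonneg) auto
  ultimately show ?thesis by blast
qed

lemma E_fun_tail_Gamma:
  assumes K: "K \<ge> 2"
  shows "\<exists>C\<ge>0. \<forall>s. Re s \<le> -1 \<longrightarrow> norm (E_fun s - (\<Sum>k\<in>{2..<K}. polylog s (2 * ln (real k)))) \<le> 
     C * Gamma (1 - Re s) * (2 * ln (real K)) powr (Re s - 1)"
proof -
  obtain C where C: "C \<ge> 0" "\<And>s. norm (E_fun s - (\<Sum>k\<in>{2..<K}. polylog s (2 * ln (real k)))) \<le> 
     C * (\<Sum>\<^sub>\<infinity>n. real (Suc n) powr (- Re s) * exp (- (2 * ln (real K)) * real (Suc n)))"
    using E_fun_tail[OF K] by blast
  have K0: "2 * ln (real K) > 0" using K by simp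
  obtain C' where C': "C' \<ge> 0" "\<And>\<sigma>. \<sigma> \<le> -1 \<Longrightarrow> (\<Sum>\<^sub>\<infinity>n. real (Suc n) powr (- \<sigma>) * exp (- (2 * ln (real K)) * real (Suc n))) \<le> C' * Gamma (1 - \<sigma>) * (2 * ln (real K)) powr (\<sigma> - 1)"
    using powr_sum_bound[OF K0] by blast
  have "norm (E_fun s - (\<Sum>k\<in>{2..<K}. polylog s (2 * ln (real k)))) \<le> 
     (C * C') * Gamma (1 - Re s) * (2 * ln (real K)) powr (Re s - 1)" if "Re s \<le> -1" for s
    using order_trans[OF C(2)[of s] mult_left_mono[OF C'(2)[OF that] C(1)]] by (simp add: mult_ac)
  then show ?thesis using C(1) C'(1) by (intro exI[of _ "C * C'"]) auto
qed

section \<open>Asymptotics of D in the lower left quadrant\<close>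

text \<open>The poles in u of the sum over k of exp(u) / (k^2 - exp(u)), which continues the
  generating series of \<zeta>(2n) exp(n u).\<close>

definition pole_at :: "nat \<Rightarrow> int \<Rightarrow> complex" where
  "pole_at k j = of_real (2 * ln (real k)) + two_pi_i j"

text \<open>Leaves out the two dominant points \<open>2\<pi>i\<close> (for \<open>k = 1\<close>) and \<open>2 log 2\<close> (for \<open>k = 2\<close>), and \<open>j = 0\<close> for \<open>k = 1\<close>, where \<open>pole_at 1 0 = 0\<close>.\<close>

definition minor_set :: "nat \<Rightarrow> int set" where
  "minor_set k = (if k = 1 then -{0, 1} else if k = 2 then -{0} else UNIV)"

lemma pole_at_simps: "Re (pole_at k j) = 2 * ln (real k)" "Im (pole_at k j) = 2 * pi * of_int j"
  by (simp_all add: pole_at_def)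

lemma Re_pole_nonneg: "k \<ge> 1 \<Longrightarrow> 0 \<le> Re (pole_at k j)"
  by (simp add: pole_at_simps)

lemma Arg_le_pi_half:
  assumes "z \<noteq> 0" "Re z \<ge> 0"
  shows "Arg z \<le> pi / 2" "Im z \<le> 0 \<Longrightarrow> Arg z \<le> 0"
proof -
  show "Arg z \<le> pi / 2" using assms by (metis Arg_eq_Im_Ln Re_Ln_pos_le abs_le_iff)
  show "Arg z \<le> 0" if "Im z \<le> 0"
  proof (cases "Im z = 0")
    case True
    then show ?thesis using assms by (metis Arg_eq_0 complex_is_Real_iff order_refl)
  next
    case False
    then show ?thesis using that Arg_neg_iff[of z] by simp
  qed
qed

text \<open>Each entry compares a main point with its nearest competitors: 2 log 2 with 2 log 3 and
  with the points of negative \<open>j\<close>, of modulus at least 2 pi; then 2 pi i with 4 pi i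
  and with 2 log 2 + 2 pi i.\<close>

lemma decay_rate_exists:
  "\<exists>q::real. 0 < q \<and> q < 1 \<and> ln 2 / ln 3 \<le> q \<and> ln 2 / pi \<le> q \<and> 1 / 2 \<le> q \<and>
    2 * pi / sqrt ((2 * ln 2)\<^sup>2 + (2 * pi)\<^sup>2) \<le> q"
proof -
  define q :: real where "q = Max {ln 2 / ln 3, ln 2 / pi, 1 / 2, 2 * pi / sqrt ((2 * ln 2)\<^sup>2 + (2 * pi)\<^sup>2)}"
  have "ln 2 < (1::real)" using ln_2_less_1 .
  then have 1: "ln 2 / pi < 1" using pi_gt3 by (simp add: field_simps)
  have 2: "ln 2 / ln 3 < (1::real)" by simp
  have "sqrt ((2 * pi)\<^sup>2) < sqrt ((2 * ln 2)\<^sup>2 + (2 * pi)\<^sup>2)" by (intro real_sqrt_less_mono) simp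
  moreover have "sqrt ((2 * pi)\<^sup>2) = 2 * pi" by (rule real_sqrt_unique) auto
  ultimately have "2 * pi < sqrt ((2 * ln 2)\<^sup>2 + (2 * pi)\<^sup>2)" by (simp only:)
  moreover from this have "0 < sqrt ((2 * ln 2)\<^sup>2 + (2 * pi)\<^sup>2)" using pi_gt_zero by linarith
  ultimately have 3: "2 * pi / sqrt ((2 * ln 2)\<^sup>2 + (2 * pi)\<^sup>2) < 1" by (simp only: divide_less_eq_1_pos)
  have "q < 1" unfolding q_def using 1 2 3 by (subst Max_less_iff) auto
  moreover have "ln 2 / ln 3 \<le> q \<and> ln 2 / pi \<le> q \<and> 1 / 2 \<le> q \<and> 2 * pi / sqrt ((2 * ln 2)\<^sup>2 + (2 * pi)\<^sup>2) \<le> q"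
    unfolding q_def by (intro conjI Max_ge) auto
  moreover from this have "0 < q" by linarith
  ultimately show ?thesis by blast
qed

text \<open>The larger of the moduli of the two main terms (2 log 2)^(s-1) and (2 pi i)^(s-1), as
  \<open>dominant_eq\<close> confirms.\<close>

definition dominant :: "complex \<Rightarrow> real" where
  "dominant s = max ((2 * ln 2) powr (Re s - 1)) ((2 * pi) powr (Re s - 1) * exp (- Im s * pi / 2))"

text \<open>Of the \<open>x\<close> powers of \<open>n\<close>, two are held back so that a later
  sum over the lattice converges; the other x - 2 produce the geometric factor.\<close>

lemma powr_ratio_bound:
  fixes l q n x :: real
  assumes "l > 0" "0 < q" "q < 1" "l / q \<le> n" "x \<ge> 2"
  shows "n powr (- x) \<le> q powr (x - 2) * (l ^ 2 * n powr (-2)) * l powr (- x)"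
proof -
  have lq: "0 < l / q" using assms by simp
  have "n powr (-x) = n powr (-2) * n powr (- (x - 2))" by (simp flip: powr_add)
  also have "\<dots> \<le> n powr (-2) * (l / q) powr (- (x - 2))"
    using assms lq by (intro mult_left_mono powr_mono2') auto
  also have "(l / q) powr (- (x - 2)) = q powr (x - 2) * l powr (- (x - 2))"
  proof -
    have "(l / q) powr (- y) = q powr y * l powr (- y)" for y
      using assms by (simp add: powr_divide powr_minus field_simps)
    then show ?thesis .
  qed
  also have "l powr (- (x - 2)) = l ^ 2 * l powr (- x)"
    using assms by (simp add: powr_diff powr_minus field_simps)
  finally show ?thesis by (simp add: mult_ac)
qed

text \<open>The sign of \<open>j\<close> decides the comparison. For j \<le> 0 the argument is at
  most 0, so Im s \<le> 0 yields no growth and 2 log 2 is the reference. For j \<ge> 1 the argument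
  is at most pi/2, so the growth is at most that of 2 pi i.\<close>

lemma minor_set_term_bound:
  assumes q: "0 < q" "q < 1" "ln 2 / ln 3 \<le> q" "ln 2 / pi \<le> q" "1 / 2 \<le> q" "2 * pi / sqrt ((2 * ln 2)\<^sup>2 + (2 * pi)\<^sup>2) \<le> q"
    and k: "k \<ge> 1" and j: "j \<in> minor_set k" and s: "Re s \<le> -1" "Im s \<le> 0"
  shows "norm (pole_at k j powr (s - 1)) \<le> q powr (- 1 - Re s) * ((2 * pi) ^ 2 * norm (pole_at k j) powr (-2)) * dominant s"
proof -
  let ?w = "pole_at k j" and ?x = "1 - Re s"
  have lnk: "ln 2 \<le> ln (real k)" if "k \<ge> 2" using that by simp
  have lnk3: "ln 3 \<le> ln (real k)" if "k \<ge> 3" using that by simp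
  have nIm: "2 * pi * \<bar>of_int j\<bar> \<le> norm ?w" using abs_Im_le_cmod[of ?w] by (simp add: pole_at_simps abs_mult)
  have nRe: "2 * ln (real k) \<le> norm ?w" using complex_Re_le_cmod[of ?w] by (simp add: pole_at_simps)
  have l2: "ln 2 < (1::real)" by (rule ln_2_less_1)
  have x: "?x \<ge> 2" using s by simp
  have norm: "norm (?w powr (s - 1)) = norm ?w powr (- ?x) * exp (- Im s * Arg ?w)"
    by (simp add: norm_powr_complex)
  have "norm (?w powr (s - 1)) \<le> q powr (?x - 2) * ((2 * pi) ^ 2 * norm ?w powr (-2)) * dominant s"
  proof (cases "j \<le> 0")
    case True
    have big: "2 * ln 2 / q \<le> norm ?w"
    proof (cases "j = 0")
      case True
      then have "k \<ge> 3" using j k by (auto simp: minor_set_def split: if_splits)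
      have "2 * ln 2 / q \<le> 2 * ln 3" using q by (simp add: field_simps)
      then show ?thesis using lnk3[OF \<open>k \<ge> 3\<close>] nRe by linarith
    next
      case False
      have "2 * ln 2 / q \<le> 2 * pi" using q by (simp add: field_simps)
      also have "\<dots> \<le> 2 * pi * \<bar>of_int j\<bar>" using False by simp
      finally show ?thesis using nIm by linarith
    qed
    then have "norm ?w > 0" using q by (smt (verit) divide_pos_pos ln_gt_zero)
    then have "Arg ?w \<le> 0" using Arg_le_pi_half(2)[of ?w] Re_pole_nonneg[OF k] True by (simp add: pole_at_simps mult_nonneg_nonpos)
    then have "exp (- Im s * Arg ?w) \<le> 1" using s by (simp add: mult_nonpos_nonpos)
    then have "norm (?w powr (s - 1)) \<le> norm ?w powr (- ?x) * 1" unfolding norm by (intro mult_left_mono) auto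
    also have "\<dots> \<le> q powr (?x - 2) * ((2 * ln 2) ^ 2 * norm ?w powr (-2)) * (2 * ln 2) powr (- ?x)"
      using powr_ratio_bound[OF _ q(1,2) big x] by simp
    also have "\<dots> \<le> q powr (?x - 2) * ((2 * pi) ^ 2 * norm ?w powr (-2)) * dominant s"
      using l2 pi_gt3 by (intro mult_mono power_mono) (auto simp: dominant_def)
    finally show ?thesis .
  next
    case False
    then have j1: "j \<ge> 1" by simp
    have big: "2 * pi / q \<le> norm ?w"
    proof (cases "k = 1")
      case True
      then have "j \<ge> 2" using j j1 by (auto simp: minor_set_def)
      have "2 * pi / q \<le> 2 * pi * 2" using q by (simp add: field_simps)
      also have "\<dots> \<le> 2 * pi * \<bar>of_int j\<bar>" using \<open>j \<ge> 2\<close> by simp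
      finally show ?thesis using nIm by linarith
    next
      case False
      then have "k \<ge> 2" using k by simp
      have "2 * pi \<le> q * sqrt ((2 * ln 2)\<^sup>2 + (2 * pi)\<^sup>2)"
      proof -
        have "sqrt ((2 * ln 2)\<^sup>2 + (2 * pi)\<^sup>2) > 0" by (intro real_sqrt_gt_zero add_nonneg_pos) auto
        then show ?thesis using q(6) by (simp add: field_simps)
      qed
      then have "2 * pi / q \<le> sqrt ((2 * ln 2)\<^sup>2 + (2 * pi)\<^sup>2)" using q by (simp add: field_simps)
      also have "\<dots> \<le> norm ?w"
        unfolding cmod_def pole_at_simps
      proof (intro real_sqrt_le_mono add_mono power_mono)
        show "2 * pi \<le> 2 * pi * real_of_int j" using j1 by simp
      qed (use lnk[OF \<open>k \<ge> 2\<close>] in auto)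
      finally show ?thesis .
    qed
    have "norm ?w > 0" using big q by (smt (verit) divide_pos_pos pi_gt_zero)
    then have "Arg ?w \<le> pi / 2" using Arg_le_pi_half(1)[of ?w] Re_pole_nonneg[OF k] by auto
    then have "exp (- Im s * Arg ?w) \<le> exp (- Im s * pi / 2)"
      using s mult_left_mono[of "Arg ?w" "pi / 2" "- Im s"] by simp
    then have "norm (?w powr (s - 1)) \<le> norm ?w powr (- ?x) * exp (- Im s * pi / 2)" unfolding norm by (intro mult_left_mono) auto
    also have "\<dots> \<le> (q powr (?x - 2) * ((2 * pi) ^ 2 * norm ?w powr (-2)) * (2 * pi) powr (- ?x)) * exp (- Im s * pi / 2)"
      using powr_ratio_bound[OF _ q(1,2) big x] by (intro mult_right_mono) auto
    also have "\<dots> = q powr (?x - 2) * ((2 * pi) ^ 2 * norm ?w powr (-2)) * ((2 * pi) powr (- ?x) * exp (- Im s * pi / 2))"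
      by (simp only: mult_ac)
    also have "\<dots> \<le> q powr (?x - 2) * ((2 * pi) ^ 2 * norm ?w powr (-2)) * dominant s"
      by (intro mult_left_mono) (auto simp: dominant_def)
    finally show ?thesis .
  qed
  then show ?thesis by simp
qed

lemma pole_at_summable:
  assumes "k \<ge> 1"
  shows "(\<lambda>j. norm (pole_at k j) powr (-2)) summable_on minor_set k"
proof -
  have "(\<lambda>j. norm (pole_at k j) powr (-2)) summable_on -{0}"
  proof (rule summable_on_comparison_test)
    show "(\<lambda>j. 1 * (1 + \<bar>of_int j\<bar>) powr (-2) :: real) summable_on -{0}" by (rule summable_on_int_powr) simp
    fix j :: int assume "j \<in> -{0}"
    then have "1 + \<bar>of_int j\<bar> \<le> norm (pole_at k j)" unfolding pole_at_def by (intro norm_two_pi_i_shift_ge) simp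
    then show "norm (pole_at k j) powr (-2) \<le> 1 * (1 + \<bar>of_int j\<bar>) powr (-2)"
      by (simp, intro powr_mono2') auto
  qed simp
  then have "(\<lambda>j. norm (pole_at k j) powr (-2)) summable_on insert 0 (-{0})" by (subst summable_on_insert_iff)
  moreover have "insert 0 (-{0}) = (UNIV :: int set)" by auto
  ultimately show ?thesis using summable_on_subset by (metis subset_UNIV)
qed

lemma minor_set_sum_bound:
  "\<exists>C q. C \<ge> 0 \<and> 0 < q \<and> q < 1 \<and> (\<forall>s. Re s \<le> -1 \<longrightarrow> Im s \<le> 0 \<longrightarrow>
     norm (\<Sum>k\<in>{1..<K}. \<Sum>\<^sub>\<infinity>j\<in>minor_set k. pole_at k j powr (s - 1)) \<le> C * q powr (1 - Re s) * dominant s)"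
proof -
  obtain q :: real where q: "0 < q" "q < 1" "ln 2 / ln 3 \<le> q" "ln 2 / pi \<le> q" "1 / 2 \<le> q" "2 * pi / sqrt ((2 * ln 2)\<^sup>2 + (2 * pi)\<^sup>2) \<le> q"
    using decay_rate_exists by blast
  define S where "S = (\<lambda>k. \<Sum>\<^sub>\<infinity>j\<in>minor_set k. norm (pole_at k j) powr (-2))"
  define C where "C = (2 * pi) ^ 2 * (\<Sum>k\<in>{1..<K}. S k)"
  have S0: "S k \<ge> 0" for k unfolding S_def by (intro infsum_nonneg) auto
  have "norm (\<Sum>k\<in>{1..<K}. \<Sum>\<^sub>\<infinity>j\<in>minor_set k. pole_at k j powr (s - 1)) \<le> (C * q powr (-2)) * q powr (1 - Re s) * dominant s"
    if s: "Re s \<le> -1" "Im s \<le> 0" for s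
  proof -
    have "norm (\<Sum>k\<in>{1..<K}. \<Sum>\<^sub>\<infinity>j\<in>minor_set k. pole_at k j powr (s - 1)) \<le> (\<Sum>k\<in>{1..<K}. q powr (-1 - Re s) * (2 * pi) ^ 2 * dominant s * S k)"
    proof (rule sum_norm_le)
      fix k assume "k \<in> {1..<K}"
      then have k: "k \<ge> 1" by simp
      have "norm (\<Sum>\<^sub>\<infinity>j\<in>minor_set k. pole_at k j powr (s - 1)) \<le> (\<Sum>\<^sub>\<infinity>j\<in>minor_set k. (q powr (-1 - Re s) * (2 * pi) ^ 2 * dominant s) * norm (pole_at k j) powr (-2))"
      proof (rule infsum_norm_le(2))
        show "(\<lambda>j. (q powr (-1 - Re s) * (2 * pi) ^ 2 * dominant s) * norm (pole_at k j) powr (-2)) summable_on minor_set k"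
          by (intro summable_on_cmult_right pole_at_summable k)
        show "norm (pole_at k j powr (s - 1)) \<le> (q powr (-1 - Re s) * (2 * pi) ^ 2 * dominant s) * norm (pole_at k j) powr (-2)" if "j \<in> minor_set k" for j
          using minor_set_term_bound[OF q k that s] by (simp add: mult_ac)
      qed
      then show "norm (\<Sum>\<^sub>\<infinity>j\<in>minor_set k. pole_at k j powr (s - 1)) \<le> q powr (-1 - Re s) * (2 * pi) ^ 2 * dominant s * S k"
        by (simp add: S_def infsum_cmult_right')
    qed
    also have "\<dots> = C * q powr (-1 - Re s) * dominant s"
      unfolding C_def sum_distrib_left[symmetric] by (simp add: mult_ac)
    also have "q powr (-1 - Re s) = q powr (-2) * q powr (1 - Re s)" by (simp flip: powr_add)
    finally show ?thesis by (simp add: mult_ac)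
  qed
  moreover have "C * q powr (-2) \<ge> 0" using S0 by (auto simp: C_def intro!: mult_nonneg_nonneg sum_nonneg)
  ultimately show ?thesis using q(1,2) by blast
qed

lemma dominant_eq:
  "norm (of_real (2 * ln 2) powr (s - 1) :: complex) = (2 * ln 2) powr (Re s - 1)"
  "norm (two_pi_i 1 powr (s - 1)) = (2 * pi) powr (Re s - 1) * exp (- Im s * pi / 2)"
proof -
  show "norm (of_real (2 * ln 2) powr (s - 1) :: complex) = (2 * ln 2) powr (Re s - 1)"
    by (subst norm_powr_real_powr) auto
  have "Arg (two_pi_i 1) = pi / 2"
  proof -
    have "two_pi_i 1 = of_real (2 * pi) * \<i>" by (simp add: two_pi_i_def)
    moreover have "Arg (of_real (2 * pi) * \<i>) = Arg \<i>" by (rule Arg_times_of_real) auto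
    ultimately show ?thesis by simp
  qed
  then show "norm (two_pi_i 1 powr (s - 1)) = (2 * pi) powr (Re s - 1) * exp (- Im s * pi / 2)"
    by (simp add: norm_powr_complex)
qed

lemma D_fun_expansion:
  assumes K: "K \<ge> 3" and s: "Re s < 0"
  shows "zeta s + (\<Sum>k\<in>{2..<K}. polylog s (2 * ln (real k))) = Gamma (1 - s) *
    (of_real (2 * ln 2) powr (s - 1) + two_pi_i 1 powr (s - 1) + (\<Sum>k\<in>{1..<K}. \<Sum>\<^sub>\<infinity>j\<in>minor_set k. pole_at k j powr (s - 1)))"
proof -
  let ?S = "\<lambda>k. \<Sum>\<^sub>\<infinity>j\<in>minor_set k. pole_at k j powr (s - 1)"
  have sub: "(\<lambda>j. pole_at k j powr (s - 1)) summable_on A" if "A \<subseteq> -{0}" for k A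
  proof -
    have "(\<lambda>j. pole_at k j powr (s - 1)) summable_on -{0}"
      unfolding pole_at_def by (rule shifted_summable) (use s in simp)
    then show ?thesis using that by (rule summable_on_subset)
  qed
  have z: "zeta s = Gamma (1 - s) * (two_pi_i 1 powr (s - 1) + ?S 1)"
  proof -
    have p: "pole_at 1 j = two_pi_i j" for j by (simp add: pole_at_def)
    have "(\<Sum>\<^sub>\<infinity>j\<in>insert 1 (-{0,1}). pole_at 1 j powr (s - 1)) = pole_at 1 1 powr (s - 1) + (\<Sum>\<^sub>\<infinity>j\<in>-{0,1}. pole_at 1 j powr (s - 1))"
      by (intro infsum_insert sub) auto
    moreover have "insert 1 (-{0,1}) = -{0::int}" by auto
    moreover have "minor_set 1 = -{0,1}" by (simp add: minor_set_def)
    ultimately show ?thesis using zeta_properties(3)[OF s] by (simp only: p)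
  qed
  have l: "polylog s (2 * ln (real k)) = Gamma (1 - s) * (\<Sum>\<^sub>\<infinity>j. pole_at k j powr (s - 1))" if "k \<ge> 2" for k
  proof -
    have "- (1 - s) = s - 1" by simp
    then show ?thesis using polylog_lat[of "2 * ln (real k)" s] s that unfolding lattice_sum_def pole_at_def by auto
  qed
  have l2: "polylog s (2 * ln (real 2)) = Gamma (1 - s) * (of_real (2 * ln 2) powr (s - 1) + ?S 2)"
  proof -
    have p: "pole_at 2 0 = of_real (2 * ln 2)" by (simp add: pole_at_def)
    have "(\<Sum>\<^sub>\<infinity>j\<in>insert 0 (-{0}). pole_at 2 j powr (s - 1)) = pole_at 2 0 powr (s - 1) + (\<Sum>\<^sub>\<infinity>j\<in>-{0}. pole_at 2 j powr (s - 1))"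
      by (intro infsum_insert sub) auto
    moreover have "insert 0 (-{0}) = (UNIV::int set)" by auto
    moreover have "minor_set 2 = -{0}" by (simp add: minor_set_def)
    ultimately show ?thesis using l[of 2] by (simp only: p order_refl)
  qed
  have "(\<Sum>k\<in>{2..<K}. polylog s (2 * ln (real k))) = polylog s (2 * ln (real 2)) + (\<Sum>k\<in>{3..<K}. polylog s (2 * ln (real k)))"
    using K sum.atLeast_Suc_lessThan[of 2 K "\<lambda>k. polylog s (2 * ln (real k))"] by (simp add: eval_nat_numeral)
  also have "(\<Sum>k\<in>{3..<K}. polylog s (2 * ln (real k))) = (\<Sum>k\<in>{3..<K}. Gamma (1 - s) * ?S k)"
    by (intro sum.cong) (auto simp: l minor_set_def)
  finally have "(\<Sum>k\<in>{2..<K}. polylog s (2 * ln (real k))) = Gamma (1 - s) * (of_real (2 * ln 2) powr (s - 1) + ?S 2 + (\<Sum>k\<in>{3..<K}. ?S k))"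
    unfolding l2 by (simp add: sum_distrib_left ring_distribs)
  moreover have "(\<Sum>k\<in>{1..<K}. ?S k) = ?S 1 + ?S 2 + (\<Sum>k\<in>{3..<K}. ?S k)"
    using K sum.atLeast_Suc_lessThan[of 1 K ?S] sum.atLeast_Suc_lessThan[of 2 K ?S] by (simp add: eval_nat_numeral)
  ultimately show ?thesis unfolding z by (simp add: ring_distribs)
qed

lemma D_fun_asymp:
  "\<exists>C q. C \<ge> 0 \<and> 0 < q \<and> q < 1 \<and> (\<forall>s. Re s \<le> -1 \<longrightarrow> Im s \<le> 0 \<longrightarrow>
     norm (D_fun s / Gamma (1 - s) - of_real (2 * ln 2) powr (s - 1) - two_pi_i 1 powr (s - 1)) \<le> C * q powr (1 - Re s) * dominant s)"
proof -
  \<comment> \<open>Any exponent above pi would do; 4 is an integer with this property.\<close>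
  obtain K :: nat where "real K > exp 4" using reals_Archimedean2 by blast
  moreover have "exp (4::real) \<ge> 5" using exp_ge_add_one_self[of 4] by simp
  ultimately have K: "real K > exp 4" "K \<ge> 3" by linarith+
  have lnK: "ln (real K) > pi"
  proof -
    have "4 < ln (real K)" using K by (metis exp_less_cancel_iff exp_ln exp_gt_zero less_trans)
    then show ?thesis using pi_less_4 by linarith
  qed
  obtain C1 q1 where 1: "C1 \<ge> 0" "0 < q1" "q1 < 1" "\<And>s. Re s \<le> -1 \<Longrightarrow> Im s \<le> 0 \<Longrightarrow>
     norm (\<Sum>k\<in>{1..<K}. \<Sum>\<^sub>\<infinity>j\<in>minor_set k. pole_at k j powr (s - 1)) \<le> C1 * q1 powr (1 - Re s) * dominant s"
    using minor_set_sum_bound[of K] by blast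
  obtain C2 where 2: "C2 \<ge> 0" "\<And>s. Re s \<le> -1 \<Longrightarrow> norm (E_fun s - (\<Sum>k\<in>{2..<K}. polylog s (2 * ln (real k)))) \<le> 
     C2 * Gamma (1 - Re s) * (2 * ln (real K)) powr (Re s - 1)"
    using E_fun_tail_Gamma[of K] K by auto
  \<comment> \<open>\<open>q1\<close> is the decay rate of the minor terms. The other entry is that
    of the tail: 2 log K against the 2 pi of the main term whose exponential growth offsets the
    smallness of Gamma(1-s).\<close>
  define q where "q = max q1 (pi / ln (real K))"
  have "0 < ln (real K)" using lnK pi_gt_zero by linarith
  then have "pi / ln (real K) < 1" using lnK by (simp only: divide_less_eq_1_pos)
  then have q: "q1 \<le> q" "pi / ln (real K) \<le> q" "0 < q" "q < 1" using 1 by (auto simp: q_def)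
  have "norm (D_fun s / Gamma (1 - s) - of_real (2 * ln 2) powr (s - 1) - two_pi_i 1 powr (s - 1)) \<le> (C1 + C2) * q powr (1 - Re s) * dominant s"
    if s: "Re s \<le> -1" "Im s \<le> 0" for s
  proof -
    define T where "T = E_fun s - (\<Sum>k\<in>{2..<K}. polylog s (2 * ln (real k)))"
    define R where "R = (\<Sum>k\<in>{1..<K}. \<Sum>\<^sub>\<infinity>j\<in>minor_set k. pole_at k j powr (s - 1))"
    have G0: "Gamma (1 - s) \<noteq> 0"
      using Re_pos_notin_nonpos_Ints[of "1 - s"] s by (simp add: Gamma_eq_zero_iff)
    have GR: "Gamma (1 - Re s) > 0" using s by (intro Gamma_real_pos) auto
    have "D_fun s = Gamma (1 - s) * (of_real (2 * ln 2) powr (s - 1) + two_pi_i 1 powr (s - 1) + R) + T"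
      using D_fun_expansion[OF K(2), of s] s by (simp add: D_fun_def T_def R_def algebra_simps)
    then have "D_fun s / Gamma (1 - s) - of_real (2 * ln 2) powr (s - 1) - two_pi_i 1 powr (s - 1) = R + T / Gamma (1 - s)"
      using G0 by (simp add: field_simps)
    then have "norm (D_fun s / Gamma (1 - s) - of_real (2 * ln 2) powr (s - 1) - two_pi_i 1 powr (s - 1)) \<le> norm R + norm T / norm (Gamma (1 - s))"
      using norm_triangle_ineq[of R "T / Gamma (1 - s)"] by (simp add: norm_divide)
    also have "norm R \<le> C1 * q powr (1 - Re s) * dominant s"
    proof -
      have "C1 * q1 powr (1 - Re s) * dominant s \<le> C1 * q powr (1 - Re s) * dominant s"
        using 1 q s by (intro mult_right_mono mult_left_mono powr_mono2) (auto simp: dominant_def le_max_iff_disj)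
      then show ?thesis using 1(4)[OF s] by (simp add: R_def)
    qed
    also have "norm T / norm (Gamma (1 - s)) \<le> C2 * q powr (1 - Re s) * dominant s"
    proof -
      have "1 - s = Complex (1 - Re s) (- Im s)" by (simp add: complex_eq_iff)
      then have "Gamma (1 - Re s) * exp (pi * Im s / 2) \<le> norm (Gamma (1 - s))"
        using norm_Gamma_lower(1)[of "1 - Re s" "- Im s"] s by simp
      then have "norm T / norm (Gamma (1 - s)) \<le> (C2 * Gamma (1 - Re s) * (2 * ln (real K)) powr (Re s - 1)) / (Gamma (1 - Re s) * exp (pi * Im s / 2))"
        using 2(2)[OF s(1)] 2(1) GR lnK unfolding T_def by (intro frac_le) auto
      also have "\<dots> = C2 * (2 * ln (real K)) powr (Re s - 1) * exp (- Im s * pi / 2)"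
        using GR by (simp add: exp_minus field_simps)
      also have "(2 * ln (real K)) powr (Re s - 1) = (pi / ln (real K)) powr (1 - Re s) * (2 * pi) powr (Re s - 1)"
      proof -
        have "2 * ln (real K) = (2 * pi) * (ln (real K) / pi)" by simp
        then have "(2 * ln (real K)) powr (Re s - 1) = (2 * pi) powr (Re s - 1) * (ln (real K) / pi) powr (Re s - 1)"
          by (metis powr_mult)
        also have "(ln (real K) / pi) powr (Re s - 1) = (pi / ln (real K)) powr (1 - Re s)"
          using lnK powr_minus[of "ln (real K) / pi" "1 - Re s"] by (simp add: powr_divide)
        finally show ?thesis by simp
      qed
      also have "C2 * ((pi / ln (real K)) powr (1 - Re s) * (2 * pi) powr (Re s - 1)) * exp (- Im s * pi / 2)
        = C2 * (pi / ln (real K)) powr (1 - Re s) * ((2 * pi) powr (Re s - 1) * exp (- Im s * pi / 2))" by (simp only: mult_ac)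
      also have "\<dots> \<le> C2 * q powr (1 - Re s) * dominant s"
        using 2(1) q \<open>0 < ln (real K)\<close> s pi_gt_zero by (intro mult_mono powr_mono2) (auto simp: dominant_def le_max_iff_disj)
      finally show ?thesis .
    qed
    finally show ?thesis by (simp add: ring_distribs)
  qed
  then show ?thesis using 1(1) 2(1) q(3,4) by (intro exI[of _ "C1 + C2"] exI[of _ q]) auto
qed

text \<open>Dividing by a positive real leaves the argument unchanged, so the principal logarithm of
  the quotient is the difference of logarithms without a multiple of 2 pi i. The ratio of the main
  terms is therefore exactly exp((s-1) L).\<close>

lemma L_const_eq: "L_const = Ln (two_pi_i 1) - of_real (ln (2 * ln 2))"
  "Re L_const = ln (pi / ln 2)" "Im L_const = pi / 2"
proof -
  have l2: "0 < ln (2::real)" by simp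
  have 1: "Ln (two_pi_i 1) = of_real (ln (2 * pi)) + \<i> * of_real pi / 2"
  proof -
    have "two_pi_i 1 = of_real (2 * pi) * \<i>" by (simp add: two_pi_i_def)
    moreover have "Ln (of_real (2 * pi) * \<i>) = of_real (ln (2 * pi)) + Ln \<i>"
      using Ln_times_of_real[of "2 * pi" \<i>] Ln_of_real[of "2 * pi"] by (simp del: of_real_mult)
    ultimately show ?thesis by (simp only: Ln_ii)
  qed
  have "2 * of_real pi * \<i> / (2 * of_real (ln 2)) = of_real (pi / ln 2) * \<i>" by simp
  then have 2: "L_const = of_real (ln (pi / ln 2)) + \<i> * of_real pi / 2"
    unfolding L_const_def using Ln_times_of_real[of "pi / ln 2" \<i>] Ln_of_real[of "pi / ln 2"] l2 pi_gt_zero by (simp del: of_real_divide)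
  have "ln (pi / ln 2) = ln (2 * pi) - ln (2 * ln 2)" by (simp add: ln_div ln_mult)
  then show "L_const = Ln (two_pi_i 1) - of_real (ln (2 * ln 2))" unfolding 1 2 by simp
  show "Re L_const = ln (pi / ln 2)" "Im L_const = pi / 2" unfolding 2 by simp_all
qed

text \<open>D divided by Gamma(1-s) and by its first main term. The divisor is holomorphic and
  zero-free for Re s < 1, so zeros and their orders are preserved there, while the model becomes 1 +
  exp((s-1) L).\<close>

definition Dnorm :: "complex \<Rightarrow> complex" where
  "Dnorm s = D_fun s / (Gamma (1 - s) * of_real (2 * ln 2) powr (s - 1))"

theorem Dnorm_asymp:
  "\<exists>C q. C > 0 \<and> 0 < q \<and> q < 1 \<and> (\<forall>s. Re s \<le> -1 \<longrightarrow> Im s \<le> 0 \<longrightarrow>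
     norm (Dnorm s - (1 + exp ((s - 1) * L_const))) \<le> C * q powr (1 - Re s) * max 1 (norm (exp ((s - 1) * L_const))))"
proof -
  obtain C q where C: "C \<ge> 0" "0 < q" "q < 1" "\<And>s. Re s \<le> -1 \<Longrightarrow> Im s \<le> 0 \<Longrightarrow>
     norm (D_fun s / Gamma (1 - s) - of_real (2 * ln 2) powr (s - 1) - two_pi_i 1 powr (s - 1)) \<le> C * q powr (1 - Re s) * dominant s"
    using D_fun_asymp by blast
  have "norm (Dnorm s - (1 + exp ((s - 1) * L_const))) \<le> (C + 1) * q powr (1 - Re s) * max 1 (norm (exp ((s - 1) * L_const)))"
    if s: "Re s \<le> -1" "Im s \<le> 0" for s
  proof -
    define a where "a = complex_of_real (2 * ln 2) powr (s - 1)"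
    define b where "b = two_pi_i 1 powr (s - 1)"
    define e where "e = exp ((s - 1) * L_const)"
    have a0: "a \<noteq> 0" by (simp add: a_def)
    have t: "two_pi_i 1 \<noteq> 0" by (simp add: two_pi_i_def)
    have b: "b = a * e"
      unfolding a_def b_def e_def powr_def L_const_eq(1) using t
      by (simp add: Ln_of_real right_diff_distrib flip: exp_add of_real_mult del: of_real_mult)
    have D: "dominant s = norm a * max 1 (norm e)"
    proof -
      have "dominant s = max (norm a) (norm b)" unfolding dominant_def a_def b_def dominant_eq ..
      also have "\<dots> = norm a * max 1 (norm e)" unfolding b norm_mult by (subst max_mult_distrib_left) simp
      finally show ?thesis .
    qed
    have "(Dnorm s - (1 + e)) * a = D_fun s / Gamma (1 - s) - a - b"
      using a0 unfolding Dnorm_def a_def[symmetric] b by (simp add: field_simps)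
    then have "norm (Dnorm s - (1 + e)) * norm a \<le> C * q powr (1 - Re s) * (norm a * max 1 (norm e))"
      using C(4)[OF s] unfolding a_def[symmetric] b_def[symmetric] D norm_mult[symmetric] by simp
    then have "norm (Dnorm s - (1 + e)) \<le> C * q powr (1 - Re s) * max 1 (norm e)"
      using a0 by (simp add: mult.left_commute mult.commute)
    also have "\<dots> \<le> (C + 1) * q powr (1 - Re s) * max 1 (norm e)"
      by (intro mult_right_mono) auto
    finally show ?thesis by (simp add: e_def)
  qed
  then show ?thesis using C by (intro exI[of _ "C + 1"] exI[of _ q]) auto
qed

section \<open>Reflection symmetry and isolation of zeros\<close>

lemma holomorphic_cnj_cnj:
  assumes "f holomorphic_on S" "open S" "\<And>z. z \<in> S \<Longrightarrow> cnj z \<in> S"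
  shows "(\<lambda>z. cnj (f (cnj z))) holomorphic_on S"
  unfolding holomorphic_on_def
proof
  fix z assume z: "z \<in> S"
  have "(f has_field_derivative deriv f (cnj z)) (at (cnj z))"
    using holomorphic_derivI[OF assms(1,2) assms(3)[OF z]] .
  from has_field_derivative_cnj_cnj[OF this]
  have "((\<lambda>z. cnj (f (cnj z))) has_field_derivative cnj (deriv f (cnj z))) (at z within S)"
    by (auto simp: o_def intro: has_field_derivative_at_within)
  then show "(\<lambda>z. cnj (f (cnj z))) field_differentiable at z within S"
    by (auto simp: field_differentiable_def)
qed

lemma cnj_Suc_powr: "cnj (of_nat (Suc n) powr s) = of_nat (Suc n) powr cnj s"
  by (subst cnj_powr) auto

lemma zeta_cnj: "s \<noteq> 1 \<Longrightarrow> zeta (cnj s) = cnj (zeta s)"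
proof -
  assume "s \<noteq> 1"
  have "cnj (zeta (cnj s)) = zeta s"
  proof (rule analytic_continuation_open[of "{s. Re s > 1}" "-{1}" "\<lambda>s. cnj (zeta (cnj s))" zeta])
    have "Re 2 > 1" by simp
    then show "{s. Re s > 1} \<noteq> {}" by blast
    show "connected (- {1::complex})" by (rule connected_punctured_universe) auto
    show "(\<lambda>s. cnj (zeta (cnj s))) holomorphic_on -{1}"
      by (rule holomorphic_cnj_cnj[OF zeta_properties(1)]) (auto simp: complex_eq_iff)
    fix z assume "z \<in> {s. Re s > 1}"
    then have z: "Re z > 1" "Re (cnj z) > 1" by auto
    have "(\<lambda>n. cnj (of_nat (Suc n) powr (- cnj z))) sums cnj (zeta (cnj z))"
      using zeta_properties(2)[OF z(2)] by (subst sums_cnj)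
    then have "(\<lambda>n. of_nat (Suc n) powr (- z)) sums cnj (zeta (cnj z))"
      by (simp only: cnj_Suc_powr complex_cnj_minus complex_cnj_cnj)
    then show "cnj (zeta (cnj z)) = zeta z" using zeta_properties(2)[OF z(1)] sums_unique2 by blast
  qed (use zeta_properties(1) \<open>s \<noteq> 1\<close> in \<open>auto intro: open_halfspace_Re_gt\<close>)
  then show ?thesis by (metis complex_cnj_cnj)
qed

section \<open>Convergence, boundedness and symmetry of E and D\<close>

lemma E_fun_term_bound:
  obtains C where "C \<ge> 0" "\<And>n s. norm ((zeta (2 * of_nat (Suc n)) - 1) * of_nat (Suc n) powr (-s)) \<le> C * (real (Suc n) powr (- Re s) * exp (- (2 * ln 2) * real (Suc n)))"
proof -
  obtain C where C: "C \<ge> 0" "\<And>n. norm (zeta (2 * of_nat (Suc n)) - (\<Sum>k\<in>{1..<2}. of_real (exp (- (2 * ln (real k)) * real (Suc n)))))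
     \<le> C * exp (- (2 * ln (real 2)) * real (Suc n))"
    using zeta_even_tail[of 2] by (metis one_le_numeral)
  have "{1..<2} = {1::nat}" by auto
  then have C': "norm (zeta (2 * of_nat (Suc n)) - 1) \<le> C * exp (- (2 * ln 2) * real (Suc n))" for n
    using C(2)[of n] by simp
  show ?thesis
  proof
    show "norm ((zeta (2 * of_nat (Suc n)) - 1) * of_nat (Suc n) powr (-s)) \<le> C * (real (Suc n) powr (- Re s) * exp (- (2 * ln 2) * real (Suc n)))" for n s
    proof -
      have "norm ((zeta (2 * of_nat (Suc n)) - 1) * of_nat (Suc n) powr (-s)) \<le> (C * exp (- (2 * ln 2) * real (Suc n))) * real (Suc n) powr (- Re s)"
        unfolding norm_mult norm_Suc_powr uminus_complex.sel using C'[of n] by (intro mult_right_mono) auto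
      then show ?thesis by (simp only: mult_ac)
    qed
  qed (rule C(1))
qed

lemma E_fun_has_sum: "((\<lambda>n. (zeta (2 * of_nat (Suc n)) - 1) * of_nat (Suc n) powr (-s)) has_sum E_fun s) UNIV"
proof -
  obtain C where C: "C \<ge> 0" "\<And>n s. norm ((zeta (2 * of_nat (Suc n)) - 1) * of_nat (Suc n) powr (-s)) \<le> C * (real (Suc n) powr (- Re s) * exp (- (2 * ln 2) * real (Suc n)))"
    using E_fun_term_bound by blast
  have "(\<lambda>n. C * (real (Suc n) powr (- Re s) * exp (- (2 * ln 2) * real (Suc n)))) summable_on UNIV"
    by (intro summable_on_cmult_right summable_powr_exp) simp
  then have "(\<lambda>n. (zeta (2 * of_nat (Suc n)) - 1) * of_nat (Suc n) powr (-s)) summable_on UNIV"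
    by (intro infsum_norm_le(1)[OF C(2)])
  then have "((\<lambda>n. (zeta (2 * of_nat (Suc n)) - 1) * of_nat (Suc n) powr (-s)) has_sum (\<Sum>\<^sub>\<infinity>n. (zeta (2 * of_nat (Suc n)) - 1) * of_nat (Suc n) powr (-s))) UNIV"
    by (rule has_sum_infsum)
  moreover from this have "E_fun s = (\<Sum>\<^sub>\<infinity>n. (zeta (2 * of_nat (Suc n)) - 1) * of_nat (Suc n) powr (-s))"
    unfolding E_fun_def by (intro sums_unique[symmetric] has_sum_imp_sums)
  ultimately show ?thesis by simp
qed

text \<open>The factors \<zeta>(2n) - 1 decay like 4^(-n), which beats n^a. The bound ignores Im s,
  so E cannot compensate a growing zeta in a vertical strip.\<close>

lemma E_fun_bounded:
  "\<exists>B\<ge>0. \<forall>s. Re s \<ge> - a \<longrightarrow> norm (E_fun s) \<le> B"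
proof -
  obtain C where C: "C \<ge> 0" "\<And>n s. norm ((zeta (2 * of_nat (Suc n)) - 1) * of_nat (Suc n) powr (-s)) \<le> C * (real (Suc n) powr (- Re s) * exp (- (2 * ln 2) * real (Suc n)))"
    using E_fun_term_bound by blast
  let ?M = "\<lambda>n. C * (real (Suc n) powr a * exp (- (2 * ln 2) * real (Suc n)))"
  have M: "?M summable_on UNIV"
    by (intro summable_on_cmult_right summable_powr_exp) simp
  have "norm (E_fun s) \<le> infsum ?M UNIV" if s: "Re s \<ge> - a" for s
  proof -
    have b: "norm ((zeta (2 * of_nat (Suc n)) - 1) * of_nat (Suc n) powr (-s)) \<le> ?M n" for n
      by (rule order_trans[OF C(2)]) (use s C(1) in \<open>auto intro!: mult_left_mono mult_right_mono powr_mono\<close>)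
    show ?thesis using infsum_norm_le(2)[OF b M] infsumI[OF E_fun_has_sum[of s]] by simp
  qed
  moreover have "infsum ?M UNIV \<ge> 0" using C(1) by (intro infsum_nonneg) auto
  ultimately show ?thesis by blast
qed

lemma E_fun_holomorphic: "E_fun holomorphic_on UNIV"
proof -
  obtain C where C: "C \<ge> 0" "\<And>n s. norm ((zeta (2 * of_nat (Suc n)) - 1) * of_nat (Suc n) powr (-s)) \<le> C * (real (Suc n) powr (- Re s) * exp (- (2 * ln 2) * real (Suc n)))"
    using E_fun_term_bound by blast
  have "(\<lambda>s. \<Sum>\<^sub>\<infinity>n. (zeta (2 * of_nat (Suc n)) - 1) * of_nat (Suc n) powr (-s)) holomorphic_on UNIV"
  proof (rule infsum_holomorphic)
    show "(\<lambda>s. (zeta (2 * of_nat (Suc n)) - 1) * of_nat (Suc n) powr (-s)) holomorphic_on UNIV" for n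
      by (intro holomorphic_intros)
    fix z :: complex
    let ?M = "\<lambda>n. C * (real (Suc n) powr (\<bar>Re z\<bar> + 1) * exp (- (2 * ln 2) * real (Suc n)))"
    have "norm ((zeta (2 * of_nat (Suc n)) - 1) * of_nat (Suc n) powr (-u)) \<le> ?M n" if "u \<in> cball z 1" for u n
    proof (rule order_trans[OF C(2)])
      have "norm (z - u) \<le> 1" using that by (simp add: dist_norm)
      then have "- Re u \<le> \<bar>Re z\<bar> + 1" using complex_Re_le_cmod[of "z - u"] by simp
      then show "C * (real (Suc n) powr (- Re u) * exp (- (2 * ln 2) * real (Suc n))) \<le> ?M n"
        using C(1) by (intro mult_left_mono mult_right_mono powr_mono) auto
    qed
    moreover have "?M summable_on UNIV" by (intro summable_on_cmult_right summable_powr_exp) simp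
    ultimately show "\<exists>r>0. \<exists>M. M summable_on UNIV \<and> (\<forall>n\<in>UNIV. \<forall>u\<in>UNIV \<inter> cball z r.
        norm ((zeta (2 * of_nat (Suc n)) - 1) * of_nat (Suc n) powr (-u)) \<le> M n)"
      by (intro exI[of _ 1] conjI exI[of _ ?M]) auto
  qed auto
  then show ?thesis by (rule holomorphic_transform) (use infsumI[OF E_fun_has_sum] in auto)
qed

lemma D_fun_holomorphic: "D_fun holomorphic_on -{1}"
  unfolding D_fun_def
  by (intro holomorphic_on_add zeta_properties(1) holomorphic_on_subset[OF E_fun_holomorphic]) auto

lemma D_fun_cnj: "s \<noteq> 1 \<Longrightarrow> D_fun (cnj s) = cnj (D_fun s)"
proof -
  assume s: "s \<noteq> 1"
  have z: "cnj (zeta (2 * of_nat (Suc n))) = zeta (2 * of_nat (Suc n))" for n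
  proof -
    have "2 * complex_of_nat (Suc n) \<noteq> 1" by (auto simp: complex_eq_iff)
    then show ?thesis using zeta_cnj[of "2 * of_nat (Suc n)"] by simp
  qed
  have "((\<lambda>n. cnj ((zeta (2 * of_nat (Suc n)) - 1) * of_nat (Suc n) powr (-s))) has_sum cnj (E_fun s)) UNIV"
    by (subst has_sum_cnj_iff) (rule E_fun_has_sum)
  then have "((\<lambda>n. (zeta (2 * of_nat (Suc n)) - 1) * of_nat (Suc n) powr (- cnj s)) has_sum cnj (E_fun s)) UNIV"
    by (simp only: complex_cnj_mult complex_cnj_diff z cnj_Suc_powr complex_cnj_minus complex_cnj_one)
  then have "E_fun (cnj s) = cnj (E_fun s)" using E_fun_has_sum has_sum_unique by blast
  then show ?thesis using zeta_cnj[OF s] by (simp add: D_fun_def)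
qed

text \<open>Rouche's theorem equates the sums of orders inside the circle. That of \<open>f\<close>
  is 1, and orders of zeros of \<open>F\<close> are positive integers, so exactly one zero remains
  and it is simple.\<close>

lemma rouche_unique_zero:
  assumes F: "F holomorphic_on ball c R" and f: "f holomorphic_on ball c R" and r: "0 < r" "r < R"
    and less: "\<And>z. z \<in> sphere c r \<Longrightarrow> norm (F z - f z) < norm (f z)"
    and zf: "\<And>z. z \<in> ball c R \<Longrightarrow> f z = 0 \<longleftrightarrow> z = c" and ord: "zorder f c = 1"
  shows "\<exists>z. {z \<in> ball c r. F z = 0} = {z} \<and> zorder F z = 1"
proof -
  \<comment> \<open>The intermediate radius gives an open set that contains the circle and has
    compact closure in the domain, whence finitely many zeros of \<open>F\<close>. Those outside the
    circle have winding number 0 and drop out.\<close>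
  define R' where "R' = (r + R) / 2"
  have R': "r < R'" "R' < R" using r by (auto simp: R'_def)
  define S where "S = ball c R'"
  have SR: "S \<subseteq> cball c R'" "cball c R' \<subseteq> ball c R" "S \<subseteq> ball c R" using R' by (auto simp: S_def)
  define Z where "Z = {p \<in> S. F p = 0}"
  \<comment> \<open>Strict inequality on the circle forces F to be nonzero here, which excludes that
    F vanishes identically.\<close>
  define pt where "pt = c + of_real r"
  have pt: "pt \<in> sphere c r" "pt \<in> S" using r R' by (auto simp: pt_def dist_norm S_def)
  have Fpt: "F pt \<noteq> 0" using less[OF pt(1)] by auto
  have finZ: "finite Z"
  proof (cases "F constant_on ball c R")
    case True
    then obtain k where k: "\<And>z. z \<in> ball c R \<Longrightarrow> F z = k" by (auto simp: constant_on_def)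
    then have "k \<noteq> 0" using Fpt pt SR by auto
    then have "Z = {}" using k SR by (auto simp: Z_def)
    then show ?thesis by simp
  next
    case False
    have "finite {z \<in> cball c R'. F z = 0}"
      by (rule holomorphic_compact_finite_zeros[OF F _ _ _ SR(2) False]) auto
    then show ?thesis by (rule finite_subset[rotated]) (use SR in \<open>auto simp: Z_def\<close>)
  qed
  have Zf: "{p \<in> S. f p = 0} = {c}" using zf SR r R' by (auto simp: S_def)
  have sph: "sphere c r \<subseteq> S" using R' by (auto simp: S_def)
  have "(\<Sum>p\<in>{p \<in> S. f p + (F p - f p) = 0}. winding_number (circlepath c r) p * zorder (\<lambda>p. f p + (F p - f p)) p)
          = (\<Sum>p\<in>{p \<in> S. f p = 0}. winding_number (circlepath c r) p * zorder f p)"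
  proof (rule Rouche_theorem)
    show "open S" "connected S" by (auto simp: S_def)
    show "finite {p \<in> S. f p + (F p - f p) = 0}" using finZ by (simp add: Z_def)
    show "finite {p \<in> S. f p = 0}" by (simp add: Zf)
    show "f holomorphic_on S" using f SR holomorphic_on_subset by blast
    show "(\<lambda>p. F p - f p) holomorphic_on S" using f F SR holomorphic_on_subset by (intro holomorphic_on_diff) blast+
    show "path_image (circlepath c r) \<subseteq> S" using sph r by simp
    show "\<forall>z\<in>path_image (circlepath c r). norm (F z - f z) < norm (f z)" using less r by simp
    show "\<forall>z. z \<notin> S \<longrightarrow> winding_number (circlepath c r) z = 0"
      using sph r by (auto intro!: winding_number_zero_outside[of _ S] simp: S_def)
  qed auto
  then have eq: "(\<Sum>p\<in>Z. winding_number (circlepath c r) p * zorder F p) = 1"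
    using r ord by (simp add: Zf Z_def winding_number_circlepath_centre)
  define Z' where "Z' = {z \<in> ball c r. F z = 0}"
  have Z'Z: "Z' \<subseteq> Z" using R' by (auto simp: Z'_def Z_def S_def)
  then have finZ': "finite Z'" using finZ finite_subset by blast
  have "(\<Sum>p\<in>Z. winding_number (circlepath c r) p * zorder F p) = (\<Sum>p\<in>Z'. winding_number (circlepath c r) p * zorder F p)"
  proof (rule sum.mono_neutral_right[OF finZ Z'Z])
    show "\<forall>p\<in>Z - Z'. winding_number (circlepath c r) p * zorder F p = 0"
    proof
      fix p assume p: "p \<in> Z - Z'"
      then have "F p = 0" "p \<notin> ball c r" by (auto simp: Z_def Z'_def)
      moreover from this have "p \<notin> sphere c r" using less[of p] by auto
      ultimately have "p \<notin> cball c r" by auto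
      then have "winding_number (circlepath c r) p = 0"
        using r by (intro winding_number_zero_outside[of _ "cball c r"]) auto
      then show "winding_number (circlepath c r) p * zorder F p = 0" by simp
    qed
  qed
  also have "\<dots> = (\<Sum>p\<in>Z'. of_int (zorder F p))"
    by (intro sum.cong) (auto simp: Z'_def dist_norm norm_minus_commute winding_number_circlepath)
  finally have "complex_of_int (\<Sum>p\<in>Z'. zorder F p) = complex_of_int 1" using eq by simp
  then have sum1: "(\<Sum>p\<in>Z'. zorder F p) = 1" by (simp only: of_int_eq_iff)
  have pos: "zorder F p > 0" if "p \<in> Z'" for p
  proof -
    have "p \<in> S" "F p = 0" using that Z'Z by (auto simp: Z_def)
    moreover have "F holomorphic_on S" using F SR holomorphic_on_subset by blast
    moreover have "open S" "connected S" by (auto simp: S_def)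
    moreover have "\<exists>w\<in>S. F w \<noteq> 0" using Fpt pt(2) by blast
    ultimately show ?thesis using zorder_exist_zero[of F S p] by simp
  qed
  have "Z' \<noteq> {}" using sum1 by auto
  then obtain z where z: "z \<in> Z'" by auto
  have "(\<Sum>p\<in>Z'. zorder F p) = zorder F z + (\<Sum>p\<in>Z' - {z}. zorder F p)" by (rule sum.remove[OF finZ' z])
  moreover have "(\<Sum>p\<in>Z' - {z}. zorder F p) \<ge> (\<Sum>p\<in>Z' - {z}. 1)" using pos by (intro sum_mono) force
  ultimately have "zorder F z + int (card (Z' - {z})) \<le> 1" using sum1 by simp
  then have "zorder F z = 1" "card (Z' - {z}) = 0" using pos[OF z] by auto
  then have "zorder F z = 1" "Z' - {z} = {}" using finZ' by (auto simp only: card_0_eq finite_Diff)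
  then have "zorder F z = 1" "Z' = {z}" using z by auto
  then show ?thesis unfolding Z'_def by blast
qed

text \<open>Used with v = (s - a) L for an approximate zero a; the radius 1 / (4 |L|) of the discs
  is chosen to give |v| \<le> 1/4.\<close>

lemma one_minus_exp_bounds:
  fixes v :: complex
  assumes "norm v \<le> 1 / 4"
  shows "norm v / 2 \<le> norm (1 - exp v)" "norm (exp v) \<le> 2"
proof -
  have r: "\<bar>Re v\<bar> \<le> 1 / 4" using assms abs_Re_le_cmod[of v] by linarith
  have e: "exp (1 / 4 :: real) \<le> 2"
    using exp_bound[of "1 / 4 :: real"] by (simp add: power2_eq_square)
  have e2: "exp \<bar>Re v\<bar> \<le> 2" using r e by (meson exp_le_cancel_iff order_trans)
  have "norm (exp v - (\<Sum>i\<le>1. v ^ i / fact i)) \<le> exp \<bar>Re v\<bar> * norm v ^ Suc 1 / fact 1"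
    by (rule Taylor_exp)
  then have "norm (exp v - 1 - v) \<le> exp \<bar>Re v\<bar> * (norm v * norm v)" by (simp add: diff_diff_add)
  also have "\<dots> \<le> 2 * (norm v * (1/4))" using e2 assms by (intro mult_mono) auto
  finally have "norm (exp v - 1 - v) \<le> norm v / 2" by simp
  moreover have "norm v \<le> norm (1 - exp v) + norm (exp v - 1 - v)"
    using norm_triangle_ineq4[of "exp v - 1" "exp v - 1 - v"] by (simp add: norm_minus_commute)
  ultimately show "norm v / 2 \<le> norm (1 - exp v)" by linarith
  have "norm (exp v) = exp (Re v)" by simp
  also have "\<dots> \<le> exp \<bar>Re v\<bar>" by simp
  finally show "norm (exp v) \<le> 2" using e2 by linarith
qed

section \<open>Zeros far to the left\<close>

lemma zorder_cnj:
  assumes f: "f holomorphic_on S" "open S" "connected S" "z \<in> S" and sym: "\<And>w. w \<in> S \<Longrightarrow> f (cnj w) = cnj (f w)"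
    and nz: "\<exists>w\<in>S. f w \<noteq> 0"
  shows "zorder f (cnj z) = zorder f z"
proof -
  define n where "n = zorder f z"
  define g where "g = zor_poly f z"
  have *: "(if f z = 0 then n > 0 else n = 0) \<and> (\<exists>r. r>0 \<and> cball z r \<subseteq> S \<and> g holomorphic_on cball z r
    \<and> (\<forall>w\<in>cball z r. f w  = g w * (w-z) ^ nat n  \<and> g w \<noteq>0))"
    unfolding n_def g_def by (rule zorder_exist_zero[OF f nz])
  then obtain r where r: "r > 0" "cball z r \<subseteq> S" "g holomorphic_on cball z r"
    "\<And>w. w \<in> cball z r \<Longrightarrow> f w = g w * (w-z) ^ nat n  \<and> g w \<noteq>0" by blast
  have n0: "n \<ge> 0" using * by (auto split: if_splits)
  show ?thesis
  proof (subst n_def[symmetric], rule zorder_eqI[of "ball (cnj z) r" _ "\<lambda>w. cnj (g (cnj w))"])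
    have d: "cnj w \<in> ball z r" if "w \<in> ball (cnj z) r" for w
      using that by (metis complex_cnj_cnj complex_cnj_diff complex_mod_cnj dist_norm mem_ball)
    show "(\<lambda>w. cnj (g (cnj w))) holomorphic_on ball (cnj z) r"
      unfolding holomorphic_on_def
    proof
      fix w assume w: "w \<in> ball (cnj z) r"
      have "g holomorphic_on ball z r" using r(3) ball_subset_cball holomorphic_on_subset by blast
      then have "(g has_field_derivative deriv g (cnj w)) (at (cnj w))"
        using d[OF w] holomorphic_derivI by blast
      from has_field_derivative_cnj_cnj[OF this]
      have "((\<lambda>w. cnj (g (cnj w))) has_field_derivative cnj (deriv g (cnj w))) (at w within ball (cnj z) r)"
        by (auto simp: o_def intro: has_field_derivative_at_within)
      then show "(\<lambda>w. cnj (g (cnj w))) field_differentiable at w within ball (cnj z) r"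
        by (auto simp: field_differentiable_def)
    qed
    show "cnj (g (cnj (cnj z))) \<noteq> 0" using r(4)[of z] r(1) by simp
    fix w assume w: "w \<in> ball (cnj z) r"
    have c: "cnj w \<in> cball z r" using d[OF w] by simp
    have "f w = cnj (f (cnj w))" using sym[of "cnj w"] c r(2) by auto
    also have "\<dots> = cnj (g (cnj w)) * (w - cnj z) ^ nat n" using r(4)[OF c] by simp
    finally show "f w = cnj (g (cnj w)) * (w - cnj z) powi n" using n0 by (simp add: power_int_def)
  qed (use r in auto)
qed

text \<open>The exact zeros of the model 1 + exp((s-1) L). The sign makes those of large positive
  index lie in the lower left quadrant.\<close>

definition approx_zero :: "int \<Rightarrow> complex" where
  "approx_zero m = 1 - \<i> * of_real pi * (2 * of_int m + 1) / L_const"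

text \<open>The difference of the real parts of consecutive approximate zeros, as opposed to their
  distance 2 pi / |L|.\<close>

definition spacing :: real where "spacing = pi\<^sup>2 / (norm L_const)\<^sup>2"

lemma ln_pi_pos: "ln (pi / ln 2) > 0"
proof (rule ln_gt_zero)
  have "ln 2 < (1::real)" by (rule ln_2_less_1)
  then show "1 < pi / ln 2" using pi_gt3 by (simp add: field_simps)
qed

lemma norm_L_bounds: "3 / 2 < norm L_const" "norm L_const < 8" "L_const \<noteq> 0"
proof -
  have "pi / 2 \<le> norm L_const" using abs_Im_le_cmod[of L_const] by (simp add: L_const_eq(3))
  then show 1: "3 / 2 < norm L_const" using pi_gt3 by linarith
  then show "L_const \<noteq> 0" by auto
  have l2: "2 / 3 \<le> ln (2::real)" by (rule ln2_ge_two_thirds)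
  have "ln (pi / ln 2) \<le> pi / ln 2 - 1" using l2 pi_gt_zero by (intro ln_le_minus_one) auto
  moreover have "pi / ln 2 \<le> pi / (2 / 3)" using l2 pi_gt_zero by (intro divide_left_mono) auto
  moreover have "pi / (2 / 3) < 6" using pi_less_4 by simp
  ultimately have "ln (pi / ln 2) \<le> 5" by linarith
  then show "norm L_const < 8" using cmod_le[of L_const] ln_pi_pos pi_less_4 pi_gt_zero unfolding L_const_eq(2,3) by linarith
qed

lemma radius_bounds: "0 < 1 / (4 * norm L_const)" "1 / (4 * norm L_const) < 1 / 6"
proof -
  have "1 / (4 * norm L_const) < 1 / 6" using norm_L_bounds(1) by (intro divide_strict_left_mono) auto
  then show "1 / (4 * norm L_const) < 1 / 6" .
qed (use norm_L_bounds in simp)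

text \<open>The disc radius is below half the horizontal spacing: the discs project to disjoint
  intervals of the real axis, which yields injectivity and a separating vertical line.\<close>

lemma spacing_pos: "spacing > 0" "1 / (4 * norm L_const) < spacing / 2"
proof -
  have L: "norm L_const > 0" using norm_L_bounds by simp
  then show "spacing > 0" by (simp add: spacing_def)
  have "norm L_const < 2 * pi\<^sup>2" 
  proof -
    have "3 * 3 \<le> pi * pi" using pi_gt3 by (intro mult_mono) auto
    then show ?thesis using norm_L_bounds(2) by (simp add: power2_eq_square)
  qed
  then have "norm L_const / (4 * (norm L_const)\<^sup>2) < 2 * pi\<^sup>2 / (4 * (norm L_const)\<^sup>2)"
    using L by (intro divide_strict_right_mono) auto
  then show "1 / (4 * norm L_const) < spacing / 2"
    using L by (simp add: spacing_def power2_eq_square)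
qed

lemma approx_zero_Re_Im:
  "Re (approx_zero m) = 1 - (of_int m + 1 / 2) * spacing"
  "Im (approx_zero m) = - (2 * of_int m + 1) * (pi * ln (pi / ln 2) / (norm L_const)\<^sup>2)"
proof -
  have n: "(norm L_const)\<^sup>2 = (Re L_const)\<^sup>2 + (Im L_const)\<^sup>2" by (rule cmod_power2)
  define N where "N = (norm L_const)\<^sup>2"
  have "Re (x / L_const) = (Re x * ln (pi / ln 2) + Im x * (pi / 2)) / N" for x
    by (simp only: Re_divide N_def n L_const_eq(2,3))
  then show "Re (approx_zero m) = 1 - (of_int m + 1 / 2) * spacing"
    unfolding approx_zero_def spacing_def N_def[symmetric] by (simp add: power2_eq_square field_simps)
  have "Im (x / L_const) = (Im x * ln (pi / ln 2) - Re x * (pi / 2)) / N" for x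
    by (simp only: Im_divide N_def n L_const_eq(2,3))
  then have "Im (approx_zero m) = - (pi * (2 * of_int m + 1) * ln (pi / ln 2) / N)"
    unfolding approx_zero_def by simp
  then show "Im (approx_zero m) = - (2 * of_int m + 1) * (pi * ln (pi / ln 2) / (norm L_const)\<^sup>2)"
    unfolding N_def by (simp only: times_divide_eq_right mult_minus_left mult_ac)
qed

lemma exp_approx_zero: "exp ((s - 1) * L_const) = - exp ((s - approx_zero m) * L_const)"
proof -
  have "(s - 1) * L_const = (s - approx_zero m) * L_const - \<i> * of_real pi * (2 * of_int m + 1)"
    using norm_L_bounds(3) by (simp add: approx_zero_def field_simps)
  also have "\<dots> = (s - approx_zero m) * L_const - \<i> * of_real pi + 2 * of_int (- m) * of_real pi * \<i>"
    by (simp add: algebra_simps)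
  also have "exp \<dots> = exp ((s - approx_zero m) * L_const) / exp (\<i> * of_real pi) * exp (2 * of_int (- m) * of_real pi * \<i>)"
    by (simp only: exp_add exp_diff)
  also have "exp (2 * of_int (- m) * of_real pi * \<i>) = 1"
    using exp_integer_2pi[of "of_int (- m)"] by (simp add: mult_ac)
  also have "exp (\<i> * of_real pi) = -1" by (simp add: mult.commute exp_pi_i)
  finally show ?thesis by simp
qed

lemma Dnorm_factor_nz:
  assumes "Re s < 1"
  shows "Gamma (1 - s) * of_real (2 * ln 2) powr (s - 1) \<noteq> 0"
  using Re_pos_notin_nonpos_Ints[of "1 - s"] assms by (simp add: Gamma_eq_zero_iff)

lemma Dnorm_eq_0_iff: "Re s < 1 \<Longrightarrow> Dnorm s = 0 \<longleftrightarrow> D_fun s = 0"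
  using Dnorm_factor_nz[of s] by (auto simp: Dnorm_def)

lemma Dnorm_factor_holomorphic: "(\<lambda>s. Gamma (1 - s) * of_real (2 * ln 2) powr (s - 1)) holomorphic_on {s. Re s < 1}"
  by (intro holomorphic_intros) (auto intro!: Re_pos_notin_nonpos_Ints)

lemma Dnorm_holomorphic: "Dnorm holomorphic_on {s. Re s < 1}"
proof -
  have "D_fun holomorphic_on {s. Re s < 1}"
    by (rule holomorphic_on_subset[OF D_fun_holomorphic]) auto
  then show ?thesis unfolding Dnorm_def
    using Dnorm_factor_nz by (intro holomorphic_on_divide Dnorm_factor_holomorphic) auto
qed

lemma zorder_D_fun:
  assumes s: "Re s < 1" and z: "zorder Dnorm s = 1" "D_fun s = 0" and nz: "\<exists>w. Re w < 1 \<and> Dnorm w \<noteq> 0"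
  shows "zorder D_fun s = 1"
proof -
  let ?S = "{s. Re s < 1}"
  let ?u = "\<lambda>s. Gamma (1 - s) * of_real (2 * ln 2) powr (s - 1)"
  have S: "open ?S" "connected ?S" by (auto intro: open_halfspace_Re_lt convex_connected convex_halfspace_Re_lt)
  have "\<exists>w\<in>?S. Dnorm w \<noteq> 0" using nz by blast
  from zorder_exist_zero[OF Dnorm_holomorphic S _ this, of s]
  obtain r where r: "r > 0" "cball s r \<subseteq> ?S" "zor_poly Dnorm s holomorphic_on cball s r"
    "\<And>w. w \<in> cball s r \<Longrightarrow> Dnorm w = zor_poly Dnorm s w * (w - s) ^ nat (zorder Dnorm s) \<and> zor_poly Dnorm s w \<noteq> 0"
    using s by blast
  show ?thesis
  proof (rule simple_zeroI[of "ball s r" _ "\<lambda>w. zor_poly Dnorm s w * ?u w"])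
    have "zor_poly Dnorm s holomorphic_on ball s r" using r(3) ball_subset_cball holomorphic_on_subset by blast
    moreover have "?u holomorphic_on ball s r"
      using r(2) by (intro holomorphic_on_subset[OF Dnorm_factor_holomorphic]) (meson ball_subset_cball order_trans)
    ultimately show "(\<lambda>w. zor_poly Dnorm s w * ?u w) holomorphic_on ball s r" by (rule holomorphic_on_mult)
    show "zor_poly Dnorm s s * ?u s \<noteq> 0" using r(1) r(4)[of s] Dnorm_factor_nz[OF s] by auto
    fix w assume w: "w \<in> ball s r"
    then have "Re w < 1" using r(2) ball_subset_cball by blast
    then have "D_fun w = Dnorm w * ?u w" using Dnorm_factor_nz[of w] by (simp add: Dnorm_def)
    then show "D_fun w = zor_poly Dnorm s w * ?u w * (w - s)" using r(4)[of w] w z(1) by simp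
  qed (use r in auto)
qed

text \<open>On the circle |v| = 1/4, so the model has modulus at least 1/8, while the error is at
  most 2/32 = 1/16; this is the origin of 1/32. Rouche's theorem applies, and the zero found is then
  located more sharply.\<close>

lemma zero_in_disc:
  assumes C: "C > 0" "0 < q" "q < 1" and asymp: "\<And>s. Re s \<le> -1 \<Longrightarrow> Im s \<le> 0 \<Longrightarrow>
     norm (Dnorm s - (1 + exp ((s - 1) * L_const))) \<le> C * q powr (1 - Re s) * max 1 (norm (exp ((s - 1) * L_const)))"
    and disc: "\<And>s. s \<in> ball (approx_zero m) 1 \<Longrightarrow> Re s \<le> -1 \<and> Im s \<le> 0 \<and> C * q powr (1 - Re s) \<le> 1 / 32"
  shows "\<exists>z. {z \<in> ball (approx_zero m) (1 / (4 * norm L_const)). Dnorm z = 0} = {z} \<and> zorder Dnorm z = 1 \<and>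
     norm (z - approx_zero m) \<le> 4 * C * q powr (1 - Re z)"
proof -
  let ?L = "norm L_const"
  define r where "r = 1 / (4 * ?L)"
  have L: "?L > 3 / 2" using norm_L_bounds by simp
  have r: "0 < r" "r < 2 * r" "2 * r < 1" using radius_bounds unfolding r_def[symmetric] by linarith+
  let ?f = "\<lambda>s. 1 + exp ((s - 1) * L_const)"
  have f: "?f s = 1 - exp ((s - approx_zero m) * L_const)" for s by (simp add: exp_approx_zero[of s m])
  have in1: "s \<in> ball (approx_zero m) 1" if "norm (s - approx_zero m) < 1" for s using that by (simp add: dist_norm norm_minus_commute)
  have err: "norm (Dnorm s - ?f s) \<le> 2 * (C * q powr (1 - Re s))" if s: "norm (s - approx_zero m) \<le> r" for s
  proof -
    have d: "Re s \<le> -1 \<and> Im s \<le> 0" using disc[OF in1] s r by auto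
    have "norm ((s - approx_zero m) * L_const) \<le> r * ?L" unfolding norm_mult using s by (intro mult_right_mono) auto
    also have "\<dots> = 1 / 4" using L norm_L_bounds(3) by (simp add: r_def field_simps)
    finally have "norm (exp ((s - approx_zero m) * L_const)) \<le> 2" by (rule one_minus_exp_bounds)
    then have "norm (exp ((s - 1) * L_const)) \<le> 2" by (simp only: exp_approx_zero[of s m] norm_minus_cancel)
    then have "C * q powr (1 - Re s) * max 1 (norm (exp ((s - 1) * L_const))) \<le> C * q powr (1 - Re s) * 2"
      using C by (intro mult_left_mono) auto
    then show ?thesis using asymp[of s] d by simp
  qed
  have low: "norm (s - approx_zero m) * ?L / 2 \<le> norm (?f s)" if s: "norm (s - approx_zero m) \<le> r" for s
  proof -
    have "norm ((s - approx_zero m) * L_const) \<le> r * ?L" unfolding norm_mult using s by (intro mult_right_mono) auto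
    also have "\<dots> = 1 / 4" using L norm_L_bounds(3) by (simp add: r_def field_simps)
    finally have "norm ((s - approx_zero m) * L_const) / 2 \<le> norm (1 - exp ((s - approx_zero m) * L_const))" by (rule one_minus_exp_bounds)
    then show ?thesis by (simp only: f norm_mult)
  qed
  have "\<exists>z. {z \<in> ball (approx_zero m) r. Dnorm z = 0} = {z} \<and> zorder Dnorm z = 1"
  proof (rule rouche_unique_zero[where R="2 * r" and f="?f"])
    show "Dnorm holomorphic_on ball (approx_zero m) (2 * r)"
    proof (rule holomorphic_on_subset[OF Dnorm_holomorphic])
      show "ball (approx_zero m) (2 * r) \<subseteq> {s. Re s < 1}"
      proof
        fix s assume "s \<in> ball (approx_zero m) (2 * r)"
        then have "s \<in> ball (approx_zero m) 1" using r by auto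
        then show "s \<in> {s. Re s < 1}" using disc[of s] by auto
      qed
    qed
    show "?f holomorphic_on ball (approx_zero m) (2 * r)" by (intro holomorphic_intros)
    show "0 < r" "r < 2 * r" using r by auto
  next
    fix z assume "z \<in> sphere (approx_zero m) r"
    then have z: "norm (z - approx_zero m) = r" by (simp add: dist_norm norm_minus_commute)
    have "C * q powr (1 - Re z) \<le> 1 / 32" using disc[OF in1] z r by auto
    then have "norm (Dnorm z - ?f z) \<le> 1 / 16" using err[of z] z by simp
    moreover have "norm (z - approx_zero m) * ?L / 2 = 1 / 8" using z L norm_L_bounds(3) by (simp add: r_def)
    ultimately show "norm (Dnorm z - ?f z) < norm (?f z)" using low[of z] z by simp
  next
    fix z assume "z \<in> ball (approx_zero m) (2 * r)"
    then have z: "norm (z - approx_zero m) < 2 * r" by (simp add: dist_norm norm_minus_commute)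
    show "?f z = 0 \<longleftrightarrow> z = approx_zero m"
    proof
      assume "?f z = 0"
      then have "exp ((z - approx_zero m) * L_const) = exp 0" by (simp add: f)
      then obtain n :: int where n: "(z - approx_zero m) * L_const = 0 + of_int (2 * n) * pi * \<i>" using exp_eq by metis
      have "norm ((z - approx_zero m) * L_const) < 2 * r * ?L" unfolding norm_mult using z L by (intro mult_strict_right_mono) auto
      also have "\<dots> = 1 / 2" using L norm_L_bounds(3) by (simp add: r_def field_simps)
      finally have "2 * pi * \<bar>of_int n\<bar> < 1 / 2" unfolding n by (simp add: norm_mult mult.commute)
      then have "\<bar>real_of_int n\<bar> < 1" using pi_gt3 mult_right_mono[of 1 "2 * pi" "\<bar>real_of_int n\<bar>"] by linarith
      then have "n = 0" by linarith
      then show "z = approx_zero m" using n norm_L_bounds(3) by simp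
    next
      assume "z = approx_zero m" then show "?f z = 0" by (simp only: f) simp
    qed
  next
    have ana: "?f analytic_on {approx_zero m}" by (intro analytic_intros)
    have der: "(?f has_field_derivative - L_const) (at (approx_zero m))"
    proof -
      have "(?f has_field_derivative exp ((approx_zero m - 1) * L_const) * L_const) (at (approx_zero m))"
        by (auto intro!: derivative_eq_intros)
      then show ?thesis by (simp only: exp_approx_zero[of "approx_zero m" m]) simp
    qed
    show "zorder ?f (approx_zero m) = 1"
    proof (rule zorder_zero_eqI'[OF ana])
      show "(deriv ^^ i) ?f (approx_zero m) = 0" if "i < nat 1" for i using that by (simp add: f)
      show "(deriv ^^ nat 1) ?f (approx_zero m) \<noteq> 0" using DERIV_imp_deriv[OF der] norm_L_bounds(3) by simp
    qed simp
  qed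
  then obtain z where z: "{z \<in> ball (approx_zero m) r. Dnorm z = 0} = {z}" "zorder Dnorm z = 1" by blast
  have zr: "norm (z - approx_zero m) \<le> r" "Dnorm z = 0" using z(1) by (auto simp: dist_norm norm_minus_commute)
  \<comment> \<open>At the zero the model is as small as the error. Its linear lower bound turns
    this into an exponentially small distance.\<close>
  have "norm (z - approx_zero m) * ?L / 2 \<le> 2 * (C * q powr (1 - Re z))"
  proof -
    have "norm (Dnorm z - ?f z) = norm (?f z)" by (simp only: zr(2) diff_0 norm_minus_cancel)
    then show ?thesis using low[OF zr(1)] err[OF zr(1)] by linarith
  qed
  moreover have "norm (z - approx_zero m) * 1 \<le> norm (z - approx_zero m) * ?L" using L by (intro mult_left_mono) auto
  ultimately have "norm (z - approx_zero m) \<le> 4 * C * q powr (1 - Re z)" by simp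
  then show ?thesis using z unfolding r_def by blast
qed

text \<open>At a zero the exponential e is so close to -1 that the logarithm of -e has modulus at
  most 1/8. Comparing it with (s - \<open>approx_zero 0\<close>) L leaves a multiple of 2 pi i,
  whose integer selects the disc.\<close>

lemma zeros_near_approx_zero:
  assumes eps: "C * q powr (1 - Re s) \<le> 1 / 32" and z: "Dnorm s = 0"
    and asymp: "norm (Dnorm s - (1 + exp ((s - 1) * L_const))) \<le> C * q powr (1 - Re s) * max 1 (norm (exp ((s - 1) * L_const)))"
  shows "\<exists>m. s \<in> ball (approx_zero m) (1 / (4 * norm L_const))"
proof -
  define e where "e = exp ((s - 1) * L_const)"
  have a: "norm (1 + e) \<le> 1 / 32 * max 1 (norm e)"
  proof -
    have "norm (Dnorm s - (1 + e)) = norm (1 + e)" unfolding z using norm_minus_cancel[of "1 + e"] by simp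
    then have "norm (1 + e) \<le> C * q powr (1 - Re s) * max 1 (norm e)" using asymp unfolding e_def[symmetric] by simp
    also have "\<dots> \<le> 1 / 32 * max 1 (norm e)" using eps by (intro mult_right_mono) auto
    finally show ?thesis .
  qed
  have "norm e \<le> norm (1 + e) + 1" using norm_triangle_ineq4[of "1 + e" 1] by simp
  then have "norm e \<le> 2" using a by (auto simp: max_def split: if_splits)
  then have b: "norm (1 + e) \<le> 1 / 16" using a by (auto simp: max_def split: if_splits)
  define v where "v = Ln (1 + (- (1 + e)))"
  have v: "norm v \<le> 1 / 8" unfolding v_def
    using norm_Ln_le[of "- (1 + e)"] b by (simp only: norm_minus_cancel) linarith
  have "e \<noteq> 0" by (simp add: e_def)
  then have "exp v = - e" by (simp add: v_def)
  also have "- e = exp ((s - approx_zero 0) * L_const)" unfolding e_def by (simp add: exp_approx_zero[of s 0])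
  finally have "exp ((s - approx_zero 0) * L_const) = exp v" by simp
  then obtain n :: int where n: "(s - approx_zero 0) * L_const = v + of_int (2 * n) * pi * \<i>" using exp_eq by metis
  have "(s - approx_zero (- n)) * L_const = v"
    using n norm_L_bounds(3) by (simp add: approx_zero_def field_simps)
  then have "norm (s - approx_zero (- n)) * norm L_const \<le> 1 / 8" using v by (metis norm_mult)
  then have "norm (s - approx_zero (- n)) * (4 * norm L_const) < 1" by linarith
  then have "norm (s - approx_zero (- n)) < 1 / (4 * norm L_const)" using norm_L_bounds(3) by (subst pos_less_divide_eq) auto
  then show ?thesis by (intro exI[of _ "- n"]) (simp add: dist_norm norm_minus_commute)
qed

text \<open>Each disc of large index holds exactly one zero by \<open>zero_in_disc\<close>, and no
  zero far to the left in the closed lower half-plane lies outside all discs by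
  \<open>zeros_near_approx_zero\<close>.\<close>

theorem far_zeros:
  "\<exists>\<sigma>\<^sub>0 M \<rho> \<kappa> C. \<sigma>\<^sub>0 \<ge> 1 \<and> \<kappa> > 0 \<and> M \<ge> 0 \<and>
     (\<forall>s. D_fun s = 0 \<and> Re s \<le> - \<sigma>\<^sub>0 \<and> Im s \<le> 0 \<longrightarrow> (\<exists>m\<ge>M. s = \<rho> m)) \<and>
     (\<forall>m\<ge>M. D_fun (\<rho> m) = 0 \<and> Re (\<rho> m) \<le> - \<sigma>\<^sub>0 \<and> Im (\<rho> m) < 0 \<and> zorder D_fun (\<rho> m) = 1 \<and>
        norm (\<rho> m - approx_zero m) \<le> C * exp (- \<kappa> * of_int m) \<and> norm (\<rho> m - approx_zero m) < 1 / (4 * norm L_const))"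
proof -
  obtain C q where C: "C > 0" "0 < q" "q < 1" and asymp: "\<And>s. Re s \<le> -1 \<Longrightarrow> Im s \<le> 0 \<Longrightarrow>
     norm (Dnorm s - (1 + exp ((s - 1) * L_const))) \<le> C * q powr (1 - Re s) * max 1 (norm (exp ((s - 1) * L_const)))"
    using Dnorm_asymp by blast
  have "((\<lambda>x::real. C * q powr x) \<longlongrightarrow> C * 0) at_top"
    by (intro tendsto_intros) (use C in real_asymp)
  then have "eventually (\<lambda>x::real. C * q powr x < 1 / 32) at_top" by (rule order_tendstoD) simp
  then obtain X0 where X0: "\<And>x. x \<ge> X0 \<Longrightarrow> C * q powr x < 1 / 32" by (auto simp: eventually_at_top_linorder)
  \<comment> \<open>The lower bound 2 turns 1 - Re s \<ge> X into Re s \<le> -1, where the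
    asymptotics hold.\<close>
  define X where "X = max X0 2"
  have X: "C * q powr x \<le> 1 / 32" if "x \<ge> X" for x using X0[of x] that by (auto simp: X_def)
  have X2: "X \<ge> 2" by (simp add: X_def)
  define \<gamma> where "\<gamma> = pi * ln (pi / ln 2) / (norm L_const)\<^sup>2"
  have \<gamma>: "\<gamma> > 0" using ln_pi_pos norm_L_bounds(3) by (simp add: \<gamma>_def)
  \<comment> \<open>The first ceiling pushes the unit disc around \<open>approx_zero m\<close> into
    1 - Re s \<ge> X, the 1 in X + 1 paying for its radius. The second pushes it below the real
    axis, since \<open>approx_zero m\<close> has imaginary part -(2m+1)
    \<open>\<gamma>\<close>.\<close>
  define M where "M = max 0 (max \<lceil>(X + 1) / spacing\<rceil> \<lceil>1 / \<gamma>\<rceil>)"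
  define r where "r = 1 / (4 * norm L_const)"
  have r: "0 < r" "r < 1" "r < spacing / 2" using radius_bounds spacing_pos(2) by (auto simp: r_def)
  have far: "X \<le> 1 - Re s \<and> Im s < 0" if s: "s \<in> ball (approx_zero m) 1" and m: "m \<ge> M" for m s
  proof -
    have d: "norm (s - approx_zero m) < 1" using s by (simp add: dist_norm norm_minus_commute)
    have m0: "real_of_int m \<ge> 0" using m by (simp add: M_def)
    have "(X + 1) / spacing \<le> of_int m" using m by (simp add: M_def ceiling_le_iff)
    then have "X + 1 \<le> of_int m * spacing" using spacing_pos(1) by (simp add: field_simps)
    moreover have "Re (s - approx_zero m) < 1" using complex_Re_le_cmod[of "s - approx_zero m"] d by linarith
    ultimately have "X \<le> 1 - Re s" using spacing_pos(1) by (simp add: approx_zero_Re_Im ring_distribs)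
    have "1 / \<gamma> \<le> of_int m" using m by (simp add: M_def ceiling_le_iff)
    then have "1 \<le> of_int m * \<gamma>" using \<gamma> by (simp add: field_simps)
    moreover have "of_int m * \<gamma> \<le> (2 * of_int m + 1) * \<gamma>" using \<gamma> m0 by (intro mult_right_mono) auto
    ultimately have "1 \<le> (2 * of_int m + 1) * \<gamma>" by linarith
    have "X \<le> 1 - Re s" by fact
    moreover have "1 \<le> (2 * of_int m + 1) * \<gamma>" by fact
    moreover have "Im (s - approx_zero m) < 1" using abs_Im_le_cmod[of "s - approx_zero m"] d by linarith
    moreover have "Im (approx_zero m) = - ((2 * of_int m + 1) * \<gamma>)" by (simp only: approx_zero_Re_Im \<gamma>_def mult_minus_left)
    ultimately show ?thesis unfolding minus_complex.sel by linarith
  qed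
  have disc: "Re s \<le> -1 \<and> Im s \<le> 0 \<and> C * q powr (1 - Re s) \<le> 1 / 32" if "s \<in> ball (approx_zero m) 1" "m \<ge> M" for m s
    using far[OF that] X2 X[of "1 - Re s"] by linarith
  define P where "P = (\<lambda>m z. {z \<in> ball (approx_zero m) r. Dnorm z = 0} = {z} \<and> zorder Dnorm z = 1 \<and>
     norm (z - approx_zero m) \<le> 4 * C * q powr (1 - Re z))"
  have "\<exists>z. P m z" if "m \<ge> M" for m
    unfolding r_def P_def by (rule zero_in_disc[OF C asymp]) (use disc that in auto)
  then have "\<forall>m\<in>{M..}. \<exists>z. P m z" by simp
  from bchoice[OF this] obtain \<rho> where "\<forall>m\<in>{M..}. P m (\<rho> m)" by blast
  then have \<rho>: "{z \<in> ball (approx_zero m) r. Dnorm z = 0} = {\<rho> m} \<and> zorder Dnorm (\<rho> m) = 1 \<and>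
     norm (\<rho> m - approx_zero m) \<le> 4 * C * q powr (1 - Re (\<rho> m))" if "m \<ge> M" for m
    using that unfolding P_def by simp
  \<comment> \<open>The line \<open>Re s = - \<sigma>\<^sub>0\<close> runs midway between two of the discs, so that it separates them.\<close>
  define \<sigma>\<^sub>0 where "\<sigma>\<^sub>0 = - (Re (approx_zero M) + spacing / 2)"
  \<comment> \<open>The real parts move left by \<open>spacing\<close> per index, so the error q^(1
    - Re s) becomes exp(-\<open>\<kappa>\<close> m) up to a constant.\<close>
  define \<kappa> where "\<kappa> = - ln q * spacing"
  have \<kappa>: "\<kappa> > 0" using C spacing_pos(1) unfolding \<kappa>_def by (intro mult_pos_pos) auto
  have \<sigma>: "\<sigma>\<^sub>0 = of_int M * spacing - 1" by (simp add: \<sigma>\<^sub>0_def approx_zero_Re_Im ring_distribs)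
  have "\<lceil>(X + 1) / spacing\<rceil> \<le> M" by (simp add: M_def)
  then have "(X + 1) / spacing \<le> of_int M" by (simp only: ceiling_le_iff)
  then have \<sigma>X: "\<sigma>\<^sub>0 \<ge> X" using spacing_pos(1) by (simp add: field_simps \<sigma>)
  have Re_near: "\<bar>Re s - Re (approx_zero m)\<bar> < r" if "s \<in> ball (approx_zero m) r" for s m
    using that abs_Re_le_cmod[of "s - approx_zero m"] by (simp add: dist_norm norm_minus_commute)
  have A: "\<exists>m\<ge>M. s = \<rho> m" if s: "D_fun s = 0" "Re s \<le> - \<sigma>\<^sub>0" "Im s \<le> 0" for s
  proof -
    have s1: "Re s \<le> -1" "X \<le> 1 - Re s" using s \<sigma>X X2 by auto
    have D0: "Dnorm s = 0" using s(1) s1 Dnorm_eq_0_iff[of s] by simp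
    obtain m where m: "s \<in> ball (approx_zero m) r"
      using zeros_near_approx_zero[OF X[OF s1(2)] D0 asymp[OF s1(1) s(3)]] unfolding r_def by blast
    have "m \<ge> M"
    proof (rule ccontr)
      assume "\<not> m \<ge> M"
      then have "real_of_int m + 1 \<le> of_int M" by linarith
      then have "(real_of_int m + 1) * spacing \<le> of_int M * spacing" using spacing_pos(1) by (intro mult_right_mono) auto
      then show False using Re_near[OF m] s(2) r spacing_pos(1) by (simp add: \<sigma> approx_zero_Re_Im ring_distribs abs_less_iff)
    qed
    moreover from this have "s = \<rho> m" using \<rho>[of m] m D0 by blast
    ultimately show ?thesis by blast
  qed
  have B: "D_fun (\<rho> m) = 0 \<and> Re (\<rho> m) \<le> - \<sigma>\<^sub>0 \<and> Im (\<rho> m) < 0 \<and> zorder D_fun (\<rho> m) = 1 \<and>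
        norm (\<rho> m - approx_zero m) \<le> (4 * C * q powr (-1)) * exp (- \<kappa> * of_int m) \<and> norm (\<rho> m - approx_zero m) < r" if m: "m \<ge> M" for m
  proof -
    have b: "\<rho> m \<in> ball (approx_zero m) r" "Dnorm (\<rho> m) = 0" using \<rho>[OF m] by blast+
    then have b1: "\<rho> m \<in> ball (approx_zero m) 1" using r by auto
    have lt: "Re (\<rho> m) < 1" using far[OF b1 m] X2 by linarith
    have D0: "D_fun (\<rho> m) = 0" using b(2) lt Dnorm_eq_0_iff by blast
    have "real_of_int M * spacing \<le> of_int m * spacing" using m spacing_pos(1) by (intro mult_right_mono) auto
    moreover have "Re (approx_zero m) = 1 - of_int m * spacing - spacing / 2" by (simp add: approx_zero_Re_Im ring_distribs)
    ultimately have Re: "Re (\<rho> m) \<le> - \<sigma>\<^sub>0"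
      using Re_near[OF b(1)] r unfolding \<sigma> by linarith
    \<comment> \<open>Two distinct points of a disc that contains a single zero cannot both be
      zeros.\<close>
    have pt: "\<exists>w. Re w < 1 \<and> Dnorm w \<noteq> 0"
    proof -
      define w where "w = approx_zero m + of_real (r / 2)"
      have w: "w \<in> ball (approx_zero m) r" "w \<noteq> approx_zero m" using r by (auto simp: w_def dist_norm)
      have c: "approx_zero m \<in> ball (approx_zero m) r" using r by simp
      have "Dnorm w \<noteq> 0 \<or> Dnorm (approx_zero m) \<noteq> 0"
      proof (rule ccontr)
        assume "\<not> ?thesis"
        then have "w = \<rho> m" "approx_zero m = \<rho> m" using \<rho>[OF m] w(1) c by blast+
        then show False using w by simp
      qed
      moreover have "Re w < 1" "Re (approx_zero m) < 1"
        using far[of w m] far[of "approx_zero m" m] w(1) c r m X2 by auto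
      ultimately show ?thesis by blast
    qed
    have "zorder D_fun (\<rho> m) = 1" using zorder_D_fun[OF lt _ D0 pt] \<rho>[OF m] by blast
    moreover have "norm (\<rho> m - approx_zero m) \<le> (4 * C * q powr (-1)) * exp (- \<kappa> * of_int m)"
    proof -
      have "Re (\<rho> m) \<le> Re (approx_zero m) + r" using Re_near[OF b(1)] by linarith
      then have ge: "of_int m * spacing + - 1 \<le> 1 - Re (\<rho> m)"
        using r spacing_pos(1) by (simp add: approx_zero_Re_Im ring_distribs)
      have "norm (\<rho> m - approx_zero m) \<le> 4 * C * q powr (1 - Re (\<rho> m))" using \<rho>[OF m] by blast
      also have "\<dots> \<le> 4 * C * q powr (of_int m * spacing + - 1)"
        using ge C by (intro mult_left_mono powr_mono') auto
      also have "q powr (of_int m * spacing + - 1) = q powr (of_int m * spacing) * q powr (-1)"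
        by (rule powr_add)
      also have "q powr (of_int m * spacing) = exp (- \<kappa> * of_int m)"
        using C by (simp add: powr_def \<kappa>_def mult_ac)
      finally show ?thesis by (simp add: mult_ac)
    qed
    ultimately show ?thesis using D0 Re far[OF b1 m] b(1) by (simp add: dist_norm norm_minus_commute)
  qed
  show ?thesis
    using A B \<kappa> \<sigma>X X2 unfolding r_def
    by (intro exI[of _ \<sigma>\<^sub>0] exI[of _ M] exI[of _ \<rho>] exI[of _ \<kappa>] exI[of _ "4 * C * q powr (-1)"]) (auto simp: M_def)
qed

section \<open>Mertens' inequality and partial sums of the zeta function\<close>

text \<open>The trigonometric inequality 3 + 4 cos x + cos 2x = 2 (1 + cos x)^2 \<ge> 0.\<close>

lemma Re_unit_nonneg:
  fixes u :: complex
  assumes "norm u = 1"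
  shows "3 + 4 * Re u + Re (u\<^sup>2) \<ge> 0"
proof -
  have "(Re u)\<^sup>2 + (Im u)\<^sup>2 = 1" using assms by (metis cmod_power2 one_power2)
  then have "3 + 4 * Re u + Re (u\<^sup>2) = 2 * (1 + Re u)\<^sup>2"
    by (simp add: power2_eq_square algebra_simps)
  then show ?thesis by simp
qed

lemma ln_norm_one_minus:
  assumes "norm z < 1"
  shows "(\<lambda>n. - Re (z ^ n) / real n) sums ln (norm (1 - z))"
proof -
  have "(\<lambda>n. - ((- (- z)) ^ n) / of_nat n) sums ln (1 + (- z))"
    by (rule Ln_series') (use assms in simp)
  then have "(\<lambda>n. Re (- (z ^ n) / of_nat n)) sums Re (ln (1 - z))"
    by (intro sums_Re) simp
  moreover have "1 - z \<noteq> 0" using assms by auto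
  ultimately show ?thesis by (simp add: Re_divide_of_nat)
qed

text \<open>The 3-4-1 inequality for one Euler factor, with r = p^(-\<sigma>) and w = p^(-it): in
  the logarithm series the n-th term is -r^n / n times the nonnegative quantity of
  \<open>Re_unit_nonneg\<close> at w^n.\<close>

lemma mertens_local:
  fixes w :: complex
  assumes r: "0 \<le> r" "r < 1" and w: "norm w = 1"
  shows "norm (1 - complex_of_real r) ^ 3 * norm (1 - of_real r * w) ^ 4 * norm (1 - of_real r * w\<^sup>2) \<le> 1"
proof -
  have n: "norm (complex_of_real r) < 1" "norm (of_real r * w) < 1" "norm (of_real r * w\<^sup>2) < 1"
    using r w by (auto simp: norm_mult norm_power)
  have nz: "norm (1 - z) > 0" if "norm z < 1" for z :: complex using that by auto
  let ?f = "\<lambda>n. 3 * (- Re (complex_of_real r ^ n) / real n) + 4 * (- Re ((of_real r * w) ^ n) / real n) + (- Re ((of_real r * w\<^sup>2) ^ n) / real n)"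
  have s: "?f sums (3 * ln (norm (1 - complex_of_real r)) + 4 * ln (norm (1 - of_real r * w)) + ln (norm (1 - of_real r * w\<^sup>2)))"
    by (intro sums_add sums_mult ln_norm_one_minus n)
  have "?f n \<le> 0" for n
  proof -
    have "?f n = - (r ^ n * (3 + 4 * Re (w ^ n) + Re ((w ^ n)\<^sup>2))) / real n"
    proof -
      have 1: "Re (complex_of_real r ^ n) = r ^ n" by (simp flip: of_real_power)
      have 2: "Re ((of_real r * w) ^ n) = r ^ n * Re (w ^ n)" by (simp add: power_mult_distrib flip: of_real_power)
      have "(w\<^sup>2) ^ n = (w ^ n)\<^sup>2" by (simp add: mult.commute flip: power_mult)
      then have 3: "Re ((of_real r * w\<^sup>2) ^ n) = r ^ n * Re ((w ^ n)\<^sup>2)"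
        unfolding power_mult_distrib by (simp flip: of_real_power)
      show ?thesis unfolding 1 2 3 divide_inverse by (simp add: algebra_simps)
    qed
    moreover have "3 + 4 * Re (w ^ n) + Re ((w ^ n)\<^sup>2) \<ge> 0"
      by (rule Re_unit_nonneg) (simp add: norm_power w)
    ultimately show ?thesis using r by simp
  qed
  then have "3 * ln (norm (1 - complex_of_real r)) + 4 * ln (norm (1 - of_real r * w)) + ln (norm (1 - of_real r * w\<^sup>2)) \<le> 0"
    by (rule sums_le[OF _ s sums_zero])
  also have "3 * ln (norm (1 - complex_of_real r)) + 4 * ln (norm (1 - of_real r * w)) + ln (norm (1 - of_real r * w\<^sup>2)) = 
     ln (norm (1 - complex_of_real r) ^ 3 * norm (1 - of_real r * w) ^ 4 * norm (1 - of_real r * w\<^sup>2))"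
    using nz[OF n(1)] nz[OF n(2)] nz[OF n(3)] by (simp add: ln_mult ln_realpow)
  finally show ?thesis
    using nz[OF n(1)] nz[OF n(2)] nz[OF n(3)] by (subst (asm) ln_le_zero_iff) auto
qed

section \<open>Euler factors by sieving with finitely many primes\<close>

definition coprimes :: "nat set \<Rightarrow> nat set" where
  "coprimes P = {n. n > 0 \<and> (\<forall>p\<in>P. \<not> p dvd n)}"

lemma npowr_summable:
  assumes "Re s > 1" shows "(\<lambda>n. of_nat n powr (-s)) summable_on (A :: nat set)" and "(\<lambda>n. real n powr (- Re s)) summable_on A"
proof -
  have "summable (\<lambda>n. real n powr (- Re s))" using assms by (simp add: summable_real_powr_iff)
  then have 1: "(\<lambda>n. real n powr (- Re s)) summable_on UNIV" by (subst summable_on_nat_iff_nonneg) auto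
  have 2: "(\<lambda>n. of_nat n powr (-s)) summable_on (UNIV :: nat set)"
    by (rule infsum_norm_le(1)[OF _ 1]) (simp add: norm_powr_real_powr)
  show "(\<lambda>n. of_nat n powr (-s)) summable_on A" by (rule summable_on_subset[OF 2]) auto
  show "(\<lambda>n. real n powr (- Re s)) summable_on A" by (rule summable_on_subset[OF 1]) auto
qed

lemma zeta_coprimes_empty:
  assumes "Re s > 1" shows "(\<Sum>\<^sub>\<infinity>n\<in>coprimes {}. of_nat n powr (-s)) = zeta s"
proof -
  have "coprimes {} = range Suc" by (auto simp: coprimes_def image_def gr0_conv_Suc)
  moreover have "(\<Sum>\<^sub>\<infinity>n\<in>range Suc. of_nat n powr (-s)) = (\<Sum>\<^sub>\<infinity>n. of_nat (Suc n) powr (-s))"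
    by (subst infsum_reindex) (auto simp: o_def)
  moreover have "(\<Sum>\<^sub>\<infinity>n. of_nat (Suc n) powr (-s)) = zeta s"
    using has_sum_imp_sums[OF dseries_has_sum[OF assms]] zeta_properties(2)[OF assms] sums_unique2
    unfolding dseries_def by blast
  ultimately show ?thesis by simp
qed

text \<open>Among the integers that survive the sieve by \<open>P\<close>, the multiples of the new
  prime \<open>p\<close> are exactly \<open>p\<close> times the survivors, so removing them
  multiplies the sum by 1 - p^(-s).\<close>

lemma coprimes_insert:
  assumes s: "Re s > 1" and p: "prime p" and P: "\<And>q. q \<in> P \<Longrightarrow> prime q" "p \<notin> P"
  shows "(\<Sum>\<^sub>\<infinity>n\<in>coprimes (insert p P). of_nat n powr (-s)) = (1 - of_nat p powr (-s)) * (\<Sum>\<^sub>\<infinity>n\<in>coprimes P. of_nat n powr (-s))"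
proof -
  let ?f = "\<lambda>n::nat. of_nat n powr (-s) :: complex"
  have im: "(\<lambda>m. p * m) ` coprimes P = {n \<in> coprimes P. p dvd n}"
  proof -
    have "p * m \<in> coprimes P \<longleftrightarrow> m \<in> coprimes P" for m
    proof -
      have "q dvd p * m \<longleftrightarrow> q dvd m" if "q \<in> P" for q
        using P that p by (metis prime_dvd_mult_iff primes_dvd_imp_eq)
      then show ?thesis using p prime_gt_0_nat by (auto simp: coprimes_def)
    qed
    then show ?thesis by (auto simp: image_iff elim!: dvdE)
  qed
  have un: "coprimes P = coprimes (insert p P) \<union> {n \<in> coprimes P. p dvd n}" by (auto simp: coprimes_def)
  have "infsum ?f (coprimes P) = infsum ?f (coprimes (insert p P)) + infsum ?f {n \<in> coprimes P. p dvd n}"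
    by (subst un, rule infsum_Un_disjoint) (auto intro: npowr_summable s simp: coprimes_def)
  also have "infsum ?f {n \<in> coprimes P. p dvd n} = infsum (\<lambda>m. ?f (p * m)) (coprimes P)"
    unfolding im[symmetric] by (subst infsum_reindex) (use prime_gt_0_nat[OF p] in \<open>auto simp: o_def inj_on_def\<close>)
  also have "(\<lambda>m. ?f (p * m)) = (\<lambda>m. of_nat p powr (-s) * ?f m)"
    using powr_times_real[of "of_nat p" "of_nat _" "-s"] by auto
  also have "infsum (\<lambda>m. of_nat p powr (-s) * ?f m) (coprimes P) = of_nat p powr (-s) * infsum ?f (coprimes P)"
    by (rule infsum_cmult_right')
  finally show ?thesis by (simp add: algebra_simps)
qed

lemma euler_product_partial:
  assumes s: "Re s > 1" and P: "finite P" "\<And>q. q \<in> P \<Longrightarrow> prime q"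
  shows "(\<Sum>\<^sub>\<infinity>n\<in>coprimes P. of_nat n powr (-s)) = (\<Prod>p\<in>P. 1 - of_nat p powr (-s)) * zeta s"
  using P
proof (induction P rule: finite_induct)
  case empty
  then show ?case using zeta_coprimes_empty[OF s] by simp
next
  case (insert p P)
  then show ?case using coprimes_insert[OF s, of p P] by simp
qed

definition primes_upto :: "nat \<Rightarrow> nat set" where "primes_upto N = {p. prime p \<and> p \<le> N}"

lemma coprimes_limit:
  assumes s: "Re s > 1"
  shows "(\<lambda>N. \<Sum>\<^sub>\<infinity>n\<in>coprimes (primes_upto N). of_nat n powr (-s)) \<longlonglongrightarrow> (1::complex)"
proof -
  have "(\<lambda>N. \<Sum>\<^sub>\<infinity>n. if n \<in> coprimes (primes_upto N) then of_nat n powr (-s) else 0) \<longlonglongrightarrow> (\<Sum>\<^sub>\<infinity>n::nat. if n = 1 then 1 else 0 :: complex)"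
  proof (rule infsum_tannery[where M="\<lambda>n. real n powr (- Re s)"])
    fix n :: nat
    consider "n = 0" | "n = 1" | "n > 1" by linarith
    then show "(\<lambda>N. if n \<in> coprimes (primes_upto N) then of_nat n powr (-s) else 0 :: complex) \<longlonglongrightarrow> (if n = 1 then 1 else 0)"
    proof cases
      case 1
      then show ?thesis by (simp add: coprimes_def)
    next
      case 2
      then have "n \<in> coprimes (primes_upto N)" for N by (auto simp: coprimes_def primes_upto_def)
      then show ?thesis using 2 by simp
    next
      case 3
      obtain p where p: "prime p" "p dvd n" using prime_factor_nat[of n] 3 by auto
      have "p \<le> n" using p 3 by (intro dvd_imp_le) auto
      then have "n \<notin> coprimes (primes_upto N)" if "N \<ge> n" for N
        using p that by (auto simp: coprimes_def primes_upto_def)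
      then have "eventually (\<lambda>N. (if n \<in> coprimes (primes_upto N) then of_nat n powr (-s) else 0 :: complex) = 0) sequentially"
        by (intro eventually_sequentiallyI[of n]) simp
      then show ?thesis using 3 by (simp add: tendsto_eventually)
    qed
  qed (use npowr_summable(2)[OF s] in \<open>auto simp: norm_powr_real_powr intro!: always_eventually\<close>)
  also have "(\<lambda>N. \<Sum>\<^sub>\<infinity>n. if n \<in> coprimes (primes_upto N) then of_nat n powr (-s) else 0) = (\<lambda>N. \<Sum>\<^sub>\<infinity>n\<in>coprimes (primes_upto N). of_nat n powr (-s) :: complex)"
    by (intro ext infsum_cong_neutral) auto
  also have "(\<Sum>\<^sub>\<infinity>n::nat. if n = 1 then 1 else 0 :: complex) = 1"
    by (subst infsum_cong_neutral[where T="{1}" and g="\<lambda>_. 1"]) auto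
  finally show ?thesis .
qed

text \<open>After sieving by the primes up to N, the 3-4-1 product of sums is the one for zeta times
  finitely many local factors, each at most 1. The sieved sums tend to 1 because only the integer 1
  survives all primes.\<close>

theorem mertens_inequality:
  assumes \<sigma>: "\<sigma> > 1"
  shows "norm (zeta (of_real \<sigma>)) ^ 3 * norm (zeta (Complex \<sigma> t)) ^ 4 * norm (zeta (Complex \<sigma> (2 * t))) \<ge> 1"
proof -
  let ?s0 = "complex_of_real \<sigma>" and ?s1 = "Complex \<sigma> t" and ?s2 = "Complex \<sigma> (2 * t)"
  let ?Z = "\<lambda>N s. \<Sum>\<^sub>\<infinity>n\<in>coprimes (primes_upto N). of_nat n powr (-s) :: complex"
  have R: "Re ?s0 > 1" "Re ?s1 > 1" "Re ?s2 > 1" using \<sigma> by auto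
  have fin: "finite (primes_upto N)" for N by (rule finite_subset[of _ "{..N}"]) (auto simp: primes_upto_def)
  have ep: "?Z N s = (\<Prod>p\<in>primes_upto N. 1 - of_nat p powr (-s)) * zeta s" if "Re s > 1" for N s
    by (rule euler_product_partial[OF that fin]) (auto simp: primes_upto_def)
  have "norm (?Z N ?s0) ^ 3 * norm (?Z N ?s1) ^ 4 * norm (?Z N ?s2) \<le> norm (zeta ?s0) ^ 3 * norm (zeta ?s1) ^ 4 * norm (zeta ?s2)" for N
  proof -
    let ?g = "\<lambda>p. norm (1 - of_nat p powr (-?s0) :: complex) ^ 3 * norm (1 - of_nat p powr (-?s1) :: complex) ^ 4 * norm (1 - of_nat p powr (-?s2) :: complex)"
    have "?g p \<le> 1" if "p \<in> primes_upto N" for p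
    proof -
      have p: "p \<ge> 2" using that prime_ge_2_nat by (auto simp: primes_upto_def)
      define r where "r = real p powr (- \<sigma>)"
      define w where "w = (of_nat p :: complex) powr (- (\<i> * of_real t))"
      have "real p powr (- \<sigma>) < real p powr 0" using p \<sigma> by (intro powr_less_mono) auto
      then have r: "0 \<le> r" "r < 1" using p by (auto simp: r_def)
      have w: "norm w = 1" unfolding w_def using p by (subst norm_powr_real_powr) auto
      have 0: "of_nat p powr (-?s0) = complex_of_real r" unfolding r_def using powr_of_real[of "real p" "-\<sigma>"] by simp
      have c1: "- ?s1 = - ?s0 + - (\<i> * of_real t)" by (simp add: complex_eq_iff)
      have c2: "- ?s2 = - ?s0 + (- (\<i> * of_real t) + - (\<i> * of_real t))" by (simp add: complex_eq_iff)
      have 1: "of_nat p powr (-?s1) = of_real r * w" unfolding c1 powr_add 0 w_def ..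
      have 2: "of_nat p powr (-?s2) = of_real r * w\<^sup>2" unfolding c2 powr_add 0 w_def power2_eq_square ..
      show ?thesis unfolding 0 1 2 by (rule mertens_local[OF r w])
    qed
    then have "(\<Prod>p\<in>primes_upto N. ?g p) \<le> 1" by (intro prod_le_1) auto
    then have "(\<Prod>p\<in>primes_upto N. ?g p) * (norm (zeta ?s0) ^ 3 * norm (zeta ?s1) ^ 4 * norm (zeta ?s2)) \<le> 1 * (norm (zeta ?s0) ^ 3 * norm (zeta ?s1) ^ 4 * norm (zeta ?s2))"
      by (intro mult_right_mono) auto
    moreover have "norm (?Z N ?s0) ^ 3 * norm (?Z N ?s1) ^ 4 * norm (?Z N ?s2) = (\<Prod>p\<in>primes_upto N. ?g p) * (norm (zeta ?s0) ^ 3 * norm (zeta ?s1) ^ 4 * norm (zeta ?s2))"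
      unfolding ep[OF R(1)] ep[OF R(2)] ep[OF R(3)] prod.distrib prod_power_distrib[symmetric] norm_mult prod_norm[symmetric] power_mult_distrib
      by (simp only: mult_ac)
    ultimately show ?thesis by simp
  qed
  moreover have "(\<lambda>N. norm (?Z N ?s0) ^ 3 * norm (?Z N ?s1) ^ 4 * norm (?Z N ?s2)) \<longlonglongrightarrow> norm (1::complex) ^ 3 * norm (1::complex) ^ 4 * norm (1::complex)"
    by (intro tendsto_intros coprimes_limit R)
  ultimately show ?thesis
    by (intro tendsto_upperbound[of _ "norm (1::complex) ^ 3 * norm (1::complex) ^ 4 * norm (1::complex)", simplified]) (auto intro!: always_eventually)
qed

text \<open>Compare each term of the tail with the integral of x^(-s) over [n, n+1]. The integrals
  telescope to N^(1-s)/(s-1), and the deviations sum to O(|s|/N). The bound does not deteriorate as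
  Re s approaches 1 away from the pole.\<close>

lemma zeta_partial_sum:
  assumes s: "Re s > 1" and N: "N \<ge> 1"
  shows "norm (zeta s - (\<Sum>n\<in>{1..<N}. of_nat n powr (-s))) \<le> 1 / norm (s - 1) + 2 * norm s / real N"
proof -
  have s1: "s \<noteq> 1" using s by auto
  \<comment> \<open>The deviation of n^(-s) from that integral, estimated by Taylor's formula for
    the antiderivative.\<close>
  define d where "d = (\<lambda>n::nat. of_nat n powr (-s) - (of_nat n powr (1 - s) - of_nat (Suc n) powr (1 - s)) / (s - 1) :: complex)"
  have db: "norm (d n) \<le> 2 * norm s * (1 / real n - 1 / real (Suc n))" if n: "n \<ge> 1" for n
  proof -
    define f where "f = (\<lambda>(i::nat) u::complex. if i = 0 then u powr (1 - s) / (1 - s) else if i = 1 then u powr (-s) else (-s) * u powr (-s - 1))"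
    let ?S = "closed_segment (of_nat n :: complex) (of_nat (Suc n))"
    have S: "u \<in> \<real> \<and> Re u \<ge> real n" if u: "u \<in> ?S" for u
    proof -
      obtain x where x: "0 \<le> x" "u = (1 - x) *\<^sub>R of_nat n + x *\<^sub>R of_nat (Suc n)" using u unfolding in_segment by blast
      then have "u = of_real (real n + x)" by (simp add: scaleR_conv_of_real algebra_simps)
      then show ?thesis using x(1) by simp
    qed
    then have nn: "u \<notin> \<real>\<^sub>\<le>\<^sub>0" if "u \<in> ?S" for u 
  proof -
    have "Re u > 0" using S[OF that] n by linarith
    then show ?thesis by (simp add: complex_nonpos_Reals_iff)
  qed
    have "norm (f 0 (of_nat (Suc n)) - (\<Sum>i\<le>(1::nat). f i (of_nat n) * (of_nat (Suc n) - of_nat n) ^ i / fact i)) \<le> (norm s * real n powr (-2)) * norm (of_nat (Suc n) - of_nat n :: complex) ^ Suc 1 / fact 1"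
    proof (rule complex_Taylor[where S="?S"])
      fix i :: nat and u assume u: "u \<in> ?S" "i \<le> 1"
      then consider "i = 0" | "i = 1" by linarith
      then show "(f i has_field_derivative f (Suc i) u) (at u within ?S)"
      proof cases
        case 1
        have "((\<lambda>u. u powr (1 - s) / (1 - s)) has_field_derivative u powr (-s)) (at u)"
          using nn[OF u(1)] s1 by (auto intro!: derivative_eq_intros)
        then show ?thesis using 1 by (auto simp: f_def has_field_derivative_at_within)
      next
        case 2
        have "((\<lambda>u. u powr (-s)) has_field_derivative (-s) * u powr (-s - 1)) (at u)"
          using nn[OF u(1)] by (auto intro!: derivative_eq_intros)
        then show ?thesis using 2 by (auto simp: f_def has_field_derivative_at_within)
      qed
    next
      fix u assume "u \<in> ?S"
      then have u: "u \<in> \<real>" "Re u \<ge> real n" using S by auto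
      have "norm (u powr (-s - 1)) = Re u powr (- Re s - 1)" using u n by (subst norm_powr_real_powr) auto
      also have "\<dots> \<le> Re u powr (-2)" using u n s by (intro powr_mono) auto
      also have "\<dots> \<le> real n powr (-2)" using u n by (intro powr_mono2') auto
      finally show "norm (f (Suc 1) u) \<le> norm s * real n powr (-2)"
        by (simp add: f_def norm_mult mult_left_mono)
    qed auto
    also have "f 0 (of_nat (Suc n)) - (\<Sum>i\<le>(1::nat). f i (of_nat n) * (of_nat (Suc n) - of_nat n) ^ i / fact i) = - d n"
    proof -
      have e: "x / (1 - s) = - (x / (s - 1))" for x by (metis minus_diff_eq minus_divide_right)
      show ?thesis by (simp add: f_def d_def e diff_divide_distrib)
    qed
    finally have A: "norm (d n) \<le> norm s * real n powr (-2)" by simp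
    \<comment> \<open>The majorant is put in telescoping form so that the tail sum is
      explicit.\<close>
    have B: "real n powr (-2) \<le> 2 * (1 / real n - 1 / real (Suc n))"
    proof -
      have p: "real n \<ge> 1" using n by simp
      then have "real n * (real n + 1) \<le> real n * (2 * real n)" by (intro mult_left_mono) auto
      then have "2 / (real n * (2 * real n)) \<le> 2 / (real n * (real n + 1))"
        using p by (intro divide_left_mono mult_pos_pos) auto
      moreover have "real n powr (-2) = 2 / (real n * (2 * real n))"
      proof -
        have "real n powr (-2) = 1 / real n powr 2" by (rule powr_minus_divide)
        moreover have "real n powr 2 = real n * real n" using p powr_numeral[of "real n" num.One] by (simp add: power2_eq_square)
        ultimately show ?thesis using p by simp
      qed
      moreover have "2 * (1 / real n - 1 / real (Suc n)) = 2 / (real n * (real n + 1))"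
        using p by (simp add: field_simps)
      ultimately show ?thesis by linarith
    qed
    show ?thesis using order_trans[OF A mult_left_mono[OF B norm_ge_zero[of s]]] by (simp only: mult_ac)
  qed
  have z: "(\<lambda>k. of_nat (k + N) powr (-s)) sums (zeta s - (\<Sum>n\<in>{1..<N}. of_nat n powr (-s)))"
  proof -
    have "(\<lambda>k. of_nat (Suc (k + (N - 1))) powr (-s)) sums (zeta s - (\<Sum>k<N-1. of_nat (Suc k) powr (-s)))"
      unfolding sums_iff_shift[of "\<lambda>k. of_nat (Suc k) powr (-s)" "N - 1"] using zeta_properties(2)[OF s] by simp
    moreover have "(\<Sum>k<N-1. of_nat (Suc k) powr (-s)) = (\<Sum>n\<in>{1..<N}. of_nat n powr (-s) :: complex)"
      by (rule sum.reindex_bij_witness[of _ "\<lambda>k. k - 1" Suc]) auto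
    ultimately show ?thesis using N by simp
  qed
  have lim: "(\<lambda>k. of_nat (k + N) powr (1 - s) :: complex) \<longlonglongrightarrow> 0"
  proof (rule tendsto_norm_zero_cancel)
    have "(\<lambda>k. real (k + N) powr (1 - Re s)) \<longlonglongrightarrow> 0" using s by real_asymp
    then show "(\<lambda>k. norm (of_nat (k + N) powr (1 - s) :: complex)) \<longlonglongrightarrow> 0"
      by (simp add: norm_powr_real_powr)
  qed
  have T: "(\<lambda>k. of_nat (k + N) powr (1 - s) - of_nat (Suc (k + N)) powr (1 - s) :: complex) sums (of_nat (0 + N) powr (1 - s) - 0)"
    using telescope_sums'[OF lim] by (simp only: add_Suc)
  have "(\<lambda>k. d (k + N)) sums ((zeta s - (\<Sum>n\<in>{1..<N}. of_nat n powr (-s))) - (of_nat (0 + N) powr (1 - s) - 0) / (s - 1))"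
    unfolding d_def by (rule sums_diff[OF z sums_divide[OF T]])
  then have ds: "(\<lambda>k. d (k + N)) sums ((zeta s - (\<Sum>n\<in>{1..<N}. of_nat n powr (-s))) - of_nat N powr (1 - s) / (s - 1))" by simp
  have "(\<lambda>k. 1 / real (k + N) - 1 / real (Suc k + N)) sums (1 / real (0 + N) - 0)"
    by (rule telescope_sums') real_asymp
  then have bs: "(\<lambda>k. 2 * norm s * (1 / real (k + N) - 1 / real (Suc (k + N)))) sums (2 * norm s * (1 / real N))"
    by (intro sums_mult) simp
  have "norm (suminf (\<lambda>k. d (k + N))) \<le> (\<Sum>k. 2 * norm s * (1 / real (k + N) - 1 / real (Suc (k + N))))"
    by (rule norm_suminf_le[OF db sums_summable[OF bs]]) (use N in auto)
  then have "norm ((zeta s - (\<Sum>n\<in>{1..<N}. of_nat n powr (-s))) - of_nat N powr (1 - s) / (s - 1)) \<le> 2 * norm s / real N"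
    using sums_unique[OF ds] sums_unique[OF bs] by simp
  moreover have "norm (of_nat N powr (1 - s) / (s - 1)) \<le> 1 / norm (s - 1)"
  proof -
    have "norm (of_nat N powr (1 - s) :: complex) = real N powr (1 - Re s)" by (subst norm_powr_real_powr) auto
    also have "\<dots> \<le> real N powr 0" using N s by (intro powr_mono) auto
    finally show ?thesis using N unfolding norm_divide by (intro divide_right_mono) auto
  qed
  ultimately show ?thesis
    using norm_triangle_ineq[of "(zeta s - (\<Sum>n\<in>{1..<N}. of_nat n powr (-s))) - of_nat N powr (1 - s) / (s - 1)" "of_nat N powr (1 - s) / (s - 1)"] by simp
qed

section \<open>Finitely many zeros in a vertical strip\<close>

text \<open>Small powers replace logarithms: 1/n = n^(-65/64) n^(1/64) with the first factor
  summable. The exponents are small enough for the balance in \<open>zeta_lower\<close>, where N of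
  size t^2 doubles them.\<close>

lemma harmonic_bounds:
  obtains A :: real where "A > 0"
    "\<And>N. N \<ge> 1 \<Longrightarrow> (\<Sum>n\<in>{1..<N}. 1 / real n) \<le> A * real N powr (1/64)"
    "\<And>N. N \<ge> 1 \<Longrightarrow> (\<Sum>n\<in>{1..<N}. ln (real n) / real n) \<le> A * real N powr (1/32)"
proof -
  let ?g = "\<lambda>n. real n powr (-(65/64))"
  define B where "B = (\<Sum>n. ?g n)"
  have s: "summable ?g" by (simp add: summable_real_powr_iff)
  have part: "(\<Sum>n\<in>{1..<N}. ?g n) \<le> B" for N
    unfolding B_def by (rule sum_le_suminf[OF s]) auto
  have "?g 1 \<le> B" using part[of 2] by (simp add: numeral_2_eq_2)
  then have B: "B \<ge> 1" by simp
  have t1: "1 / real n = ?g n * real n powr (1/64)" if "n \<ge> 1" for n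
  proof -
    have "?g n * real n powr (1/64) = real n powr (-1)" by (simp only: powr_add[symmetric]) simp
    then show ?thesis using that by (simp add: powr_minus_divide)
  qed
  have h1: "(\<Sum>n\<in>{1..<N}. 1 / real n) \<le> B * real N powr (1/64)" for N
  proof -
    have "(\<Sum>n\<in>{1..<N}. 1 / real n) \<le> (\<Sum>n\<in>{1..<N}. ?g n * real N powr (1/64))"
    proof (rule sum_mono)
      fix n assume n: "n \<in> {1..<N}"
      then have "1 / real n = ?g n * real n powr (1/64)" by (intro t1) auto
      also have "\<dots> \<le> ?g n * real N powr (1/64)" using n by (intro mult_left_mono powr_mono2) auto
      finally show "1 / real n \<le> ?g n * real N powr (1/64)" .
    qed
    also have "\<dots> = (\<Sum>n\<in>{1..<N}. ?g n) * real N powr (1/64)" by (simp add: sum_distrib_right)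
    also have "\<dots> \<le> B * real N powr (1/64)" by (intro mult_right_mono part) auto
    finally show ?thesis .
  qed
  have h2: "(\<Sum>n\<in>{1..<N}. ln (real n) / real n) \<le> (64 * B) * real N powr (1/32)" for N
  proof -
    have "(\<Sum>n\<in>{1..<N}. ln (real n) / real n) \<le> (\<Sum>n\<in>{1..<N}. ?g n * (64 * real N powr (1/32)))"
    proof (rule sum_mono)
      fix n assume n: "n \<in> {1..<N}"
      have "ln (real n) \<le> real n powr (1/64) / (1/64)" using n by (intro ln_powr_bound) auto
      then have "ln (real n) / real n \<le> (64 * real n powr (1/64)) * (1 / real n)"
        using n by (simp add: divide_right_mono)
      also have "1 / real n = ?g n * real n powr (1/64)" using n by (intro t1) auto
      also have "(64 * real n powr (1/64)) * (?g n * real n powr (1/64)) = ?g n * (64 * (real n powr (1/64) * real n powr (1/64)))"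
        by (simp only: mult_ac)
      also have "real n powr (1/64) * real n powr (1/64) = real n powr (1/32)" by (simp flip: powr_add)
      also have "?g n * (64 * real n powr (1/32)) \<le> ?g n * (64 * real N powr (1/32))"
        using n by (intro mult_left_mono powr_mono2) auto
      finally show "ln (real n) / real n \<le> ?g n * (64 * real N powr (1/32))" .
    qed
    also have "\<dots> = (\<Sum>n\<in>{1..<N}. ?g n) * (64 * real N powr (1/32))" by (simp add: sum_distrib_right)
    also have "\<dots> \<le> B * (64 * real N powr (1/32))" by (intro mult_right_mono part) auto
    finally show ?thesis by (simp add: mult_ac)
  qed
  show ?thesis
  proof (rule that[of "64 * B"])
    show "(\<Sum>n\<in>{1..<N}. 1 / real n) \<le> 64 * B * real N powr (1/64)" for N
      by (rule order_trans[OF h1]) (use B in \<open>auto intro!: mult_right_mono\<close>)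
  qed (use h2 B in auto)
qed

lemma norm_npowr: "norm (of_nat n powr s :: complex) = real n powr Re s"
  by (subst norm_powr_real_powr) auto

text \<open>With N of size t^2 both error terms of \<open>zeta_partial_sum\<close> are O(1/t), and a
  power of N costs only twice the exponent in t.\<close>

lemma cutoff:
  fixes t :: real assumes t: "t \<ge> 1"
  obtains N :: nat where "N \<ge> 1" "t\<^sup>2 \<le> real N" "\<And>e. 0 \<le> e \<Longrightarrow> e \<le> 1 \<Longrightarrow> real N powr e \<le> 2 * t powr (2 * e)"
proof -
  define M where "M = nat \<lceil>t\<^sup>2\<rceil>"
  have t2: "t\<^sup>2 \<ge> 1" using t by (simp add: one_le_power)
  have N: "t\<^sup>2 \<le> real M" unfolding M_def by linarith
  have M1: "M \<ge> 1" using N t2 by linarith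
  have N2: "real M \<le> 2 * t\<^sup>2" unfolding M_def using t2 by linarith
  have "real M powr e \<le> 2 * t powr (2 * e)" if e: "0 \<le> e" "e \<le> 1" for e :: real
  proof -
    have "real M powr e \<le> (2 * t\<^sup>2) powr e" using N2 e by (intro powr_mono2) auto
    also have "\<dots> = 2 powr e * (t\<^sup>2) powr e" using t by (simp add: powr_mult)
    also have "(t\<^sup>2) powr e = t powr (2 * e)" using t by (simp add: powr_powr flip: powr_numeral)
    also have "2 powr e * t powr (2 * e) \<le> 2 powr 1 * t powr (2 * e)" using e by (intro mult_right_mono powr_mono) auto
    finally show ?thesis by simp
  qed
  with N M1 show ?thesis using that by blast
qed

lemma partial_sum_error:
  assumes t: "t \<ge> 1" and s: "Re s > 1" "Re s \<le> S" "Im s = t" and N: "t\<^sup>2 \<le> real N" "N \<ge> 1"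
  shows "norm (zeta s - (\<Sum>n\<in>{1..<N}. of_nat n powr (-s))) \<le> (2 * S + 3) / t"
proof -
  have "t \<le> norm (s - 1)" using abs_Im_le_cmod[of "s - 1"] s t by simp
  then have 1: "1 / norm (s - 1) \<le> 1 / t" using t by (intro divide_left_mono mult_pos_pos) auto
  have "norm s \<le> S + t" using cmod_le[of s] s t by simp
  also have "\<dots> \<le> (S + 1) * t" using mult_left_mono[of 1 t S] s t by (simp add: ring_distribs)
  finally have "2 * norm s / real N \<le> 2 * ((S + 1) * t) / t\<^sup>2"
    using N t s by (intro frac_le) auto
  also have "\<dots> = (2 * S + 2) / t" using t by (simp add: power2_eq_square field_simps)
  finally have "2 * norm s / real N \<le> (2 * S + 2) / t" .
  then show ?thesis using zeta_partial_sum[OF s(1) N(2)] 1 by (simp add: add_divide_distrib)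
qed

lemma zeta_upper:
  assumes S: "S \<ge> 2"
  shows "\<exists>C>0. \<forall>\<sigma> t. 1 < \<sigma> \<and> \<sigma> \<le> S \<and> t \<ge> 1 \<longrightarrow> norm (zeta (Complex \<sigma> t)) \<le> C * t powr (1/32)"
proof -
  obtain A where A: "A > 0" "\<And>N. N \<ge> 1 \<Longrightarrow> (\<Sum>n\<in>{1..<N}. 1 / real n) \<le> A * real N powr (1/64)"
    by (rule harmonic_bounds) blast
  have "norm (zeta (Complex \<sigma> t)) \<le> (2 * A + 2 * S + 3) * t powr (1/32)" if st: "1 < \<sigma>" "\<sigma> \<le> S" "t \<ge> 1" for \<sigma> t
  proof -
    obtain N :: nat where N: "N \<ge> 1" "t\<^sup>2 \<le> real N" "\<And>e. 0 \<le> e \<Longrightarrow> e \<le> 1 \<Longrightarrow> real N powr e \<le> 2 * t powr (2 * e)"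
      using cutoff[OF st(3)] by blast
    let ?s = "Complex \<sigma> t"
    have "norm (\<Sum>n\<in>{1..<N}. of_nat n powr (-?s) :: complex) \<le> (\<Sum>n\<in>{1..<N}. 1 / real n)"
    proof (rule sum_norm_le)
      fix n assume n: "n \<in> {1..<N}"
      have "norm (of_nat n powr (-?s) :: complex) = real n powr (- \<sigma>)" by (simp add: norm_npowr)
      also have "\<dots> \<le> real n powr (-1)" using n st by (intro powr_mono) auto
      also have "\<dots> = 1 / real n" using n by (simp add: powr_minus_divide)
      finally show "norm (of_nat n powr (-?s) :: complex) \<le> 1 / real n" .
    qed
    also have "\<dots> \<le> A * real N powr (1/64)" by (rule A(2)[OF N(1)])
    also have "\<dots> \<le> A * (2 * t powr (2 * (1/64)))" using A(1) N(3)[of "1/64"] by (intro mult_left_mono) auto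
    finally have 1: "norm (\<Sum>n\<in>{1..<N}. of_nat n powr (-?s) :: complex) \<le> 2 * A * t powr (1/32)" by simp
    have "norm (zeta ?s - (\<Sum>n\<in>{1..<N}. of_nat n powr (-?s))) \<le> (2 * S + 3) / t"
      by (rule partial_sum_error) (use st N in auto)
    also have "\<dots> \<le> (2 * S + 3) / 1" using st S by (intro divide_left_mono) auto
    also have "\<dots> \<le> (2 * S + 3) * t powr (1/32)" using st S mult_left_mono[of 1 "t powr (1/32)" "2 * S + 3"] by (simp add: ge_one_powr_ge_zero)
    finally have "norm (zeta ?s - (\<Sum>n\<in>{1..<N}. of_nat n powr (-?s))) \<le> (2 * S + 3) * t powr (1/32)" .
    then show ?thesis using 1 norm_triangle_sub[of "zeta ?s" "\<Sum>n\<in>{1..<N}. of_nat n powr (-?s)"] by (simp add: ring_distribs)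
  qed
  then show ?thesis using A(1) S by (intro exI[of _ "2 * A + 2 * S + 3"]) auto
qed

text \<open>Variation along a horizontal segment, read off from the partial sums by 0 \<le> 1 -
  n^(-d) \<le> d log n, without differentiating zeta.\<close>

lemma zeta_diff:
  assumes S: "S \<ge> 2"
  shows "\<exists>C>0. \<forall>\<sigma> \<sigma>' t. 1 < \<sigma> \<and> \<sigma> \<le> \<sigma>' \<and> \<sigma>' \<le> S \<and> t \<ge> 1 \<longrightarrow>
     norm (zeta (Complex \<sigma> t) - zeta (Complex \<sigma>' t)) \<le> C * ((\<sigma>' - \<sigma>) * t powr (1/16) + 1 / t)"
proof -
  obtain A where A: "A > 0" "\<And>N. N \<ge> 1 \<Longrightarrow> (\<Sum>n\<in>{1..<N}. ln (real n) / real n) \<le> A * real N powr (1/32)"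
    by (rule harmonic_bounds) blast
  define C where "C = 2 * A + 2 * (2 * S + 3)"
  have "norm (zeta (Complex \<sigma> t) - zeta (Complex \<sigma>' t)) \<le> C * ((\<sigma>' - \<sigma>) * t powr (1/16) + 1 / t)"
    if st: "1 < \<sigma>" "\<sigma> \<le> \<sigma>'" "\<sigma>' \<le> S" "t \<ge> 1" for \<sigma> \<sigma>' t
  proof -
    obtain N :: nat where N: "N \<ge> 1" "t\<^sup>2 \<le> real N" "\<And>e. 0 \<le> e \<Longrightarrow> e \<le> 1 \<Longrightarrow> real N powr e \<le> 2 * t powr (2 * e)"
      using cutoff[OF st(4)] by blast
    let ?s = "Complex \<sigma> t" and ?s' = "Complex \<sigma>' t" and ?d = "\<sigma>' - \<sigma>"
    let ?P = "\<lambda>s. \<Sum>n\<in>{1..<N}. of_nat n powr (-s) :: complex"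
    have "norm (?P ?s - ?P ?s') = norm (\<Sum>n\<in>{1..<N}. of_nat n powr (-?s) - of_nat n powr (-?s') :: complex)"
      by (simp add: sum_subtractf)
    also have "\<dots> \<le> (\<Sum>n\<in>{1..<N}. ?d * (ln (real n) / real n))"
    proof (rule sum_norm_le)
      fix n assume n: "n \<in> {1..<N}"
      have e: "- ?s' = - ?s + of_real (- ?d)" by (simp add: complex_eq_iff)
      have "of_nat n powr (-?s') = of_nat n powr (-?s) * complex_of_real (real n powr (- ?d))"
        unfolding e powr_add using powr_of_real[of "real n" "- ?d"] by simp
      then have "of_nat n powr (-?s) - of_nat n powr (-?s') = of_nat n powr (-?s) * complex_of_real (1 - real n powr (- ?d))"
        by (simp add: algebra_simps)
      then have "norm (of_nat n powr (-?s) - of_nat n powr (-?s') :: complex) = real n powr (- \<sigma>) * \<bar>1 - real n powr (- ?d)\<bar>"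
        by (simp only: norm_mult norm_npowr norm_of_real) simp
      also have "\<dots> \<le> (1 / real n) * (?d * ln (real n))"
      proof (intro mult_mono)
        have "real n powr (- \<sigma>) \<le> real n powr (-1)" using n st by (intro powr_mono) auto
        then show "real n powr (- \<sigma>) \<le> 1 / real n" using n by (simp add: powr_minus_divide)
        have "real n powr (- ?d) \<le> real n powr 0" using n st by (intro powr_mono) auto
        moreover have "1 + - ?d * ln (real n) \<le> real n powr (- ?d)"
          using n exp_ge_add_one_self[of "- ?d * ln (real n)"] by (simp add: powr_def)
        moreover have "real n powr 0 = 1" using n by simp
        ultimately have "0 \<le> 1 - real n powr (- ?d)" "1 - real n powr (- ?d) \<le> ?d * ln (real n)" by linarith+
        then show "\<bar>1 - real n powr (- ?d)\<bar> \<le> ?d * ln (real n)" by (simp only: abs_of_nonneg)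
      qed auto
      finally show "norm (of_nat n powr (-?s) - of_nat n powr (-?s') :: complex) \<le> ?d * (ln (real n) / real n)" by simp
    qed
    also have "\<dots> = ?d * (\<Sum>n\<in>{1..<N}. ln (real n) / real n)" by (simp only: sum_distrib_left)
    also have "\<dots> \<le> ?d * (A * (2 * t powr (2 * (1/32))))"
    proof (intro mult_left_mono)
      have "A * real N powr (1/32) \<le> A * (2 * t powr (2 * (1/32)))" using A(1) N(3)[of "1/32"] by (intro mult_left_mono) auto
      then show "(\<Sum>n\<in>{1..<N}. ln (real n) / real n) \<le> A * (2 * t powr (2 * (1/32)))" using A(2)[OF N(1)] by linarith
    qed (use st in auto)
    finally have 1: "norm (?P ?s - ?P ?s') \<le> (2 * A) * (?d * t powr (1/16))" by (simp add: mult_ac)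
    have 2: "norm (zeta ?s - ?P ?s) \<le> (2 * S + 3) / t" by (rule partial_sum_error) (use st N in auto)
    have 3: "norm (zeta ?s' - ?P ?s') \<le> (2 * S + 3) / t" by (rule partial_sum_error) (use st N in auto)
    have "zeta ?s - zeta ?s' = (zeta ?s - ?P ?s) + (?P ?s - ?P ?s') - (zeta ?s' - ?P ?s')" by simp
    then have "norm (zeta ?s - zeta ?s') \<le> norm (zeta ?s - ?P ?s) + norm (?P ?s - ?P ?s') + norm (zeta ?s' - ?P ?s')"
      using norm_triangle_ineq4[of "(zeta ?s - ?P ?s) + (?P ?s - ?P ?s')" "zeta ?s' - ?P ?s'"]
        norm_triangle_ineq[of "zeta ?s - ?P ?s" "?P ?s - ?P ?s'"] by (simp only:)
    also have "\<dots> \<le> (2 * A) * (?d * t powr (1/16)) + 2 * (2 * S + 3) * (1 / t)"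
    proof -
      define E where "E = (2 * S + 3) / t"
      have "2 * (2 * S + 3) * (1 / t) = 2 * E" by (simp add: E_def)
      then show ?thesis using 1 2 3 unfolding E_def[symmetric] by linarith
    qed
    also have "\<dots> \<le> C * (?d * t powr (1/16)) + C * (1 / t)"
      using A(1) S st by (intro add_mono mult_right_mono) (auto simp: C_def)
    finally show ?thesis by (simp only: ring_distribs)
  qed
  moreover have "C > 0" using A(1) S by (simp add: C_def)
  ultimately show ?thesis by blast
qed

lemma zeta_near_one:
  assumes S: "S \<ge> 2" and \<sigma>: "1 < \<sigma>" "\<sigma> \<le> S"
  shows "norm (zeta (of_real \<sigma>)) \<le> (1 + 2 * S\<^sup>2) / (\<sigma> - 1)"
proof -
  have "norm (zeta (of_real \<sigma>)) \<le> 1 / norm (complex_of_real \<sigma> - 1) + 2 * norm (complex_of_real \<sigma>) / real 1"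
    using zeta_partial_sum[of "of_real \<sigma>" 1] \<sigma> by simp
  also have "norm (complex_of_real \<sigma> - 1) = \<sigma> - 1"
    using \<sigma> by (metis abs_of_pos diff_gt_0_iff_gt norm_of_real of_real_1 of_real_diff)
  also have "2 * norm (complex_of_real \<sigma>) / real 1 \<le> 2 * S" using \<sigma> by simp
  also have "2 * S \<le> 2 * S\<^sup>2 / (\<sigma> - 1)"
  proof -
    have "2 * S * (\<sigma> - 1) \<le> 2 * S * S" using \<sigma> S by (intro mult_left_mono) auto
    then show ?thesis using \<sigma> by (simp add: field_simps power2_eq_square)
  qed
  finally show ?thesis by (simp add: add_divide_distrib)
qed

text \<open>
  For \<open>\<sigma> - 1 \<ge> t\<^sup>-\<^sup>1\<^sup>/\<^sup>2\<close> this is Mertens' inequality; closer to the line, the variation of \<open>\<zeta>\<close>, at most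
  a multiple of \<open>t\<^sup>-\<^sup>7\<^sup>/\<^sup>1\<^sup>6\<close>, is absorbed because \<open>49/128 < 7/16\<close>. What matters later is \<open>49/128 < 1/2\<close>.
\<close>

lemma zeta_lower:
  assumes S: "S \<ge> 2"
  shows "\<exists>c>0. \<exists>T\<ge>1. \<forall>\<sigma> t. 1 < \<sigma> \<and> \<sigma> \<le> S \<and> t \<ge> T \<longrightarrow> c * t powr (-(49/128)) \<le> norm (zeta (Complex \<sigma> t))"
proof -
  obtain C1 where C1: "C1 > 0" "\<And>\<sigma> t. 1 < \<sigma> \<Longrightarrow> \<sigma> \<le> S \<Longrightarrow> t \<ge> 1 \<Longrightarrow> norm (zeta (Complex \<sigma> t)) \<le> C1 * t powr (1/32)"
    using zeta_upper[OF S] by blast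
  obtain C2 where C2: "C2 > 0" "\<And>\<sigma> \<sigma>' t. 1 < \<sigma> \<Longrightarrow> \<sigma> \<le> \<sigma>' \<Longrightarrow> \<sigma>' \<le> S \<Longrightarrow> t \<ge> 1 \<Longrightarrow>
     norm (zeta (Complex \<sigma> t) - zeta (Complex \<sigma>' t)) \<le> C2 * ((\<sigma>' - \<sigma>) * t powr (1/16) + 1 / t)"
    using zeta_diff[OF S] by blast
  define C3 where "C3 = 1 + 2 * S\<^sup>2"
  have C3: "C3 > 0" by (simp add: C3_def add_pos_nonneg)
  \<comment> \<open>Mertens' inequality will read 1 \<le> 2 C1 C3^3 X^4 t^(49/32), with 49/32 = 3/2
    + 1/32 from the cube of t^(1/2) and from zeta at height 2t. Solving for X gives this constant
    and the exponent 49/128.\<close>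
  define c where "c = (1 / (2 * C1 * C3 ^ 3)) powr (1/4)"
  have c: "c > 0" using C1(1) C3 by (simp add: c_def)
  have c4: "c ^ 4 = 1 / (2 * C1 * C3 ^ 3)"
  proof -
    have "c ^ 4 = c powr 4" using c by (simp add: powr_numeral)
    also have "\<dots> = 1 / (2 * C1 * C3 ^ 3)" using C1(1) C3 by (simp add: c_def powr_powr)
    finally show ?thesis .
  qed
  have far: "c * t powr (-(49/128)) \<le> norm (zeta (Complex \<sigma> t))" if st: "t powr (-(1/2)) \<le> \<sigma> - 1" "\<sigma> \<le> S" "t \<ge> 1" for \<sigma> t
  proof -
    let ?X = "norm (zeta (Complex \<sigma> t))"
    have tp: "t powr (-(1/2)) > 0" using st by simp
    then have \<sigma>: "\<sigma> > 1" using st by linarith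
    have "norm (zeta (of_real \<sigma>)) \<le> C3 / (\<sigma> - 1)" unfolding C3_def by (rule zeta_near_one[OF S \<sigma> st(2)])
    also have "\<dots> \<le> C3 / t powr (-(1/2))" using st tp C3 \<sigma> by (intro divide_left_mono mult_pos_pos) auto
    also have "\<dots> = C3 * t powr (1/2)" using st by (simp add: powr_minus_divide)
    finally have a: "norm (zeta (of_real \<sigma>)) \<le> C3 * t powr (1/2)" .
    have "norm (zeta (Complex \<sigma> (2 * t))) \<le> C1 * (2 * t) powr (1/32)" using st \<sigma> by (intro C1(2)) auto
    also have "(2 * t) powr (1/32) = 2 powr (1/32) * t powr (1/32)" using st by (simp add: powr_mult)
    also have "2 powr (1/32) \<le> (2::real) powr 1" by (intro powr_mono) auto
    finally have b: "norm (zeta (Complex \<sigma> (2 * t))) \<le> 2 * C1 * t powr (1/32)" using C1(1) by (simp add: mult_right_mono mult_left_mono)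
    have "1 \<le> norm (zeta (of_real \<sigma>)) ^ 3 * ?X ^ 4 * norm (zeta (Complex \<sigma> (2 * t)))" by (rule mertens_inequality[OF \<sigma>])
    also have "\<dots> \<le> (C3 * t powr (1/2)) ^ 3 * ?X ^ 4 * (2 * C1 * t powr (1/32))"
      using a b C3 by (intro mult_mono power_mono) auto
    also have "\<dots> = (2 * C1 * C3 ^ 3) * ?X ^ 4 * ((t powr (1/2)) ^ 3 * t powr (1/32))"
      by (simp add: power_mult_distrib mult_ac)
    also have "(t powr (1/2)) ^ 3 * t powr (1/32) = t powr (49/32)"
      using st by (simp add: powr_powr flip: powr_add powr_numeral)
    finally have "1 \<le> (2 * C1 * C3 ^ 3) * ?X ^ 4 * t powr (49/32)" .
    then have "1 / (2 * C1 * C3 ^ 3) * t powr (-(49/32)) \<le> ?X ^ 4"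
      using C1(1) C3 st by (simp add: powr_minus_divide field_simps)
    moreover have "(c * t powr (-(49/128))) ^ 4 = 1 / (2 * C1 * C3 ^ 3) * t powr (-(49/32))"
      unfolding power_mult_distrib c4 using st by (simp add: powr_powr flip: powr_numeral)
    ultimately have "(c * t powr (-(49/128))) ^ 4 \<le> ?X ^ 4" by simp
    then show ?thesis by (rule power_le_imp_le_base[of _ 3, simplified]) simp
  qed
  \<comment> \<open>Fixes the height beyond which the variation of zeta is at most half of the lower
    bound; the other half remains, whence the final constant c / 2.\<close>
  have "((\<lambda>t::real. t powr (-(7/16)) / t powr (-(49/128))) \<longlongrightarrow> 0) at_top" by real_asymp
  then have "eventually (\<lambda>t::real. t powr (-(7/16)) / t powr (-(49/128)) < c / (4 * C2)) at_top"
    by (rule order_tendstoD) (use c C2(1) in simp)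
  then obtain T0 where T0: "\<And>t::real. t \<ge> T0 \<Longrightarrow> t powr (-(7/16)) / t powr (-(49/128)) < c / (4 * C2)"
    by (auto simp: eventually_at_top_linorder)
  define T where "T = max T0 1"
  have "c / 2 * t powr (-(49/128)) \<le> norm (zeta (Complex \<sigma> t))" if st: "1 < \<sigma>" "\<sigma> \<le> S" "t \<ge> T" for \<sigma> t
  proof (cases "t powr (-(1/2)) \<le> \<sigma> - 1")
    case True
    have "c / 2 * t powr (-(49/128)) \<le> c * t powr (-(49/128))" using c by (intro mult_right_mono) auto
    then show ?thesis using far[OF True st(2)] st(3) by (simp add: T_def)
  next
    case False
    have t: "t \<ge> 1" "t \<ge> T0" using st by (auto simp: T_def)
    define \<sigma>' where "\<sigma>' = 1 + t powr (-(1/2))"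
    have "t powr (-(1/2)) \<le> t powr 0" using t by (intro powr_mono) auto
    then have \<sigma>': "\<sigma> \<le> \<sigma>'" "\<sigma>' \<le> S" "\<sigma>' - \<sigma> \<le> t powr (-(1/2))" using False S st t by (auto simp: \<sigma>'_def)
    have 1: "c * t powr (-(49/128)) \<le> norm (zeta (Complex \<sigma>' t))"
      by (rule far) (use \<sigma>' t in \<open>auto simp: \<sigma>'_def\<close>)
    have "norm (zeta (Complex \<sigma> t) - zeta (Complex \<sigma>' t)) \<le> C2 * ((\<sigma>' - \<sigma>) * t powr (1/16) + 1 / t)"
      by (rule C2(2)) (use st \<sigma>' t in auto)
    also have "\<dots> \<le> C2 * (t powr (-(7/16)) + t powr (-(7/16)))"
    proof (intro mult_left_mono add_mono)
      have "(\<sigma>' - \<sigma>) * t powr (1/16) \<le> t powr (-(1/2)) * t powr (1/16)" using \<sigma>' by (intro mult_right_mono) auto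
      also have "\<dots> = t powr (-(7/16))" by (simp flip: powr_add)
      finally show "(\<sigma>' - \<sigma>) * t powr (1/16) \<le> t powr (-(7/16))" .
      have "1 / t = t powr (-1)" using t by (simp add: powr_minus_divide)
      also have "\<dots> \<le> t powr (-(7/16))" using t by (intro powr_mono) auto
      finally show "1 / t \<le> t powr (-(7/16))" .
    qed (use C2 in auto)
    also have "\<dots> = 2 * C2 * t powr (-(7/16))" by simp
    also have "\<dots> \<le> c / 2 * t powr (-(49/128))"
    proof -
      have "t powr (-(7/16)) < c / (4 * C2) * t powr (-(49/128))"
        using T0[OF t(2)] t by (simp add: pos_divide_less_eq)
      then have "2 * C2 * t powr (-(7/16)) \<le> 2 * C2 * (c / (4 * C2) * t powr (-(49/128)))" using C2(1) by (intro mult_left_mono) auto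
      also have "\<dots> = c / 2 * t powr (-(49/128))" using C2(1) by simp
      finally show ?thesis .
    qed
    finally have "norm (zeta (Complex \<sigma> t) - zeta (Complex \<sigma>' t)) \<le> c / 2 * t powr (-(49/128))" .
    then show ?thesis using 1 norm_triangle_ineq2[of "zeta (Complex \<sigma>' t)" "zeta (Complex \<sigma> t)"] by (simp add: norm_minus_commute)
  qed
  then show ?thesis using c by (intro exI[of _ "c / 2"] conjI exI[of _ T]) (auto simp: T_def)
qed

text \<open>The nonzero \<open>j\<close> are e n with e = 1 or -1; the positive factor n comes out
  of the power and sums to \<zeta>(1-s). The bracket with two powers stands for the usual sine
  factor.\<close>

lemma zeta_reflection:
  assumes s: "Re s < 0"
  shows "zeta s = Gamma (1 - s) * (two_pi_i 1 powr (s - 1) + two_pi_i (-1) powr (s - 1)) * zeta (1 - s)"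
proof -
  have R: "Re (1 - s) > 1" using s by simp
  have ds: "dseries (1 - s) = zeta (1 - s)"
    using has_sum_imp_sums[OF dseries_has_sum[OF R]] zeta_properties(2)[OF R] sums_unique2 by blast
  have sum1: "(\<Sum>\<^sub>\<infinity>j\<in>range (\<lambda>n. e * int (Suc n)). two_pi_i j powr (s - 1)) = two_pi_i e powr (s - 1) * zeta (1 - s)"
    if e: "e = 1 \<or> e = -1" for e
  proof -
    have "(\<Sum>\<^sub>\<infinity>j\<in>range (\<lambda>n. e * int (Suc n)). two_pi_i j powr (s - 1)) = (\<Sum>\<^sub>\<infinity>n. two_pi_i (e * int (Suc n)) powr (s - 1))"
      by (subst infsum_reindex) (use e in \<open>auto simp: inj_def o_def\<close>)
    also have "(\<lambda>n. two_pi_i (e * int (Suc n)) powr (s - 1)) = (\<lambda>n. two_pi_i e powr (s - 1) * of_nat (Suc n) powr (- (1 - s)))"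
    proof
      fix n
      have "two_pi_i (e * int (Suc n)) = of_real (real (Suc n)) * two_pi_i e" by (simp add: two_pi_i_def)
      moreover have "two_pi_i e \<noteq> 0" using e by (auto simp: two_pi_i_def)
      ultimately show "two_pi_i (e * int (Suc n)) powr (s - 1) = two_pi_i e powr (s - 1) * of_nat (Suc n) powr (- (1 - s))"
        using powr_of_real_mult[of "real (Suc n)" "two_pi_i e" "s - 1"] by simp
    qed
    also have "infsum \<dots> UNIV = two_pi_i e powr (s - 1) * zeta (1 - s)"
      unfolding infsum_cmult_right' dseries_def[symmetric] ds ..
    finally show ?thesis .
  qed
  let ?A = "range (\<lambda>n. 1 * int (Suc n))" and ?B = "range (\<lambda>n. (-1) * int (Suc n))"
  have sm: "(\<lambda>j. two_pi_i j powr (s - 1)) summable_on X" if "X \<subseteq> -{0}" for X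
  proof -
    have "(\<lambda>j. two_pi_i j powr (s - 1)) summable_on -{0}" using shifted_summable[of "s - 1" 0] s by simp
    then show ?thesis using that by (rule summable_on_subset)
  qed
  have "-{0} = ?A \<union> ?B"
  proof -
    have "j \<in> ?A \<union> ?B" if "j \<noteq> 0" for j :: int
    proof (cases "j > 0")
      case True
      then have "j = 1 * int (Suc (nat (j - 1)))" by simp
      then show ?thesis by blast
    next
      case False
      then have "j = (-1) * int (Suc (nat (- j - 1)))" using that by simp
      then show ?thesis by blast
    qed
    then show ?thesis by auto
  qed
  then have "(\<Sum>\<^sub>\<infinity>j\<in>-{0}. two_pi_i j powr (s - 1)) = (\<Sum>\<^sub>\<infinity>j\<in>?A \<union> ?B. two_pi_i j powr (s - 1))" by simp
  also have "\<dots> = (\<Sum>\<^sub>\<infinity>j\<in>?A. two_pi_i j powr (s - 1)) + (\<Sum>\<^sub>\<infinity>j\<in>?B. two_pi_i j powr (s - 1))"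
    by (rule infsum_Un_disjoint) (auto intro!: sm)
  also have "\<dots> = (two_pi_i 1 powr (s - 1) + two_pi_i (-1) powr (s - 1)) * zeta (1 - s)"
    using sum1[of 1] sum1[of "-1"] by (simp add: ring_distribs)
  finally show ?thesis using zeta_properties(3)[OF s] by simp
qed

text \<open>With y = -Im s, Gamma contributes y^(1/2) exp(-pi y/2), the bracket of the reflection
  formula exp(pi y/2), and \<zeta>(1-s) at least y^(-49/128). The exponentials cancel and 1/2 -
  49/128 = 15/128 > 0, so zeta outgrows the bounded E.\<close>

lemma strip_zero_free:
  "\<exists>T>0. \<forall>s. - a \<le> Re s \<and> Re s < 0 \<and> Im s \<le> - T \<longrightarrow> D_fun s \<noteq> 0"
proof -
  \<comment> \<open>The reflected real part 1 - Re s ranges up to 1 + a; the 2 is demanded by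
    \<open>zeta_lower\<close>.\<close>
  define S where "S = max 2 (1 + a)"
  have S: "S \<ge> 2" "S \<ge> 1 + a" by (auto simp: S_def)
  obtain c T0 where c: "c > 0" "T0 \<ge> 1" "\<And>\<sigma> t. 1 < \<sigma> \<Longrightarrow> \<sigma> \<le> S \<Longrightarrow> t \<ge> T0 \<Longrightarrow> c * t powr (-(49/128)) \<le> norm (zeta (Complex \<sigma> t))"
    using zeta_lower[OF S(1)] by blast
  obtain B where B: "B \<ge> 0" "\<And>s. Re s \<ge> - a \<Longrightarrow> norm (E_fun s) \<le> B" using E_fun_bounded[of a] by blast
  obtain x0 where x0: "x0 \<in> {1..S}" "\<And>x. x \<in> {1..S} \<Longrightarrow> Gamma x0 \<le> Gamma x"
  proof -
    have "continuous_on {1..S} (Gamma :: real \<Rightarrow> real)"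
      by (intro continuous_on_Gamma continuous_on_id) (auto elim!: nonpos_Ints_cases)
    then show ?thesis using continuous_attains_inf[of "{1..S}" "Gamma :: real \<Rightarrow> real"] S that by auto
  qed
  define g where "g = Gamma x0"
  have g: "g > 0" using x0(1) by (auto simp: g_def intro!: Gamma_real_pos)
  define K where "K = g * (2 * pi) powr (- S) * c / 2"
  have K: "K > 0" using g c by (simp add: K_def)
  have lower: "K * y powr (15/128) \<le> norm (zeta s)" if s: "- a \<le> Re s" "Re s < 0" "y = - Im s" "y \<ge> T0" for s y
  proof -
    have y: "y \<ge> 1" using s c by simp
    have 1: "1 - s = Complex (1 - Re s) y" using s by (simp add: complex_eq_iff)
    have G: "g * (y powr (1/2) * exp (- pi * y / 2)) \<le> norm (Gamma (1 - s))"
    proof -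
      have "sqrt y \<le> sqrt (2 * pi * y)" using y pi_gt3 by (intro real_sqrt_le_mono) simp
      then have "g * (sqrt y * exp (- pi * y / 2)) \<le> Gamma (1 - Re s) * (sqrt (2 * pi * y) * exp (- pi * y / 2))"
        using x0(2)[of "1 - Re s"] s(1,2) S g y by (intro mult_mono mult_right_mono mult_nonneg_nonneg) (auto simp: g_def)
      also have "\<dots> \<le> norm (Gamma (1 - s))" unfolding 1 using s y by (intro norm_Gamma_lower) auto
      finally show ?thesis using y by (simp add: powr_half_sqrt)
    qed
    have n1: "norm (two_pi_i 1 powr (s - 1)) = (2 * pi) powr (Re s - 1) * exp (pi * y / 2)"
      unfolding dominant_eq using s by (simp add: mult.commute)
    have n2: "norm (two_pi_i (-1) powr (s - 1)) = (2 * pi) powr (Re s - 1) * exp (- (pi * y / 2))"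
    proof -
      have "two_pi_i (-1) = of_real (2 * pi) * (- \<i>)" by (simp add: two_pi_i_def)
      moreover have "Arg (of_real (2 * pi) * (- \<i>)) = Arg (- \<i>)" by (rule Arg_times_of_real) auto
      ultimately have "Arg (two_pi_i (-1)) = - (pi / 2)" by simp
      then show ?thesis using s by (simp only: norm_powr_complex) (simp add: mult.commute)
    qed
    have P: "(2 * pi) powr (- S) * (exp (pi * y / 2) / 2) \<le> norm (two_pi_i 1 powr (s - 1) + two_pi_i (-1) powr (s - 1))"
    proof -
      have "exp (- (pi * y / 2)) \<le> exp (pi * y / 2) / 2"
      proof -
        have "pi * 1 \<le> pi * y" using y by (intro mult_left_mono) auto
        then have "1 \<le> pi * y" using pi_gt3 by linarith
        then have "exp 1 \<le> exp (pi * y)" by simp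
        moreover have "exp 1 \<ge> (2::real)" using exp_ge_add_one_self[of 1] by simp
        ultimately have "2 \<le> exp (pi * y)" by linarith
        also have "exp (pi * y) = exp (pi * y / 2) / exp (- (pi * y / 2))" by (simp flip: exp_diff)
        finally show ?thesis by (simp add: field_simps)
      qed
      then have "(2 * pi) powr (- S) * (exp (pi * y / 2) / 2) \<le> (2 * pi) powr (Re s - 1) * (exp (pi * y / 2) - exp (- (pi * y / 2)))"
        using s S pi_gt3 by (intro mult_mono powr_mono) auto
      also have "\<dots> \<le> norm (two_pi_i 1 powr (s - 1) + two_pi_i (-1) powr (s - 1))"
        using norm_diff_ineq[of "two_pi_i 1 powr (s - 1)" "two_pi_i (-1) powr (s - 1)"] unfolding n1 n2 by (simp add: right_diff_distrib)
      finally show ?thesis .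
    qed
    have Z: "c * y powr (-(49/128)) \<le> norm (zeta (1 - s))" unfolding 1 using s S by (intro c(3)) auto
    have "(g * (y powr (1/2) * exp (- pi * y / 2))) * ((2 * pi) powr (- S) * (exp (pi * y / 2) / 2)) * (c * y powr (-(49/128))) \<le> norm (zeta s)"
      unfolding zeta_reflection[OF s(2)] norm_mult using G P Z g c by (intro mult_mono) auto
    also have "(g * (y powr (1/2) * exp (- pi * y / 2))) * ((2 * pi) powr (- S) * (exp (pi * y / 2) / 2)) * (c * y powr (-(49/128)))
       = K * (y powr (1/2) * y powr (-(49/128))) * (exp (- pi * y / 2) * exp (pi * y / 2))" by (simp add: K_def)
    also have "exp (- pi * y / 2) * exp (pi * y / 2) = 1" by (simp flip: exp_add)
    also have "y powr (1/2) * y powr (-(49/128)) = y powr (15/128)" by (simp flip: powr_add)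
    finally show ?thesis by simp
  qed
  have "filterlim (\<lambda>y::real. K * y powr (15/128)) at_top at_top"
    using K by real_asymp
  then have "eventually (\<lambda>y::real. K * y powr (15/128) > B) at_top" by (simp add: filterlim_at_top_dense)
  then obtain T1 where T1: "\<And>y::real. y \<ge> T1 \<Longrightarrow> K * y powr (15/128) > B" by (auto simp: eventually_at_top_linorder)
  define T where "T = max T0 T1"
  have "D_fun s \<noteq> 0" if s: "- a \<le> Re s" "Re s < 0" "Im s \<le> - T" for s
  proof
    assume "D_fun s = 0"
    then have "zeta s = - E_fun s" by (simp add: D_fun_def add_eq_0_iff2)
    then have "norm (zeta s) \<le> B" using B(2)[of s] s by simp
    moreover have "K * (- Im s) powr (15/128) \<le> norm (zeta s)" using s by (intro lower) (auto simp: T_def)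
    moreover have "T1 \<le> - Im s" using s(3) by (simp add: T_def)
    ultimately show False using T1[of "- Im s"] by linarith
  qed
  then show ?thesis using c(2) by (intro exI[of _ T]) (auto simp: T_def)
qed

theorem strip_finite: "finite {s. D_fun s = 0 \<and> - a \<le> Re s \<and> Re s < 0}"
proof -
  obtain T where T: "T > 0" "\<And>s. - a \<le> Re s \<Longrightarrow> Re s < 0 \<Longrightarrow> Im s \<le> - T \<Longrightarrow> D_fun s \<noteq> 0"
    using strip_zero_free[of a] by blast
  have T': "D_fun s \<noteq> 0" if "- a \<le> Re s" "Re s < 0" "Im s \<ge> T" for s
  proof -
    have "s \<noteq> 1" using that by auto
    moreover have "D_fun (cnj s) \<noteq> 0" using that by (intro T(2)) auto
    ultimately show ?thesis using D_fun_cnj[of s] by auto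
  qed
  define K where "K = cbox (Complex (- a) (- T)) (Complex 0 T)"
  have sub: "{s. D_fun s = 0 \<and> - a \<le> Re s \<and> Re s < 0} \<subseteq> {s \<in> K. D_fun s = 0}"
  proof
    fix s assume "s \<in> {s. D_fun s = 0 \<and> - a \<le> Re s \<and> Re s < 0}"
    then have s: "D_fun s = 0" "- a \<le> Re s" "Re s < 0" by auto
    then have "\<not> Im s \<le> - T" "\<not> Im s \<ge> T" using T(2)[of s] T'[of s] by blast+
    then show "s \<in> {s \<in> K. D_fun s = 0}" using s by (simp add: K_def in_cbox_complex_iff)
  qed
  \<comment> \<open>Finiteness of zeros on a compact set needs a nonconstant function. A constant
    nonzero D has no zeros, and D = 0 contradicts the zero-free region unless the strip is
    empty.\<close>
  show ?thesis
  proof (cases "D_fun constant_on -{1}")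
    case True
    then obtain k where k: "\<And>s. s \<noteq> 1 \<Longrightarrow> D_fun s = k" by (auto simp: constant_on_def)
    show ?thesis
    proof (cases "k = 0")
      case False
      have "D_fun s \<noteq> 0" if "Re s < 0" for s
      proof -
        have "s \<noteq> 1" using that by auto
        then show ?thesis using k[of s] False by simp
      qed
      then have "{s. D_fun s = 0 \<and> - a \<le> Re s \<and> Re s < 0} = {}" by blast
      then show ?thesis by (simp only: finite.emptyI)
    next
      case True
      have "{s. D_fun s = 0 \<and> - a \<le> Re s \<and> Re s < 0} = {}"
      proof (rule ccontr)
        assume "\<not> ?thesis"
        then obtain s where "- a \<le> Re s" "Re s < 0" by auto
        then have "D_fun (Complex (Re s) (- T)) \<noteq> 0" by (intro T(2)) auto
        moreover have "Complex (Re s) (- T) \<noteq> 1" using \<open>Re s < 0\<close> by (auto simp: complex_eq_iff)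
        ultimately show False using k[of "Complex (Re s) (- T)"] True by simp
      qed
      then show ?thesis by (simp only: finite.emptyI)
    qed
  next
    case False
    have "finite {s \<in> K. D_fun s = 0}"
    proof (rule holomorphic_compact_finite_zeros[OF D_fun_holomorphic _ _ _ _ False])
      show "connected (- {1::complex})" by (rule connected_punctured_universe) auto
      show "K \<subseteq> - {1}" by (auto simp: K_def in_cbox_complex_iff)
    qed (auto simp: K_def)
    then show ?thesis by (rule finite_subset[OF sub])
  qed
qed

section \<open>The zeros of D\<close>

text \<open>Theta is the argument of i / L, the direction of 1 - \<open>approx_zero m\<close> for m
  \<ge> 0.\<close>

lemma exp_i_Theta: "exp (\<i> * of_real Theta) = \<i> * of_real (norm L_const) / L_const" "0 < Theta" "Theta < pi / 2"
proof -
  have L: "L_const \<noteq> 0" by (rule norm_L_bounds)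
  have "0 < Re L_const" "0 < Im L_const" using ln_pi_pos by (simp_all add: L_const_eq(2,3))
  then have "0 < Arg L_const" "Arg L_const < pi / 2"
    using Arg_pos_iff[of L_const] Arg_lt_pi[of L_const] Re_Ln_pos_lt[OF L] L by (auto simp: Arg_eq_Im_Ln)
  then show "0 < Theta" "Theta < pi / 2" by (auto simp: Theta_def)
  have "L_const = of_real (norm L_const) * exp (\<i> * of_real (Arg L_const))" using Arg_eq[OF L] .
  then have "exp (\<i> * of_real (Arg L_const)) = L_const / of_real (norm L_const)"
    using L by (simp add: field_simps)
  moreover have "\<i> * of_real Theta = of_real pi / 2 * \<i> - \<i> * of_real (Arg L_const)"
    by (simp add: Theta_def algebra_simps)
  moreover have "exp (of_real pi / 2 * \<i>) = \<i>" using cis_pi_half by (simp add: cis_conv_exp mult.commute)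
  ultimately show "exp (\<i> * of_real Theta) = \<i> * of_real (norm L_const) / L_const" by (simp add: exp_diff)
qed

lemma one_minus_approx_zero: "1 - approx_zero m = of_real (pi * (2 * of_int m + 1) / norm L_const) * exp (\<i> * of_real Theta)"
  using norm_L_bounds(3) by (simp add: approx_zero_def exp_i_Theta field_simps)

lemma norm_one_minus_approx_zero: "m \<ge> 0 \<Longrightarrow> norm (approx_zero m - 1) = 2 * pi / norm L_const * (of_int m + 1 / 2)"
proof -
  assume "m \<ge> 0"
  then have "0 \<le> pi * (2 * of_int m + 1) / norm L_const" by (intro divide_nonneg_nonneg mult_nonneg_nonneg) auto
  then have "norm (1 - approx_zero m) = pi * (2 * of_int m + 1) / norm L_const"
    unfolding one_minus_approx_zero norm_mult norm_exp_i_times norm_of_real by (simp only: abs_of_nonneg mult_1_right)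
  also have "\<dots> = 2 * pi / norm L_const * (of_int m + 1 / 2)" by (simp add: algebra_simps add_divide_distrib)
  finally show ?thesis by (simp add: norm_minus_commute)
qed

text \<open>The approximate zeros lie exactly on the two rays, so the distance of a true zero to its
  ray is at most its distance to its approximation.\<close>

lemma approx_zero_on_ray:
  assumes "m \<ge> 0"
  shows "approx_zero m \<in> {s. s \<noteq> 1 \<and> Arg (1 - s) = Theta}" "cnj (approx_zero m) \<in> {s. s \<noteq> 1 \<and> Arg (1 - s) = - Theta}"
proof -
  define R where "R = pi * (2 * of_int m + 1) / norm L_const"
  have R: "R > 0" using assms norm_L_bounds(3) unfolding R_def by (intro divide_pos_pos mult_pos_pos) auto
  have 1: "1 - approx_zero m = of_real R * exp (\<i> * of_real Theta)" unfolding R_def by (rule one_minus_approx_zero)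
  have "1 - cnj (approx_zero m) = cnj (1 - approx_zero m)" by simp
  also have "\<dots> = of_real R * exp (\<i> * of_real (- Theta))" unfolding 1 by (simp add: exp_cnj)
  finally have 2: "1 - cnj (approx_zero m) = of_real R * exp (\<i> * of_real (- Theta))" .
  have "Arg (1 - approx_zero m) = Theta" by (rule Arg_unique[OF 1[symmetric] R]) (use exp_i_Theta(2,3) in auto)
  moreover have "Arg (1 - cnj (approx_zero m)) = - Theta" by (rule Arg_unique[OF 2[symmetric] R]) (use exp_i_Theta(2,3) in auto)
  moreover have "1 - approx_zero m \<noteq> 0" "1 - cnj (approx_zero m) \<noteq> 0" using 1 2 R by auto
  ultimately show "approx_zero m \<in> {s. s \<noteq> 1 \<and> Arg (1 - s) = Theta}" "cnj (approx_zero m) \<in> {s. s \<noteq> 1 \<and> Arg (1 - s) = - Theta}" by auto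
qed

lemma exp_int_tendsto_0:
  fixes C \<kappa> :: real
  assumes "\<kappa> > 0" shows "((\<lambda>m::int. C * exp (- \<kappa> * of_int m)) \<longlongrightarrow> 0) at_top"
proof -
  have "((\<lambda>x::real. C * exp (- \<kappa> * x)) \<longlongrightarrow> 0) at_top" using assms by real_asymp
  then show ?thesis by (rule filterlim_compose[OF _ filterlim_real_of_int_at_top])
qed

text \<open>Bounding the modulus on both sides by \<delta> (m + 1/2) up to 2 squeezes the index set
  between two integer intervals starting at M, whose lengths differ from R / \<delta> by a bounded
  amount.\<close>

lemma card_int_approx:
  fixes \<rho> :: "int \<Rightarrow> complex"
  assumes d: "\<delta> > 0" and M: "M \<ge> 0" and near: "\<And>m. m \<ge> M \<Longrightarrow> \<bar>norm (\<rho> m) - \<delta> * (of_int m + 1 / 2)\<bar> \<le> 2" and R: "R \<ge> 0"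
  shows "finite {m. M \<le> m \<and> norm (\<rho> m) \<le> R}"
    "\<bar>real (card {m. M \<le> m \<and> norm (\<rho> m) \<le> R}) - R / \<delta>\<bar> \<le> 2 / \<delta> + 2 + of_int M"
proof -
  let ?I = "{m. M \<le> m \<and> norm (\<rho> m) \<le> R}"
  define lo where "lo = \<lfloor>(R - 2) / \<delta> - 1 / 2\<rfloor>"
  define hi where "hi = \<lfloor>(R + 2) / \<delta> - 1 / 2\<rfloor>"
  have up: "?I \<subseteq> {M..hi}"
  proof
    fix m assume m: "m \<in> ?I"
    then have "\<delta> * (of_int m + 1 / 2) \<le> R + 2" using near[of m] by (auto simp: abs_le_iff)
    then have "of_int m + 1 / 2 \<le> (R + 2) / \<delta>" using d by (simp add: pos_le_divide_eq mult.commute)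
    then have "m \<le> hi" unfolding hi_def by (simp add: le_floor_iff)
    then show "m \<in> {M..hi}" using m by simp
  qed
  then show fin: "finite ?I" by (rule finite_subset) simp
  have down: "{M..lo} \<subseteq> ?I"
  proof
    fix m assume m: "m \<in> {M..lo}"
    then have "of_int m \<le> (R - 2) / \<delta> - 1 / 2" by (simp add: lo_def le_floor_iff)
    then have "of_int m + 1 / 2 \<le> (R - 2) / \<delta>" by linarith
    then have "\<delta> * (of_int m + 1 / 2) \<le> R - 2" using d by (simp add: pos_le_divide_eq mult.commute)
    then have "norm (\<rho> m) \<le> R" using near[of m] m by (auto simp: abs_le_iff)
    then show "m \<in> ?I" using m by simp
  qed
  have "card ?I \<le> card {M..hi}" by (rule card_mono[OF _ up]) simp
  then have "card ?I \<le> nat (hi - M + 1)" by simp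
  moreover have "real (nat (hi - M + 1)) \<le> (R + 2) / \<delta> + 1"
  proof -
    have "real_of_int hi \<le> (R + 2) / \<delta> - 1 / 2" unfolding hi_def by (rule of_int_floor_le)
    moreover have "0 \<le> (R + 2) / \<delta>" using R d by simp
    ultimately show ?thesis using M by (cases "hi - M + 1 \<ge> 0") auto
  qed
  ultimately have 1: "real (card ?I) \<le> (R + 2) / \<delta> + 1" by linarith
  have "card {M..lo} \<le> card ?I" by (rule card_mono[OF fin down])
  then have "nat (lo - M + 1) \<le> card ?I" by simp
  then have "real_of_int (lo - M + 1) \<le> real (card ?I)" by linarith
  moreover have "(R - 2) / \<delta> - 1 / 2 - 1 < real_of_int lo" unfolding lo_def by linarith
  ultimately have 2: "(R - 2) / \<delta> - 1 / 2 - of_int M \<le> real (card ?I)" by simp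
  have e: "(R + 2) / \<delta> = R / \<delta> + 2 / \<delta>" "(R - 2) / \<delta> = R / \<delta> - 2 / \<delta>"
    by (simp_all add: add_divide_distrib diff_divide_distrib)
  have "real_of_int M \<ge> 0" using M by simp
  then show "\<bar>real (card ?I) - R / \<delta>\<bar> \<le> 2 / \<delta> + 2 + of_int M"
    using 1 2 unfolding e abs_le_iff by linarith
qed

theorem theorem5p1:
  "\<exists>\<sigma>\<^sub>0 :: real. \<sigma>\<^sub>0 > 0 \<and>
     (\<forall>s. D_fun s = 0 \<and> Re s \<le> - \<sigma>\<^sub>0 \<longrightarrow> zorder D_fun s = 1) \<and>
     (\<exists>(m\<^sub>0 :: int) (\<rho> :: int \<Rightarrow> complex).
        {s. D_fun s = 0 \<and> Re s \<le> - \<sigma>\<^sub>0} = \<rho> ` {m\<^sub>0..} \<union> (\<lambda>m. cnj (\<rho> m)) ` {m\<^sub>0..} \<and>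
        inj_on \<rho> {m\<^sub>0..} \<and>
        \<rho> ` {m\<^sub>0..} \<inter> (\<lambda>m. cnj (\<rho> m)) ` {m\<^sub>0..} = {} \<and>
        (\<exists>(\<kappa> :: real) (C :: real). \<kappa> > 0 \<and>
           (\<forall>m\<ge>m\<^sub>0. cmod (\<rho> m - (1 - \<i> * of_real pi * (2 * of_int m + 1) / L_const))
                       \<le> C * exp (- \<kappa> * of_int m))) \<and>
        filterlim (\<lambda>m. cmod (\<rho> m)) at_top at_top \<and>
        ((\<lambda>m. infdist (\<rho> m) {s. s \<noteq> 1 \<and> Arg (1 - s) = Theta}) \<longlongrightarrow> 0) at_top \<and>
        ((\<lambda>m. infdist (cnj (\<rho> m)) {s. s \<noteq> 1 \<and> Arg (1 - s) = - Theta}) \<longlongrightarrow> 0) at_top \<and>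
        ((\<lambda>m. cmod (\<rho> (m + 1) - \<rho> m)) \<longlongrightarrow> 2 * pi / cmod L_const) at_top) \<and>
     (\<lambda>R :: real. real (card {s. D_fun s = 0 \<and> Re s < 0 \<and> cmod s \<le> R}) - cmod L_const / pi * R)
        \<in> O[at_top](\<lambda>_. 1)"
proof -
  obtain \<sigma> M \<rho> \<kappa> C where \<sigma>: "\<sigma> \<ge> 1" and \<kappa>: "\<kappa> > 0" and M: "M \<ge> (0::int)"
    and A: "\<And>s. D_fun s = 0 \<Longrightarrow> Re s \<le> - \<sigma> \<Longrightarrow> Im s \<le> 0 \<Longrightarrow> \<exists>m\<ge>M. s = \<rho> m"
    and B: "\<And>m. m \<ge> M \<Longrightarrow> D_fun (\<rho> m) = 0 \<and> Re (\<rho> m) \<le> - \<sigma> \<and> Im (\<rho> m) < 0 \<and> zorder D_fun (\<rho> m) = 1 \<and>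
        norm (\<rho> m - approx_zero m) \<le> C * exp (- \<kappa> * of_int m) \<and> norm (\<rho> m - approx_zero m) < 1 / (4 * norm L_const)"
    using far_zeros by blast
  define r where "r = 1 / (4 * norm L_const)"
  have r: "0 < r" "r < 1" "2 * r < spacing" using radius_bounds spacing_pos(2) by (auto simp: r_def)
  have near: "norm (\<rho> m - approx_zero m) < r" if "m \<ge> M" for m using B[OF that] by (simp add: r_def)
  have neg: "Re s < 0" "s \<noteq> 1" if "Re s \<le> - \<sigma>" for s using that \<sigma> by auto
  have zord: "zorder D_fun s = 1" if s: "D_fun s = 0" "Re s \<le> - \<sigma>" for s
  proof (cases "Im s \<le> 0")
    case True
    then show ?thesis using A[OF s] B by blast
  next
    case False
    have "D_fun (cnj s) = 0" using D_fun_cnj[of s] s neg by simp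
    then have 1: "zorder D_fun (cnj s) = 1" using A[of "cnj s"] B s False by auto
    have "zorder D_fun (cnj (cnj s)) = zorder D_fun (cnj s)"
    proof (rule zorder_cnj[of _ "{s. Re s < 0}"])
      show "D_fun holomorphic_on {s. Re s < 0}" by (rule holomorphic_on_subset[OF D_fun_holomorphic]) auto
      show "connected {s. Re s < 0}" by (intro convex_connected convex_halfspace_Re_lt)
      show "D_fun (cnj w) = cnj (D_fun w)" if "w \<in> {s. Re s < 0}" for w using that by (intro D_fun_cnj) auto
      \<comment> \<open>A point where D does not vanish: zeros this far left with Im s \<le> 0 lie
        strictly below the real axis, so the real point is none.\<close>
      have "D_fun (of_real (- \<sigma>)) \<noteq> 0"
      proof
        assume "D_fun (of_real (- \<sigma>)) = 0"
        then obtain m where "m \<ge> M" "of_real (- \<sigma>) = \<rho> m" using A[of "of_real (- \<sigma>)"] by auto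
        then have "Im (complex_of_real (- \<sigma>)) < 0" using B[of m] by metis
        then show False by simp
      qed
      then show "\<exists>w\<in>{s. Re s < 0}. D_fun w \<noteq> 0" using \<sigma> by (intro bexI[of _ "of_real (- \<sigma>)"]) auto
    qed (use s neg open_halfspace_Re_lt in auto)
    then show ?thesis using 1 by simp
  qed
  have zeros: "{s. D_fun s = 0 \<and> Re s \<le> - \<sigma>} = \<rho> ` {M..} \<union> (\<lambda>m. cnj (\<rho> m)) ` {M..}"
  proof (intro equalityI subsetI)
    fix s assume "s \<in> {s. D_fun s = 0 \<and> Re s \<le> - \<sigma>}"
    then have s: "D_fun s = 0" "Re s \<le> - \<sigma>" by auto
    show "s \<in> \<rho> ` {M..} \<union> (\<lambda>m. cnj (\<rho> m)) ` {M..}"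
    proof (cases "Im s \<le> 0")
      case True
      then show ?thesis using A[OF s] by auto
    next
      case False
      have "D_fun (cnj s) = 0" using D_fun_cnj[of s] s neg by simp
      then obtain m where "m \<ge> M" "cnj s = \<rho> m" using A[of "cnj s"] s False by auto
      then have "s = cnj (\<rho> m)" by (metis complex_cnj_cnj)
      then show ?thesis using \<open>m \<ge> M\<close> by auto
    qed
  next
    fix s assume "s \<in> \<rho> ` {M..} \<union> (\<lambda>m. cnj (\<rho> m)) ` {M..}"
    then obtain m where m: "m \<ge> M" "s = \<rho> m \<or> s = cnj (\<rho> m)" by auto
    have "D_fun (cnj (\<rho> m)) = 0" using D_fun_cnj[of "\<rho> m"] B[OF m(1)] neg by simp
    then show "s \<in> {s. D_fun s = 0 \<and> Re s \<le> - \<sigma>}" using m B[OF m(1)] by auto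
  qed
  have inj_less: "\<rho> m \<noteq> \<rho> m'" if "m \<ge> M" "m < m'" for m m'
  proof
    assume eq: "\<rho> m = \<rho> m'"
    have "Re (approx_zero m) - Re (approx_zero m') = (of_int m' - of_int m) * spacing" by (simp add: approx_zero_Re_Im algebra_simps)
    moreover have "1 * spacing \<le> (of_int m' - of_int m) * spacing" using that spacing_pos(1) by (intro mult_right_mono) linarith+
    moreover have "\<bar>Re (\<rho> m - approx_zero m)\<bar> < r" "\<bar>Re (\<rho> m' - approx_zero m')\<bar> < r"
      using near[of m] near[of m'] that abs_Re_le_cmod[of "\<rho> m - approx_zero m"] abs_Re_le_cmod[of "\<rho> m' - approx_zero m'"] by linarith+
    moreover have "Re (\<rho> m) = Re (\<rho> m')" using eq by simp
    ultimately show False using r unfolding minus_complex.sel by linarith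
  qed
  have inj: "inj_on \<rho> {M..}"
  proof (rule inj_onI)
    fix m m' assume "m \<in> {M..}" "m' \<in> {M..}" "\<rho> m = \<rho> m'"
    then show "m = m'" using inj_less[of m m'] inj_less[of m' m] by (cases m m' rule: linorder_cases) auto
  qed
  have disj: "\<rho> ` {M..} \<inter> (\<lambda>m. cnj (\<rho> m)) ` {M..} = {}"
  proof -
    have "\<rho> m \<noteq> cnj (\<rho> m')" if "m \<ge> M" "m' \<ge> M" for m m'
    proof
      assume "\<rho> m = cnj (\<rho> m')"
      then have "Im (\<rho> m) = - Im (\<rho> m')" by simp
      then show False using B[OF that(1)] B[OF that(2)] by linarith
    qed
    then show ?thesis by auto
  qed
  have est: "\<exists>\<kappa> C. \<kappa> > 0 \<and> (\<forall>m\<ge>M. cmod (\<rho> m - (1 - \<i> * of_real pi * (2 * of_int m + 1) / L_const)) \<le> C * exp (- \<kappa> * of_int m))"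
    using B \<kappa> unfolding approx_zero_def[symmetric] by blast
  have dist_lim: "((\<lambda>m. norm (\<rho> m - approx_zero m)) \<longlongrightarrow> 0) at_top"
  proof (rule tendsto_sandwich[OF _ _ tendsto_const exp_int_tendsto_0[OF \<kappa>]])
    show "eventually (\<lambda>m. norm (\<rho> m - approx_zero m) \<le> C * exp (- \<kappa> * of_int m)) at_top"
      using eventually_ge_at_top[of M] by eventually_elim (use B in blast)
  qed auto
  define \<delta> where "\<delta> = 2 * pi / norm L_const"
  have \<delta>: "\<delta> > 0" using norm_L_bounds(3) by (simp add: \<delta>_def)
  \<comment> \<open>The 2 is made of 1 for moving the centre from 1 to 0 and less than 1 for the
    disc radius.\<close>
  have size: "\<bar>norm (\<rho> m) - \<delta> * (of_int m + 1 / 2)\<bar> \<le> 2" if m: "m \<ge> M" for m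
  proof -
    have "norm (approx_zero m - 1) = \<delta> * (of_int m + 1 / 2)" unfolding \<delta>_def using m M by (intro norm_one_minus_approx_zero) simp
    moreover have "\<bar>norm (\<rho> m) - norm (approx_zero m - 1)\<bar> \<le> norm (\<rho> m - (approx_zero m - 1))" by (rule norm_triangle_ineq3)
    moreover have "norm (\<rho> m - (approx_zero m - 1)) \<le> norm (\<rho> m - approx_zero m) + 1"
      using norm_triangle_ineq[of "\<rho> m - approx_zero m" 1] by (simp add: diff_diff_eq2 diff_add_eq)
    ultimately show ?thesis using near[OF m] r by linarith
  qed
  have inf: "filterlim (\<lambda>m. cmod (\<rho> m)) at_top at_top"
  proof (rule filterlim_at_top_mono)
    have "filterlim (\<lambda>x::real. \<delta> * (x + 1 / 2) - 2) at_top at_top" using \<delta> by real_asymp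
    then show "filterlim (\<lambda>m::int. \<delta> * (of_int m + 1 / 2) - 2) at_top at_top"
      by (rule filterlim_compose[OF _ filterlim_real_of_int_at_top])
    show "eventually (\<lambda>m. \<delta> * (of_int m + 1 / 2) - 2 \<le> norm (\<rho> m)) at_top"
      using eventually_ge_at_top[of M]
    proof eventually_elim
      case (elim m)
      then show ?case using size[of m] by linarith
    qed
  qed
  have ray1: "((\<lambda>m. infdist (\<rho> m) {s. s \<noteq> 1 \<and> Arg (1 - s) = Theta}) \<longlongrightarrow> 0) at_top"
  proof (rule tendsto_sandwich[OF _ _ tendsto_const dist_lim])
    show "eventually (\<lambda>m. infdist (\<rho> m) {s. s \<noteq> 1 \<and> Arg (1 - s) = Theta} \<le> norm (\<rho> m - approx_zero m)) at_top"
      using eventually_ge_at_top[of 0]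
    proof eventually_elim
      case (elim m)
      then show ?case using infdist_le[OF approx_zero_on_ray(1)[OF elim], of "\<rho> m"] by (simp add: dist_norm)
    qed
  qed (simp add: infdist_nonneg)
  have ray2: "((\<lambda>m. infdist (cnj (\<rho> m)) {s. s \<noteq> 1 \<and> Arg (1 - s) = - Theta}) \<longlongrightarrow> 0) at_top"
  proof (rule tendsto_sandwich[OF _ _ tendsto_const dist_lim])
    show "eventually (\<lambda>m. infdist (cnj (\<rho> m)) {s. s \<noteq> 1 \<and> Arg (1 - s) = - Theta} \<le> norm (\<rho> m - approx_zero m)) at_top"
      using eventually_ge_at_top[of 0]
    proof eventually_elim
      case (elim m)
      have "dist (cnj (\<rho> m)) (cnj (approx_zero m)) = norm (\<rho> m - approx_zero m)"
        unfolding dist_norm complex_cnj_diff[symmetric] by (rule complex_mod_cnj)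
      then show ?case using infdist_le[OF approx_zero_on_ray(2)[OF elim], of "cnj (\<rho> m)"] by simp
    qed
  qed (simp add: infdist_nonneg)
  have gap: "((\<lambda>m. cmod (\<rho> (m + 1) - \<rho> m)) \<longlongrightarrow> 2 * pi / cmod L_const) at_top"
  proof -
    have l0: "((\<lambda>m. \<rho> m - approx_zero m) \<longlongrightarrow> 0) at_top" using dist_lim by (rule tendsto_norm_zero_cancel)
    have "filterlim (\<lambda>m::int. m + 1) at_top at_top"
      by (rule filterlim_at_top_mono[OF filterlim_ident]) auto
    then have l1: "((\<lambda>m. \<rho> (m + 1) - approx_zero (m + 1)) \<longlongrightarrow> 0) at_top" by (rule filterlim_compose[OF l0])
    \<comment> \<open>Consecutive approximate zeros differ exactly by -2 pi i / L; the corrections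
      tend to 0.\<close>
    have "((\<lambda>m. norm ((\<rho> (m + 1) - approx_zero (m + 1)) - (\<rho> m - approx_zero m) + - (2 * of_real pi * \<i> / L_const))) \<longlongrightarrow> norm (0 - 0 + - (2 * of_real pi * \<i> / L_const))) at_top"
      by (intro tendsto_intros l0 l1)
    moreover have "(\<rho> (m + 1) - approx_zero (m + 1)) - (\<rho> m - approx_zero m) + - (2 * of_real pi * \<i> / L_const) = \<rho> (m + 1) - \<rho> m" for m
      using norm_L_bounds(3) by (simp add: approx_zero_def field_simps)
    moreover have "norm (0 - 0 + - (2 * of_real pi * \<i> / L_const)) = 2 * pi / norm L_const" by (simp add: norm_divide norm_mult)
    ultimately show ?thesis by (simp only:)
  qed
  define F where "F = {s. D_fun s = 0 \<and> - \<sigma> \<le> Re s \<and> Re s < 0}"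
  have finF: "finite F" unfolding F_def by (rule strip_finite)
  \<comment> \<open>At most \<open>card F\<close> zeros lie between the line Re s = -\<sigma> and
    the imaginary axis. Each of the two strings contributes R / \<delta> up to the error in
    parentheses, and 2 R / \<delta> is |L| R / pi.\<close>
  define K where "K = real (card F) + 2 * (2 / \<delta> + 2 + of_int M)"
  have count: "\<bar>real (card {s. D_fun s = 0 \<and> Re s < 0 \<and> cmod s \<le> R}) - cmod L_const / pi * R\<bar> \<le> K" if R: "R \<ge> 0" for R
  proof -
    let ?N = "{s. D_fun s = 0 \<and> Re s < 0 \<and> cmod s \<le> R}"
    let ?I = "{m. M \<le> m \<and> norm (\<rho> m) \<le> R}"
    define FR where "FR = {s \<in> F. - \<sigma> < Re s \<and> cmod s \<le> R}"
    have I: "finite ?I" "\<bar>real (card ?I) - R / \<delta>\<bar> \<le> 2 / \<delta> + 2 + of_int M"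
      by (rule card_int_approx[OF \<delta> M size R]; assumption)+
    have FR: "finite FR" "card FR \<le> card F" using finF by (auto simp: FR_def intro: card_mono)
    have injI: "inj_on \<rho> ?I" by (rule inj_on_subset[OF inj]) auto
    have c1: "card (\<rho> ` ?I) = card ?I" by (rule card_image[OF injI])
    have c2: "card (cnj ` \<rho> ` ?I) = card ?I" using c1 by (subst card_image) (auto simp: inj_on_def)
    have "?N = FR \<union> {s. (D_fun s = 0 \<and> Re s \<le> - \<sigma>) \<and> cmod s \<le> R}"
      using \<sigma> by (auto simp: FR_def F_def)
    also have "{s. (D_fun s = 0 \<and> Re s \<le> - \<sigma>) \<and> cmod s \<le> R} = {s \<in> {s. D_fun s = 0 \<and> Re s \<le> - \<sigma>}. cmod s \<le> R}" by blast
    also have "\<dots> = \<rho> ` ?I \<union> cnj ` \<rho> ` ?I" unfolding zeros by auto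
    finally have N: "?N = FR \<union> (\<rho> ` ?I \<union> cnj ` \<rho> ` ?I)" .
    have d1: "\<rho> ` ?I \<inter> cnj ` \<rho> ` ?I = {}" using disj by auto
    have d2: "FR \<inter> (\<rho> ` ?I \<union> cnj ` \<rho> ` ?I) = {}"
    proof -
      have "Re s \<le> - \<sigma>" if "s \<in> \<rho> ` ?I \<union> cnj ` \<rho> ` ?I" for s using that B by auto
      then show ?thesis by (force simp: FR_def)
    qed
    have "card ?N = card FR + (card ?I + card ?I)"
      unfolding N using FR(1) I(1) c1 c2 d1 d2 by (simp add: card_Un_disjoint)
    then have eq: "real (card ?N) = real (card FR) + 2 * real (card ?I)" by simp
    have *: "\<bar>a + 2 * b - c\<bar> \<le> f + 2 * e" if "c = 2 * x" "\<bar>b - x\<bar> \<le> e" "0 \<le> a" "a \<le> f" for a b c e f x :: real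
      using that by linarith
    show ?thesis unfolding eq K_def
      by (rule *[OF _ I(2)]) (use FR(2) in \<open>simp_all add: \<delta>_def\<close>)
  qed
  have big: "(\<lambda>R :: real. real (card {s. D_fun s = 0 \<and> Re s < 0 \<and> cmod s \<le> R}) - cmod L_const / pi * R) \<in> O[at_top](\<lambda>_. 1)"
  proof (rule bigoI[where c = K])
    show "\<forall>\<^sub>F R in at_top. norm (real (card {s. D_fun s = 0 \<and> Re s < 0 \<and> cmod s \<le> R}) - cmod L_const / pi * R) \<le> K * norm (1::real)"
      using eventually_ge_at_top[of 0] by eventually_elim (use count in simp)
  qed
  have \<sigma>pos: "\<sigma> > 0" using \<sigma> by simp
  have simple: "\<forall>s. D_fun s = 0 \<and> Re s \<le> - \<sigma> \<longrightarrow> zorder D_fun s = 1" using zord by blast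
  show ?thesis
    by (rule exI[of _ \<sigma>], rule conjI[OF \<sigma>pos], rule conjI[OF simple], rule conjI[OF _ big],
        rule exI[of _ M], rule exI[of _ \<rho>], intro conjI zeros inj disj est inf ray1 ray2 gap)
qed

end
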